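(* Let $e$ and $n$ be positive integers. For all $g\in G(e,e,n+1)$, we have $g\in P_G$ if and only if $g\preccurlyeq_T c$.
   Context: Partitions. $\mu_d\subset\mathbb{C}$ is the group of $d$-th roots of unity, $\zeta_d=\exp(2i\pi/d)$. For finite $x\subset\mathbb{C}$, $NCP_x$ is the set of partitions of $x$ such that any two parts whose convex hulls intersect are equal. $NCP(e,1,n)$ is the set of elements of $NCP_{\mu_{en}}$ invariant under multiplication by $\mu_e$. For $u\in NCP_{\mu_{en}\cup\{0\}}$, $u^\flat$ is its restriction to $\mu_{en}$; $NCP(e,e,n+1):=\{u\in NCP_{\mu_{en}\cup\{0\}}\mid u^\flat\in NCP(e,1,n)\}$. An element of $NCP(e,1,n)$ is long if $0$ lies in the convex hull of one of its parts (the long part), short otherwise. $u\in NCP(e,e,n+1)$ is long symmetric if $u^\flat$ is long (then the part of $u$ containing $0$ is the long part of $u^\flat$ together with $0$, and is called the long part of $u$); short symmetric if $u^\flat$ is short and $\{0\}$ is a part of $u$; asymmetric if $u^\flat$ is short and $\{0\}$ is not a part of $u$. Group. $G(e,e,n+1)\subset GL_{n+1}(\mathbb{C})$ is generated by the permutation matrices and the diagonal matrices with entries in $\mu_e$ and determinant $1$. It acts on $\mathbb{C}^{n+1}$ with coordinates $X_0,\dots,X_n$. Let $x_0=(0,\zeta_{en},\zeta_{en}^2,\dots,\zeta_{en}^n)$; its stabiliser in $G(e,e,n+1)$ is trivial, and its orbit is the set of vectors whose coordinates are $0$ and a set of representatives of $\mu_{en}/\mu_e$ (in any order). $c\in G(e,e,n+1)$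 is the element $c(X_0,X_1,\dots,X_n)=(\zeta_e^{-1}X_0,X_2,X_3,\dots,X_n,\zeta_eX_1)$. Elements $g_u$. For $u\in NCP(e,e,n+1)$ and $z\in\mu_{en}\cup\{0\}$ let $z'$ be the successor of $z$ in the counterclockwise order of the part of $u$ containing $z$; for the long part of a long symmetric $u$, use the counterclockwise order of its non-zero elements and set $0':=0$. If $u$ is asymmetric, the special index is the $j\in\{1,\dots,n\}$ such that the unique $z\in\mu_{en}$ with $z'=0$ lies in $\mu_e\zeta_{en}^j$; if $u$ is symmetric there is no special index. Then $g_u$ is the unique element of $G(e,e,n+1)$ such that $g_u(x_0)=(0',y_1,\dots,y_n)$, where $y_j=0$ if $j$ is special and $y_j=(\zeta_{en}^j)'$ otherwise. $P_G:=\{g_u\mid u\in NCP(e,e,n+1)\}$. Order $\preccurlyeq_T$. $T$ is the set of all reflections in $G(e,e,n+1)$. $\mathrm{Red}_T(h)$ is the set of minimal length sequences $(t_1,\dots,t_k)$ in $T$ with $h=t_1\cdots t_k$. $g\preccurlyeq_T h$ means that there are $(t_1,\dots,t_k)\in\mathrm{Red}_T(h)$ and $l\leq k$ with $g=t_1\cdots t_l$.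
   Formalization: Proved for e at least 2 rather than all positive e: for e = 1 the claim fails for every n, since the partition whose only non-singleton part is {0,1} gives an element of P_G exchanging X_0 and X_n, while every element below c fixes X_0. *)

theory Defs
  imports
    "HOL-Analysis.Convex"
    "HOL-Algebra.Generated_Groups"
    "HOL-Library.Disjoint_Sets"
    "HOL-Combinatorics.Permutations"
    "Jordan_Normal_Form.Matrix_Kernel"
begin

section \<open>Non-crossing partitions\<close>

definition mu :: "nat \<Rightarrow> complex set" where
  "mu d = {z. z ^ d = 1}"

definition zeta :: "nat \<Rightarrow> complex" where
  "zeta d = exp (2 * \<i> * complex_of_real pi / of_nat d)"

definition NCP :: "complex set \<Rightarrow> complex set set set" where
  "NCP x = {u. partition_on x u \<and>
     (\<forall>p\<in>u. \<forall>q\<in>u. convex hull p \<inter> convex hull q \<noteq> {} \<longrightarrow> p = q)}"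

text \<open>\<open>NCP_e1 e n\<close> is $NCP(e,1,n)$ and \<open>NCP_ee e n\<close> is $NCP(e,e,n+1)$.\<close>

definition NCP_e1 :: "nat \<Rightarrow> nat \<Rightarrow> complex set set set" where
  "NCP_e1 e n = {u \<in> NCP (mu (e * n)). \<forall>\<omega>\<in>mu e. (\<lambda>p. (*) \<omega> ` p) ` u = u}"

definition flat :: "nat \<Rightarrow> nat \<Rightarrow> complex set set \<Rightarrow> complex set set" where
  "flat e n u = {p \<inter> mu (e * n) | p. p \<in> u \<and> p \<inter> mu (e * n) \<noteq> {}}"

definition NCP_ee :: "nat \<Rightarrow> nat \<Rightarrow> complex set set set" where
  "NCP_ee e n = {u \<in> NCP (mu (e * n) \<union> {0}). flat e n u \<in> NCP_e1 e n}"

definition long :: "complex set set \<Rightarrow> bool" where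
  "long v \<longleftrightarrow> (\<exists>p\<in>v. 0 \<in> convex hull p)"

definition long_symmetric :: "nat \<Rightarrow> nat \<Rightarrow> complex set set \<Rightarrow> bool" where
  "long_symmetric e n u \<longleftrightarrow> long (flat e n u)"

definition short_symmetric :: "nat \<Rightarrow> nat \<Rightarrow> complex set set \<Rightarrow> bool" where
  "short_symmetric e n u \<longleftrightarrow> \<not> long (flat e n u) \<and> {0} \<in> u"

definition asymmetric :: "nat \<Rightarrow> nat \<Rightarrow> complex set set \<Rightarrow> bool" where
  "asymmetric e n u \<longleftrightarrow> \<not> long (flat e n u) \<and> {0} \<notin> u"

section \<open>The group $G(e,e,n+1)$\<close>

text \<open>Rows and columns of matrices are indexed by $0,\dots,n$, like the coordinates
  $X_0,\dots,X_n$; the group acts on column vectors by \<open>(*\<^sub>v)\<close>.\<close>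

definition GL :: "nat \<Rightarrow> complex mat monoid" where
  "GL m = units_of (ring_mat TYPE(complex) m ())"

definition permutation_matrices :: "nat \<Rightarrow> complex mat set" where
  "permutation_matrices m =
     {mat m m (\<lambda>(i, j). if i = \<sigma> j then 1 else 0) | \<sigma>. \<sigma> permutes {..<m}}"

definition special_diagonal_matrices :: "nat \<Rightarrow> nat \<Rightarrow> complex mat set" where
  "special_diagonal_matrices e m =
     {D \<in> carrier_mat m m. diagonal_mat D \<and> (\<forall>i<m. D $$ (i, i) \<in> mu e) \<and> det D = 1}"

definition G_ee :: "nat \<Rightarrow> nat \<Rightarrow> complex mat set" where
  "G_ee e n = generate (GL (n + 1))
     (permutation_matrices (n + 1) \<union> special_diagonal_matrices e (n + 1))"

definition x0 :: "nat \<Rightarrow> nat \<Rightarrow> complex vec" where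
  "x0 e n = vec (n + 1) (\<lambda>j. if j = 0 then 0 else zeta (e * n) ^ j)"

definition c_elt :: "nat \<Rightarrow> nat \<Rightarrow> complex mat" where
  "c_elt e n = mat (n + 1) (n + 1) (\<lambda>(i, j).
     if i = 0 then (if j = 0 then inverse (zeta e) else 0)
     else if i = n then (if j = 1 then zeta e else 0)
     else (if j = i + 1 then 1 else 0))"

lemma c_elt_mult_vec:
  assumes "n \<ge> 1" and X: "X \<in> carrier_vec (n + 1)"
  shows "c_elt e n *\<^sub>v X = vec (n + 1) (\<lambda>i.
     if i = 0 then inverse (zeta e) * X $ 0
     else if i = n then zeta e * X $ 1
     else X $ (i + 1))"
proof (rule eq_vecI)
  fix i assume "i < dim_vec (vec (n + 1) (\<lambda>i.
     if i = 0 then inverse (zeta e) * X $ 0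
     else if i = n then zeta e * X $ 1
     else X $ (i + 1)))"
  then have i: "i < n + 1" by simp
  have "(c_elt e n *\<^sub>v X) $ i = (\<Sum>j = 0..<n + 1. c_elt e n $$ (i, j) * X $ j)"
    using i X by (auto simp: c_elt_def scalar_prod_def)
  also have "\<dots> = (\<Sum>j = 0..<n + 1.
      if j = (if i = 0 then 0 else if i = n then 1 else i + 1)
      then (if i = 0 then inverse (zeta e) else if i = n then zeta e else 1) * X $ j else 0)"
    using i by (intro sum.cong) (auto simp: c_elt_def)
  also have "\<dots> = (if i = 0 then inverse (zeta e) * X $ 0
     else if i = n then zeta e * X $ 1 else X $ (i + 1))"
    using i assms(1) by (subst sum.delta) auto
  finally show "(c_elt e n *\<^sub>v X) $ i = vec (n + 1) (\<lambda>i.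
     if i = 0 then inverse (zeta e) * X $ 0
     else if i = n then zeta e * X $ 1
     else X $ (i + 1)) $ i" using i by simp
qed (simp add: c_elt_def)

section \<open>The elements $g_u$\<close>

text \<open>For a finite set \<open>p\<close> in convex position, the successor of \<open>z\<close> in the counterclockwise
  (cyclic) order is the end point \<open>w\<close> of the edge of the polygon \<open>convex hull p\<close> that leaves \<open>z\<close>
  counterclockwise: no point of \<open>p\<close> lies strictly to the right of the directed line from
  \<open>z\<close> to \<open>w\<close>. The sets to which \<open>ccw_succ\<close> is applied below are in convex position: they are
  subsets of the unit circle, possibly with \<open>0\<close> added when \<open>0\<close> is not in the convex hull
  of the rest.\<close>

definition ccw_succ :: "complex set \<Rightarrow> complex \<Rightarrow> complex" where
  "ccw_succ p z = (if p = {z} then z else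
     (THE w. w \<in> p - {z} \<and> (\<forall>v\<in>p. Im (cnj (w - z) * (v - z)) \<ge> 0)))"

text \<open>\<open>nxt e n u z\<close> is $z'$. When \<open>u\<close> is long symmetric, its long part is the one
  containing \<open>0\<close>.\<close>

definition nxt :: "nat \<Rightarrow> nat \<Rightarrow> complex set set \<Rightarrow> complex \<Rightarrow> complex" where
  "nxt e n u z = (let p = (THE p. p \<in> u \<and> z \<in> p) in
     if long_symmetric e n u \<and> 0 \<in> p
     then (if z = 0 then 0 else ccw_succ (p - {0}) z)
     else ccw_succ p z)"

definition is_special_index :: "nat \<Rightarrow> nat \<Rightarrow> complex set set \<Rightarrow> nat \<Rightarrow> bool" where
  "is_special_index e n u j \<longleftrightarrow> asymmetric e n u \<and> j \<in> {1..n} \<and>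
     (THE z. z \<in> mu (e * n) \<and> nxt e n u z = 0) \<in> (\<lambda>\<omega>. \<omega> * zeta (e * n) ^ j) ` mu e"

definition g_elt :: "nat \<Rightarrow> nat \<Rightarrow> complex set set \<Rightarrow> complex mat" where
  "g_elt e n u = (THE g. g \<in> G_ee e n \<and>
     g *\<^sub>v x0 e n = vec (n + 1) (\<lambda>j.
       if j = 0 then nxt e n u 0
       else if is_special_index e n u j then 0
       else nxt e n u (zeta (e * n) ^ j)))"

definition P_G :: "nat \<Rightarrow> nat \<Rightarrow> complex mat set" where
  "P_G e n = g_elt e n ` NCP_ee e n"

section \<open>The order defined by reduced reflection factorisations\<close>

text \<open>A reflection is an element whose fixed space is a hyperplane of $\mathbb{C}^{n+1}$;
  all elements of \<open>G_ee e n\<close> have finite order when \<open>e > 0\<close>.\<close>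

definition refls :: "nat \<Rightarrow> nat \<Rightarrow> complex mat set" where
  "refls e n = {t \<in> G_ee e n. kernel_dim (t - 1\<^sub>m (n + 1)) = n}"

definition mat_prod :: "nat \<Rightarrow> complex mat list \<Rightarrow> complex mat" where
  "mat_prod n ts = foldr (*) ts (1\<^sub>m (n + 1))"

definition Red_T :: "nat \<Rightarrow> nat \<Rightarrow> complex mat \<Rightarrow> complex mat list set" where
  "Red_T e n h = {ts. set ts \<subseteq> refls e n \<and> mat_prod n ts = h \<and>
     (\<forall>ss. set ss \<subseteq> refls e n \<and> mat_prod n ss = h \<longrightarrow> length ts \<le> length ss)}"

definition le_T :: "nat \<Rightarrow> nat \<Rightarrow> complex mat \<Rightarrow> complex mat \<Rightarrow> bool" where
  "le_T e n g h \<longleftrightarrow> (\<exists>ts \<in> Red_T e n h. \<exists>l \<le> length ts. g = mat_prod n (take l ts))"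

text \<open>The equivalence of \<open>g \<in> P_G e n\<close> and \<open>le_T e n g (c_elt e n)\<close> fails for every \<open>n \<ge> 1\<close>
  when \<open>e = 1\<close>: \<open>c_elt 1 n\<close> is then the matrix of an \<open>n\<close>-cycle fixing $X_0$, so that every
  \<open>g\<close> below it fixes $X_0$, whereas the partition whose only non-singleton part is
  \<open>{0, 1}\<close> is asymmetric and yields the transposition of $X_0$ and $X_n$. The parameter
  \<open>e\<close> therefore has to be at least \<open>2\<close>.\<close>

end

theory Submission
  imports "HOL-Analysis.Convex_Euclidean_Space" Defs
begin

unbundle no vec_syntax

text \<open>
  The group acts on the multiples of the coordinate forms by \<open>mu e\<close>; these are realised as the set
  of points $\mu_{en} \cup 2\mu_e$, the circle of radius 2 standing for the multiples of $X_0$. An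
  element then becomes an equivariant permutation of this set, right multiplication by a
  reflection becomes composition with an exchange of two $\mu_e$-orbits, and $g_u$ becomes the
  successor map of \<open>u\<close>. Splitting off an arc of a part of \<open>u\<close>, or replacing the long part by its
  intersection with a window of \<open>n\<close> consecutive positions (and the rotations of it) together
  with 0, composes the successor map with one exchange of orbits and adds one to the dimension of
  the fixed space.

  Since \<open>c\<close> fixes no nonzero vector, it is not a product of fewer than \<open>n + 1\<close> reflections, and in a
  factorisation into \<open>n + 1\<close> reflections the linear forms of the hyperplanes are independent.
  If \<open>u\<close> refines \<open>v\<close>, some move on \<open>v\<close> is still refined by \<open>u\<close>; a chain of moves from the partition with one
  part through \<open>u\<close> to the partition into points is therefore a reduced factorisation of \<open>c\<close>, with
  $g_u$ as a partial product. Conversely, if a prefix of a reduced factorisation is $g_u$, independence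
  provides a vector fixed by the next shorter prefix but not by the reflection that is removed.
  Following the coordinates of this vector along the cycles of $g_u$ shows that this reflection
  is one of the moves on \<open>u\<close>.
\<close>

section \<open>Planar geometry\<close>

text \<open>Composing a permutation of \<open>Omega\<close> with an exchange may split cycles or
  fuse them. The fixed vector decides which happens: its coordinates form an equivariant function
  \<open>F\<close> with \<open>F x \<noteq> F y\<close>. Follow \<open>x\<close> and
  \<open>y\<close> to their first return to one of the two orbits. Invariance of \<open>F\<close>
  leaves two possibilities. Either one point reaches the other exactly, with weight 1, and the path
  between them is an arc to split off; or both return to their own orbits with weights different
  from 1. Such weights occur only on the cycles of a long part and of the circle of radius 2, so the
  exchange is the one that breaks up the long part.

  Lengths are controlled by inequalities only. \<open>rank\<close> is at most \<open>e * dm\<close>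
  and every move raises it by at least \<open>e\<close>, so a chain of moves ending at the partition
  into points is short enough; independence of the linear forms gives the matching lower bound
  \<open>dm\<close>.

  The condition e \<ge> 2 enters in two forms: \<open>zeta e \<noteq> 1\<close>, and 2n \<le> N, by
  which n consecutive positions span an angle less than \<pi>.\<close>

definition orient :: "complex \<Rightarrow> complex \<Rightarrow> complex \<Rightarrow> real" where
  "orient a b v = Im (cnj (b - a) * (v - a))"

text \<open>\<open>orient a b v\<close> is the quantity in \<open>ccw_succ\<close>: twice the signed
  area of the triangle, positive when it runs counterclockwise. As a product of sines of half
  differences its sign is visible, since each factor is positive for a difference strictly between 0
  and 2 \<pi>.\<close>

lemma orient_cis:
  "orient (cis \<alpha>) (cis \<beta>) (cis \<gamma>) =
     4 * sin ((\<beta> - \<alpha>) / 2) * sin ((\<gamma> - \<alpha>) / 2) * sin ((\<gamma> - \<beta>) / 2)"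
proof -
  define p q where "p = (\<beta> - \<alpha>) / 2" and "q = (\<gamma> - \<alpha>) / 2"
  have 1: "\<beta> = \<alpha> + 2 * p" "\<gamma> = \<alpha> + 2 * q" by (auto simp: p_def q_def field_simps)
  have "orient (cis \<alpha>) (cis \<beta>) (cis \<gamma>) = sin (\<gamma> - \<beta>) - sin (\<alpha> - \<beta>) - sin (\<gamma> - \<alpha>)"
    by (simp add: orient_def sin_diff algebra_simps)
  also have "\<dots> = sin (2 * (q - p)) + sin (2 * p) - sin (2 * q)"
  proof -
    have "\<gamma> - \<beta> = 2 * (q - p)" "\<alpha> - \<beta> = - (2 * p)" "\<gamma> - \<alpha> = 2 * q" by (simp_all add: 1)
    then show ?thesis by (metis diff_minus_eq_add sin_minus)
  qed
  also have "\<dots> = 2 * sin (q - p) * (cos (q - p) - cos (p + q))"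
  proof -
    have "(2 * p - 2 * q) / 2 = - (q - p)" "(2 * p + 2 * q) / 2 = p + q" by simp_all
    then have "sin (2 * p) - sin (2 * q) = 2 * sin (- (q - p)) * cos (p + q)"
      using sin_diff_sin[of "2 * p" "2 * q"] by metis
    then have "sin (2 * p) - sin (2 * q) = - 2 * sin (q - p) * cos (p + q)"
      unfolding sin_minus by simp
    then show ?thesis unfolding sin_double by (simp add: algebra_simps)
  qed
  also have "\<dots> = 4 * sin p * sin q * sin (q - p)"
    by (simp add: cos_diff cos_add algebra_simps)
  finally show ?thesis by (simp add: p_def q_def diff_divide_distrib[symmetric])
qed

lemma orient_mult: "orient (c * a) (c * b) (c * v) = (cmod c)\<^sup>2 * orient a b v"
proof -
  have "cnj (c * b - c * a) * (c * v - c * a) = (c * cnj c) * (cnj (b - a) * (v - a))"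
    by (simp add: algebra_simps)
  also have "c * cnj c = of_real ((cmod c)\<^sup>2)" by (metis complex_norm_square of_real_power)
  finally show ?thesis unfolding orient_def by simp
qed

lemma orient_halfplanes:
  "convex {v. orient a b v < 0}" "convex {v. orient a b v > 0}"
proof -
  \<comment> \<open>The direction \<open>b - a\<close> turned by a right angle;
    \<open>orient a b\<close> is an affine function with this normal.\<close>
  define m where "m = Complex (- Im (b - a)) (Re (b - a))"
  have 1: "orient a b v = inner m v - inner m a" for v
    by (simp add: orient_def m_def inner_complex_def algebra_simps)
  show "convex {v. orient a b v < 0}" "convex {v. orient a b v > 0}"
    using convex_halfspace_lt[of m "inner m a"] convex_halfspace_gt[of "inner m a" m]
    by (auto simp: 1)
qed

lemma segments_cross:
  assumes "orient a b x < 0" "orient a b y > 0" "orient x y a > 0" "orient x y b < 0"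
  shows "convex hull {a, b} \<inter> convex hull {x, y} \<noteq> {}"
proof -
  define s where "s = orient a b y - orient a b x"
  \<comment> \<open>The zero of the affine function \<open>orient a b\<close> on the segment from
    \<open>x\<close> to \<open>y\<close>. The identity below exhibits the same point on the segment
    from \<open>a\<close> to \<open>b\<close>.\<close>
  define p where "p = (of_real (orient a b y / s) * x + of_real (- orient a b x / s) * y)"
  have s: "s > 0" using assms by (simp add: s_def)
  have s': "s = orient x y a - orient x y b"
    by (simp add: s_def orient_def algebra_simps)
  have "of_real (orient a b y) * x - of_real (orient a b x) * y =
    of_real (orient x y a) * b - of_real (orient x y b) * a"
    by (simp add: complex_eq_iff orient_def algebra_simps)
  then have "of_real s * p = of_real s * (of_real (- orient x y b / s) * a + of_real (orient x y a
    / s) * b)"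
    using s unfolding p_def by (simp add: algebra_simps)
  then have p': "p = of_real (- orient x y b / s) * a + of_real (orient x y a / s) * b"
    using s by simp
  have "p \<in> convex hull {x, y}" unfolding convex_hull_2 
    by (rule CollectI, rule exI[of _ "orient a b y / s"], rule exI[of _ "- orient a b x / s"])
      (use s assms in \<open>auto simp: p_def scaleR_conv_of_real s_def add_divide_distrib[symmetric]
        diff_divide_distrib[symmetric] intro!: divide_nonneg_pos divide_nonpos_pos\<close>)
  moreover have "p \<in> convex hull {a, b}" unfolding convex_hull_2 
    by (rule CollectI, rule exI[of _ "- orient x y b / s"], rule exI[of _ "orient x y a / s"])
      (use s assms in \<open>auto simp: p' scaleR_conv_of_real s' add_divide_distrib[symmetric]
        diff_divide_distrib[symmetric] intro!: divide_nonneg_pos divide_nonpos_pos\<close>)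
  ultimately show ?thesis by blast
qed

section \<open>Roots of unity\<close>

text \<open>The case \<open>d = 0\<close> is included because division by 0 then makes both sides 1;
  so \<open>zeta_pow_order\<close> can be a rewrite rule without a positivity condition.\<close>

lemma zeta_power: "zeta d ^ k = cis (2 * pi * real k / real d)"
proof -
  have "zeta d = cis (2 * pi / real d)"
    unfolding zeta_def cis_conv_exp by (simp add: mult_ac)
  then show ?thesis by (simp add: DeMoivre mult_ac)
qed

lemma mu_eq: assumes "d > 0" shows "mu d = {zeta d ^ k | k. k < d}"
proof -
  have "mu d = (\<lambda>k. cis (2 * pi * real k / real d)) ` {..<d}"
    using bij_betw_roots_unity[OF assms] unfolding mu_def bij_betw_def by simp
  then show ?thesis by (auto simp: zeta_power)
qed

lemma zeta_pow_order [simp]: "zeta d ^ d = 1"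
  by (cases "d = 0") (auto simp: zeta_power)

lemma zeta_nz [simp]: "zeta d \<noteq> 0" unfolding zeta_def by simp

lemma zeta_inj: assumes "i < d" "j < d" "zeta d ^ i = zeta d ^ j" shows "i = j"
proof -
  have "inj_on (\<lambda>k. cis (2 * pi * real k / real d)) {..<d}"
    using bij_betw_roots_unity[of d] assms unfolding bij_betw_def by simp
  then show ?thesis using assms unfolding zeta_power inj_on_def by auto
qed

lemma mu_mult: "x \<in> mu d \<Longrightarrow> y \<in> mu d \<Longrightarrow> x * y \<in> mu d"
  and mu_inverse: "x \<in> mu d \<Longrightarrow> inverse x \<in> mu d"
  and mu_divide: "x \<in> mu d \<Longrightarrow> y \<in> mu d \<Longrightarrow> x / y \<in> mu d"
  and mu_one: "1 \<in> mu d"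
  and mu_norm: "d > 0 \<Longrightarrow> x \<in> mu d \<Longrightarrow> cmod x = 1"
  and mu_nz: "d > 0 \<Longrightarrow> x \<in> mu d \<Longrightarrow> x \<noteq> 0"
  and zeta_mu: "zeta d \<in> mu d"
  and mu_pow: "x \<in> mu d \<Longrightarrow> x ^ k \<in> mu d"
proof -
  show "x ^ k \<in> mu d" if "x \<in> mu d" for x k
  proof -
    have "(x ^ k) ^ d = (x ^ d) ^ k" by (simp add: power_mult[symmetric] mult.commute)
    then show ?thesis using that by (simp add: mu_def)
  qed
  show "cmod x = 1" if "d > 0" "x \<in> mu d" for x
    using that power_eq_1_iff[of x d] by (auto simp: mu_def)
qed (auto simp: mu_def power_mult_distrib power_inverse power_divide power_0_left)

lemma mu_finite: "d > 0 \<Longrightarrow> finite (mu d)" by (auto simp: mu_eq)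

lemma mu_card: "d > 0 \<Longrightarrow> card (mu d) = d"
  using bij_betw_roots_unity[of d] bij_betw_same_card unfolding mu_def by fastforce


lemma orient_same [simp]: "orient a a b = 0" "orient a b a = 0" "orient a b b = 0"
  by (simp_all add: orient_def algebra_simps)

lemma orient_cyc: "orient a b v = orient v a b" "orient a b v = - orient b a v"
  "orient a b v = - orient a v b"
  by (simp_all add: orient_def algebra_simps)

locale refl_group =
  fixes e n :: nat
  assumes e2: "2 \<le> e" and n1: "1 \<le> n"
begin

definition N :: nat where "N = e * n"
abbreviation "\<zeta> \<equiv> zeta N"

lemma N_pos [simp]: "0 < N" "0 < e" "0 < n" using e2 n1 by (auto simp: N_def)
text \<open>Here e \<ge> 2 becomes geometry: \<open>n\<close> consecutive positions span an angle
  less than \<pi>, so they lie in an open half plane, and \<open>0\<close> is strictly on one side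
  of every chord between two of them.\<close>

lemma N_ge: "2 * n \<le> N" using e2 by (simp add: N_def)
lemma n_less_N: "n < N" using N_ge n1 by linarith

lemma zeta_e: "zeta e = \<zeta> ^ n"
  using zeta_power[of e 1] e2 n1 by (simp add: zeta_power N_def)

lemma zeta_e_pow: "zeta e ^ k = \<zeta> ^ (n * k)"
  by (simp add: zeta_e power_mult)

lemma mu_e_sub: "\<omega> \<in> mu e \<Longrightarrow> \<omega> \<in> mu N"
  by (simp add: mu_def N_def power_mult)

lemma zeta_n_mu: "\<zeta> ^ (n * k) \<in> mu e"
  unfolding zeta_e_pow[symmetric] by (intro mu_pow zeta_mu)

lemma mu_e_nz: "\<omega> \<in> mu e \<Longrightarrow> \<omega> \<noteq> 0" using mu_nz[of e] by simp
lemma mu_N_nz: "\<omega> \<in> mu N \<Longrightarrow> \<omega> \<noteq> 0" using mu_nz[of N] by simp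

lemma mu_N_pow [intro]: "z \<in> mu N \<Longrightarrow> z * \<zeta> ^ k \<in> mu N"
  by (intro mu_mult mu_pow zeta_mu)

lemma mu_N_rot: "\<omega> \<in> mu e \<Longrightarrow> z \<in> mu N \<Longrightarrow> \<omega> * z \<in> mu N"
  using mu_e_sub mu_mult by blast

lemma pow_mod: "\<zeta> ^ (k mod N) = \<zeta> ^ k"
proof -
  have "\<zeta> ^ k = \<zeta> ^ (N * (k div N) + k mod N)" by simp
  also have "\<dots> = \<zeta> ^ (k mod N)" unfolding power_add power_mult by simp
  finally show ?thesis by simp
qed

lemma pos_ex:
  assumes "z \<in> mu N" "w \<in> mu N"
  shows "\<exists>k<N. w = z * \<zeta> ^ k"
proof -
  have "w / z \<in> mu N" using assms by (intro mu_divide)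
  then obtain k where "k < N" "w / z = \<zeta> ^ k" using mu_eq[of N] by auto
  then show ?thesis using mu_N_nz[OF assms(1)] by (auto simp: field_simps)
qed

lemma pos_inj: "z \<noteq> 0 \<Longrightarrow> i < N \<Longrightarrow> j < N \<Longrightarrow> z * \<zeta> ^ i = z * \<zeta> ^ j \<Longrightarrow> i = j"
  using zeta_inj[of i N j] by simp

lemma pos_eq: "z \<noteq> 0 \<Longrightarrow> z * \<zeta> ^ i = z * \<zeta> ^ j \<longleftrightarrow> i mod N = j mod N"
  using zeta_inj[of "i mod N" N "j mod N"] pow_mod[of i] pow_mod[of j] by auto

definition \<delta> :: real where "\<delta> = 2 * pi / real N"

lemma pow_cis: "\<zeta> ^ k = cis (real k * \<delta>)"
  by (simp add: zeta_power \<delta>_def mult_ac)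

lemma delta_pos: "\<delta> > 0" unfolding \<delta>_def using N_pos(1) by simp

lemma delta_step: "k < j \<Longrightarrow> real k * \<delta> + \<delta> \<le> real j * \<delta>"
  using mult_right_mono[of "real k + 1" "real j" \<delta>] delta_pos by (simp add: algebra_simps)

lemma delta_N: "real N * \<delta> = 2 * pi" unfolding \<delta>_def using N_pos(1) by simp

lemma orient_pos:
  assumes "z \<in> mu N" "i < j" "j < k" "k < N + i"
  shows "orient (z * \<zeta> ^ i) (z * \<zeta> ^ j) (z * \<zeta> ^ k) > 0"
proof -
  have z: "cmod z = 1" using assms(1) mu_norm[of N] by simp
  have s: "sin (\<delta> * (real b - real a) / 2) > 0" if "a < b" "b < N + a" for a b
  proof (rule sin_gt_zero)
    show "0 < \<delta> * (real b - real a) / 2" using that delta_pos by simp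
    have "\<delta> * (real b - real a) < \<delta> * real N"
      using that delta_pos by (intro mult_strict_left_mono) auto
    then show "\<delta> * (real b - real a) / 2 < pi" using delta_N by (simp add: mult.commute)
  qed
  show ?thesis
    unfolding orient_mult z pow_cis orient_cis
    using s[of i j] s[of i k] s[of j k] assms by (simp add: algebra_simps)
qed

text \<open>Turns the test in \<open>ccw_succ\<close> into a comparison of exponents: to the right
  of a chord lie only the positions strictly between its ends.\<close>

lemma orient_pos_iff1:
  assumes "z \<in> mu N" "j < k" "k < N" "i < N"
  shows "orient (z * \<zeta> ^ j) (z * \<zeta> ^ k) (z * \<zeta> ^ i) \<ge> 0 \<longleftrightarrow> \<not> (j < i \<and> i < k)"
proof -
  consider "i < j" | "i = j" | "j < i" "i < k" | "i = k" | "k < i" by linarith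
  then show ?thesis
  proof cases
    case 1 then show ?thesis using orient_pos[of z i j k]
      assms orient_cyc(1)[of "z * \<zeta> ^ j" "z * \<zeta> ^ k" "z * \<zeta> ^ i"] by simp
  next
    case 3 then show ?thesis using orient_pos[of z j i k] assms
      orient_cyc(2)[of "z * \<zeta> ^ j" "z * \<zeta> ^ k" "z * \<zeta> ^ i"]
        orient_cyc(1)[of "z * \<zeta> ^ k" "z * \<zeta> ^ j" "z * \<zeta> ^ i"]
          orient_cyc(1)[of  "z * \<zeta> ^ j" "z * \<zeta> ^ i" "z * \<zeta> ^ k"] by simp
  next
    case 5 then show ?thesis using orient_pos[of z j k i] assms by simp
  qed (use assms in auto)
qed

lemma orient_zero:
  assumes "z \<in> mu N"
  shows "orient 0 (z * \<zeta> ^ i) (z * \<zeta> ^ j) = sin ((real j - real i) * \<delta>)"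
proof -
  have z: "cmod z = 1" using assms(1) mu_norm[of N] by simp
  have "orient 0 (z * \<zeta> ^ i) (z * \<zeta> ^ j) = orient 0 (\<zeta> ^ i) (\<zeta> ^ j)"
    using orient_mult[of z 0 "\<zeta> ^ i" "\<zeta> ^ j"] z by simp
  also have "\<dots> = sin ((real j - real i) * \<delta>)"
    by (simp add: orient_def pow_cis left_diff_distrib sin_diff algebra_simps)
  finally show ?thesis .
qed

lemma orient_zero_pos:
  assumes "z \<in> mu N" "i < j" "j < n + i"
  shows "orient 0 (z * \<zeta> ^ i) (z * \<zeta> ^ j) > 0" "orient 0 (z * \<zeta> ^ j) (z * \<zeta> ^ i) < 0"
proof -
  have "(real j - real i) * \<delta> < real n * \<delta>" 
    using assms delta_pos by (intro mult_strict_right_mono) auto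
  also have "2 * (real n * \<delta>) \<le> real N * \<delta>"
    using N_ge delta_pos mult_right_mono[of "real (2 * n)" "real N" \<delta>] of_nat_mono[OF N_ge] by simp
  finally have "(real j - real i) * \<delta> < pi" using delta_N by simp
  then have s: "sin ((real j - real i) * \<delta>) > 0"
    using assms delta_pos by (intro sin_gt_zero) auto
  then show "orient 0 (z * \<zeta> ^ i) (z * \<zeta> ^ j) > 0" using assms by (simp add: orient_zero)
  have "(real i - real j) * \<delta> = - ((real j - real i) * \<delta>)" by (simp add: algebra_simps)
  then show "orient 0 (z * \<zeta> ^ j) (z * \<zeta> ^ i) < 0" 
    unfolding orient_zero[OF assms(1)] using s by simp
qed

lemma chords_cross:
  assumes "z \<in> mu N" "0 < i" "i < j" "j < k" "k < N"
  shows "convex hull {z, z * \<zeta> ^ j} \<inter> convex hull {z * \<zeta> ^ i, z * \<zeta> ^ k} \<noteq> {}"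
proof (rule segments_cross)
  let ?p = "\<lambda>i. z * \<zeta> ^ i"
  have 1: "orient z (?p i) (?p j) > 0" "orient z (?p j) (?p k) > 0" "orient (?p i) (?p j) (?p k) >
    0"
     "orient z (?p i) (?p k) > 0"
    using orient_pos[of z 0 i j] orient_pos[of z 0 j k] orient_pos[of z i j k]
      orient_pos[of z 0 i k] assms by simp_all
  show "orient z (?p j) (?p i) < 0" by (subst orient_cyc(3)) (use 1 in simp)
  show "orient z (?p j) (?p k) > 0" using 1 by simp
  show "orient (?p i) (?p k) z > 0" using 1 orient_cyc(1) by metis
  show "orient (?p i) (?p k) (?p j) < 0" by (subst orient_cyc(3)) (use 1 in simp)
qed

text \<open>As \<open>k < n\<close>, the angle at \<open>0\<close> is less than \<pi>; so
  \<open>0\<close> lies to the left of the chord from \<open>z\<close> to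
  \<open>z * \<zeta> ^ k\<close>, while the intermediate position lies to its right.\<close>

lemma chord_meets_ray:
  assumes "z \<in> mu N" "0 < i" "i < k" "k < n"
  shows "convex hull {0, z * \<zeta> ^ i} \<inter> convex hull {z, z * \<zeta> ^ k} \<noteq> {}"
proof (rule segments_cross)
  let ?p = "\<lambda>i. z * \<zeta> ^ i"
  have 1: "orient z (?p i) (?p k) > 0"
    using orient_pos[of z 0 i k] n_less_N assms by simp
  show "orient 0 (?p i) z < 0" "orient 0 (?p i) (?p k) > 0"
    using orient_zero_pos[of z 0 i] orient_zero_pos[of z i k] assms by simp_all
  have "orient 0 z (?p k) > 0" using orient_zero_pos[of z 0 k] assms by simp
  then show "orient z (?p k) 0 > 0" using orient_cyc(1) by metis
  show "orient z (?p k) (?p i) < 0" by (subst orient_cyc(3)) (use 1 in simp)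
qed

text \<open>The separating line passes a quarter step before \<open>a\<close> and a quarter step after \<open>a * \<zeta> ^ k\<close>.\<close>

lemma arc_hulls_disjoint:
  assumes a: "a \<in> mu N" and k: "k < N"
    and r: "r \<subseteq> {a * \<zeta> ^ i | i. i \<le> k}"
    and q: "q \<subseteq> {a * \<zeta> ^ i | i. k < i \<and> i < N} \<union> {0}"
    and z: "0 \<in> q \<Longrightarrow> 2 * k + 1 < N"
  shows "convex hull r \<inter> convex hull q = {}"
proof -
  define h where "h = \<delta> / 4"
  have h: "h > 0" using delta_pos by (simp add: h_def)
  define b c where "b = a * cis (- h)" and "c = a * cis (real k * \<delta> + h)"
  have na: "cmod a = 1" using a mu_norm[of N] by simp
  have kN: "real k * \<delta> + \<delta> \<le> real N * \<delta>"
    using delta_step[of k N] k by simp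
  have s0: "sin ((real k * \<delta> + h + h) / 2) > 0"
    using kN delta_N delta_pos h by (intro sin_gt_zero) (auto simp: h_def intro!: add_pos_nonneg)
  have o: "orient b c (a * \<zeta> ^ i) = 4 * sin ((real k * \<delta> + h + h) / 2) *
     sin ((real i * \<delta> + h) / 2) * sin ((real i * \<delta> - (real k * \<delta> + h)) / 2)" for i
    unfolding b_def c_def orient_mult na pow_cis orient_cis by simp
  have s1: "sin ((real i * \<delta> + h) / 2) > 0" if "i < N" for i
  proof -
    have "real i * \<delta> + \<delta> \<le> real N * \<delta>"
      using delta_step[of i N] that by simp
    then show ?thesis using delta_N delta_pos h
      by (intro sin_gt_zero) (auto simp: h_def intro!: add_nonneg_pos)
  qed
  have neg: "orient b c (a * \<zeta> ^ i) < 0" if "i \<le> k" for i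
  proof -
    have "real i * \<delta> \<le> real k * \<delta>" using that delta_pos by simp
    moreover have "0 \<le> real i * \<delta>" using delta_pos by simp
    moreover have "sin ((x - (y + d / 4)) / 2) < 0" if "x \<le> y" "0 \<le> x" "y + d \<le> 2 * pi" "0 < d"
      for x y d :: real
    proof -
      have "sin ((y + d / 4 - x) / 2) > 0" by (rule sin_gt_zero) (use that in \<open>simp_all add:
        field_simps\<close>)
      then show ?thesis using sin_minus[of "(y + d / 4 - x) / 2"] by (simp add: minus_divide_left)
    qed
    ultimately have "sin ((real i * \<delta> - (real k * \<delta> + h)) / 2) < 0" using kN delta_N delta_pos
      by (simp add: h_def)
    then show ?thesis unfolding o using s0 s1[of i] that k by (intro mult_pos_neg) auto
  qed
  have pos: "orient b c (a * \<zeta> ^ i) > 0" if "k < i" "i < N" for i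
  proof -
    have "real k * \<delta> + \<delta> \<le> real i * \<delta>"
      using delta_step[of k i] that by simp
    moreover have "real i * \<delta> \<le> real N * \<delta>" using that delta_pos by simp
    moreover have "0 \<le> real k * \<delta>" using delta_pos by simp
    moreover have "sin ((x - (y + d / 4)) / 2) > 0" if "y + d \<le> x" "x \<le> 2 * pi" "0 \<le> y" "0 < d"
      for x y d :: real
      by (rule sin_gt_zero) (use that in \<open>simp_all add: field_simps\<close>)
    ultimately have "sin ((real i * \<delta> - (real k * \<delta> + h)) / 2) > 0" using delta_N delta_pos
      by (simp add: h_def)
    then show ?thesis unfolding o using s0 s1[of i] that by simp
  qed
  \<comment> \<open>The chord from \<open>b\<close> to \<open>c\<close> subtends the angle
    \<open>k * \<delta> + \<delta> / 2\<close> at the centre, and \<open>2 * k + 1 < N\<close> says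
    exactly that this is less than \<pi>; then \<open>0\<close> is on the side of
    \<open>q\<close>.\<close>
  have "orient b c 0 > 0" if "2 * k + 1 < N"
  proof -
    have "orient b c 0 = orient 0 (cis (- h)) (cis (real k * \<delta> + h))"
      using orient_mult[of a 0 "cis (- h)" "cis (real k * \<delta> + h)"] na orient_cyc(1)[of b c 0]
        by (simp add: b_def c_def)
    also have "\<dots> = sin (real k * \<delta> + h + h)"
      by (simp add: orient_def cis_cnj cis_mult add_ac del: cis.simps) (simp add: add_ac)
    also have "\<dots> > 0"
    proof (rule sin_gt_zero)
      show "real k * \<delta> + h + h > 0" using delta_pos h by (intro add_nonneg_pos) auto
      have "(2 * real k + 1) * \<delta> < real N * \<delta>" 
        using that delta_pos by (intro mult_strict_right_mono) (auto simp flip: of_nat_Suc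
          of_nat_mult)
      then show "real k * \<delta> + h + h < pi" using delta_N by (simp add: h_def algebra_simps)
    qed
    finally show ?thesis .
  qed
  then have "q \<subseteq> {v. orient b c v > 0}" using q z pos by auto
  then have "convex hull q \<subseteq> {v. orient b c v > 0}" by (intro hull_minimal orient_halfplanes)
  moreover have "r \<subseteq> {v. orient b c v < 0}" using r neg by auto
  then have "convex hull r \<subseteq> {v. orient b c v < 0}" by (intro hull_minimal orient_halfplanes)
  ultimately show ?thesis by fastforce
qed

section \<open>Cyclic successors\<close>

text \<open>A singleton is its own successor: the least exponent is then \<open>N\<close>.\<close>

definition nxt_in :: "complex set \<Rightarrow> complex \<Rightarrow> complex" where
  "nxt_in p z = z * \<zeta> ^ (LEAST k. 0 < k \<and> z * \<zeta> ^ k \<in> p)"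

lemma nxt_in_ex:
  assumes "z \<in> p"
  shows "\<exists>k. 0 < k \<and> k \<le> N \<and> nxt_in p z = z * \<zeta> ^ k \<and> z * \<zeta> ^ k \<in> p \<and> (\<forall>i. 0 < i \<and>
    i < k \<longrightarrow> z * \<zeta> ^ i \<notin> p)"
proof -
  let ?P = "\<lambda>k. 0 < k \<and> z * \<zeta> ^ k \<in> p"
  have N: "?P N" using assms by simp
  show ?thesis
    by (rule exI[of _ "LEAST k. ?P k"])
      (use LeastI[of ?P, OF N] Least_le[of ?P, OF N] not_less_Least[of _ ?P]
        in \<open>auto simp: nxt_in_def\<close>)
qed

lemma nxt_in_eqI:
  assumes "0 < k" "z * \<zeta> ^ k \<in> p" "\<And>i. 0 < i \<Longrightarrow> i < k \<Longrightarrow> z * \<zeta> ^ i \<notin> p"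
  shows "nxt_in p z = z * \<zeta> ^ k"
proof -
  have "(LEAST k. 0 < k \<and> z * \<zeta> ^ k \<in> p) = k"
    by (rule Least_equality) (use assms in \<open>auto simp: not_less[symmetric]\<close>)
  then show ?thesis by (simp add: nxt_in_def)
qed

lemma nxt_in_in: "z \<in> p \<Longrightarrow> nxt_in p z \<in> p"
  using nxt_in_ex[of z p] by auto

lemma nxt_in_rot: "\<omega> \<noteq> 0 \<Longrightarrow> nxt_in ((*) \<omega> ` p) (\<omega> * z) = \<omega> * nxt_in p z"
proof -
  assume "\<omega> \<noteq> 0"
  then have "\<omega> * z * x \<in> (*) \<omega> ` p \<longleftrightarrow> z * x \<in> p" for x by (auto simp: mult.assoc)
  then show ?thesis by (simp add: nxt_in_def)
qed

lemma nxt_in_inj: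
  assumes p: "p \<subseteq> mu N" and z: "z \<in> p" and w: "w \<in> p" and eq: "nxt_in p z = nxt_in p w"
  shows "z = w"
proof -
  obtain k where k: "0 < k" "k \<le> N" "nxt_in p z = z * \<zeta> ^ k" "\<forall>i. 0 < i \<and> i < k \<longrightarrow> z * \<zeta> ^ i \<notin> p"
    using nxt_in_ex[OF z] by auto
  obtain l where l: "0 < l" "l \<le> N" "nxt_in p w = w * \<zeta> ^ l" "\<forall>i. 0 < i \<and> i < l \<longrightarrow> w * \<zeta> ^ i \<notin> p"
    using nxt_in_ex[OF w] by auto
  \<comment> \<open>Of two points with the same successor, the later one would be met on the way
    from the earlier one, against the minimality of the step.\<close>
  have *: "z = w * \<zeta> ^ (l - k)" if "k \<le> l" "z * \<zeta> ^ k = w * \<zeta> ^ l" for z w k l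
    using that by (simp flip: power_add add: power_diff field_simps)
  show ?thesis
  proof (cases "k \<le> l")
    case True
    have "z = w * \<zeta> ^ (l - k)" by (rule *[OF True]) (use k l eq in simp)
    then show ?thesis using l(1,4) k(1) True z by (cases "k = l") (auto dest: spec[of _ "l - k"])
  next
    case False
    have "w = z * \<zeta> ^ (k - l)" by (rule *) (use False k l eq in simp_all)
    then show ?thesis using k(1,4) l(1) w False by (auto dest: spec[of _ "k - l"])
  qed
qed

lemma ccw_succ_nxt_in:
  assumes p: "p \<subseteq> mu N" and z: "z \<in> p"
  shows "ccw_succ p z = nxt_in p z"
proof (cases "p = {z}")
  case True
  obtain k where "0 < k" "k \<le> N" "nxt_in p z = z * \<zeta> ^ k" "z * \<zeta> ^ k \<in> p"
    using nxt_in_ex[OF z] by auto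
  then show ?thesis using True by (simp add: ccw_succ_def)
next
  case False
  obtain k where k: "0 < k" "k \<le> N" "nxt_in p z = z * \<zeta> ^ k" "z * \<zeta> ^ k \<in> p" "\<And>i. 0 < i \<Longrightarrow> i < k \<Longrightarrow>
    z * \<zeta> ^ i \<notin> p"
    using nxt_in_ex[OF z] by auto
  have zN: "z \<in> mu N" using p z by auto
  have z0: "z \<noteq> 0" using zN mu_N_nz by auto
  have pos: "\<exists>i<N. v = z * \<zeta> ^ i \<and> (i = 0 \<longleftrightarrow> v = z)" if vp: "v \<in> p" for v
  proof -
    obtain i where "i < N" "v = z * \<zeta> ^ i" using pos_ex[OF zN, of v] vp p by blast
    then show ?thesis using pos_inj[OF z0, of i 0] by (intro exI[of _ i]) auto
  qed
  \<comment> \<open>A step of \<open>N\<close> would be a return to \<open>z\<close>, but another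
    point of \<open>p\<close> comes before that.\<close>
  have kN: "k < N"
  proof (rule ccontr)
    assume "\<not> k < N"
    then have "k = N" using k by simp
    obtain v where v: "v \<in> p" "v \<noteq> z" using False z by auto
    then obtain i where "i < N" "v = z * \<zeta> ^ i" "i \<noteq> 0" using pos by metis
    then show False using k(5)[of i] \<open>k = N\<close> v by auto
  qed
  have "(THE w. w \<in> p - {z} \<and> (\<forall>v\<in>p. orient z w v \<ge> 0)) = z * \<zeta> ^ k"
  proof (rule the_equality)
    have "z * \<zeta> ^ k \<noteq> z" using pos_inj[OF z0, of k 0] k kN by auto
    moreover have "orient z (z * \<zeta> ^ k) v \<ge> 0" if v: "v \<in> p" for v
    proof -
      obtain i where i: "i < N" "v = z * \<zeta> ^ i" using pos v by metis
      then show ?thesis using orient_pos_iff1[OF zN, of 0 k i] k kN v by auto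
    qed
    ultimately show "z * \<zeta> ^ k \<in> p - {z} \<and> (\<forall>v\<in>p. orient z (z * \<zeta> ^ k) v \<ge> 0)" using k by auto
  next
    fix w assume w: "w \<in> p - {z} \<and> (\<forall>v\<in>p. orient z w v \<ge> 0)"
    obtain j where j: "j < N" "w = z * \<zeta> ^ j" "j \<noteq> 0" using pos w by (metis Diff_iff singletonI)
    \<comment> \<open>A competitor \<open>w\<close> is tested against the true successor: if
      \<open>w\<close> came later, that successor would lie to the right of the edge to
      \<open>w\<close>.\<close>
    have "orient z w (z * \<zeta> ^ k) \<ge> 0" using w k by auto
    then have "\<not> (0 < k \<and> k < j)" using orient_pos_iff1[OF zN, of 0 j k] j kN by simp
    moreover have "\<not> j < k" using k(5)[of j] j w by auto
    ultimately show "w = z * \<zeta> ^ k" using k j by (cases "j = k") auto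
  qed
  then show ?thesis using False k by (simp add: ccw_succ_def orient_def)
qed

text \<open>A window is shorter than the circle, so its points determine their exponents. The cyclic
  order of \<open>Z\<close> is therefore the order of exponents, and only the last point wraps
  around to \<open>f\<close>.\<close>

lemma window_nxt_in:
  assumes Z: "Z \<subseteq> {f * \<zeta> ^ i | i. i < n}" and f: "f \<in> Z" "f \<in> mu N" and j: "j < n" "f * \<zeta> ^ j \<in> Z"
  shows "nxt_in Z (f * \<zeta> ^ j) = f \<longleftrightarrow> (\<forall>i. j < i \<and> i < n \<longrightarrow> f * \<zeta> ^ i \<notin> Z)"
    and "\<not> (\<forall>i. j < i \<and> i < n \<longrightarrow> f * \<zeta> ^ i \<notin> Z) \<Longrightarrow>
      \<exists>k. j < k \<and> k < n \<and> nxt_in Z (f * \<zeta> ^ j) = f * \<zeta> ^ k \<and> f * \<zeta> ^ k \<in> Z \<and> (\<forall>i. j < i \<and>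
        i < k \<longrightarrow> f * \<zeta> ^ i \<notin> Z)"
proof -
  have f0: "f \<noteq> 0" using f mu_N_nz by auto
  have mem: "\<exists>i<n. f * \<zeta> ^ m = f * \<zeta> ^ i \<and> m mod N = i" if "f * \<zeta> ^ m \<in> Z" for m
  proof -
    obtain i where "i < n" "f * \<zeta> ^ m = f * \<zeta> ^ i" using Z \<open>f * \<zeta> ^ m \<in> Z\<close> by auto
    then show ?thesis using pos_eq[OF f0, of m i] n_less_N by auto
  qed
  have 1: "nxt_in Z (f * \<zeta> ^ j) = f" if a: "\<forall>i. j < i \<and> i < n \<longrightarrow> f * \<zeta> ^ i \<notin> Z"
  proof -
    have "nxt_in Z (f * \<zeta> ^ j) = f * \<zeta> ^ j * \<zeta> ^ (N - j)"
    proof (rule nxt_in_eqI)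
      show "0 < N - j" using j n_less_N by simp
      have "f * \<zeta> ^ j * \<zeta> ^ (N - j) = f" using j n_less_N by (simp flip: power_add add: mult.assoc)
      then show "f * \<zeta> ^ j * \<zeta> ^ (N - j) \<in> Z" using f(1) by (simp only:)
      fix i assume i: "0 < i" "i < N - j"
      show "f * \<zeta> ^ j * \<zeta> ^ i \<notin> Z"
      proof
        assume "f * \<zeta> ^ j * \<zeta> ^ i \<in> Z"
        then have "f * \<zeta> ^ (j + i) \<in> Z" by (simp add: power_add mult.assoc)
        then show False using mem[of "j + i"] a i by auto
      qed
    qed
    also have "\<dots> = f" using j n_less_N by (simp flip: power_add add: mult.assoc)
    finally show ?thesis .
  qed
  show 2: "\<exists>k. j < k \<and> k < n \<and> nxt_in Z (f * \<zeta> ^ j) = f * \<zeta> ^ k \<and> f * \<zeta> ^ k \<in> Z \<and> (\<forall>i. j < i \<and>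
    i < k \<longrightarrow> f * \<zeta> ^ i \<notin> Z)"
    if a: "\<not> (\<forall>i. j < i \<and> i < n \<longrightarrow> f * \<zeta> ^ i \<notin> Z)"
  proof -
    define k where "k = (LEAST i. j < i \<and> i < n \<and> f * \<zeta> ^ i \<in> Z)"
    have k: "j < k \<and> k < n \<and> f * \<zeta> ^ k \<in> Z" unfolding k_def by (rule LeastI_ex) (use a in auto)
    have kl: "f * \<zeta> ^ i \<notin> Z" if "j < i" "i < k" for i
      using not_less_Least[of i "\<lambda>i. j < i \<and> i < n \<and> f * \<zeta> ^ i \<in> Z"] that k unfolding k_def by auto
    have "nxt_in Z (f * \<zeta> ^ j) = f * \<zeta> ^ j * \<zeta> ^ (k - j)"
    proof (rule nxt_in_eqI)
      show "0 < k - j" "f * \<zeta> ^ j * \<zeta> ^ (k - j) \<in> Z" using k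
        by (simp_all flip: power_add add: mult.assoc)
      show "f * \<zeta> ^ j * \<zeta> ^ i \<notin> Z" if "0 < i" "i < k - j" for i
        using kl[of "j + i"] that by (simp add: power_add mult.assoc)
    qed
    also have "\<dots> = f * \<zeta> ^ k" using k by (simp flip: power_add add: mult.assoc)
    finally show ?thesis using k kl by auto
  qed
  show "nxt_in Z (f * \<zeta> ^ j) = f \<longleftrightarrow> (\<forall>i. j < i \<and> i < n \<longrightarrow> f * \<zeta> ^ i \<notin> Z)"
  proof
    assume c: "nxt_in Z (f * \<zeta> ^ j) = f"
    show "\<forall>i. j < i \<and> i < n \<longrightarrow> f * \<zeta> ^ i \<notin> Z"
    proof (rule ccontr)
      assume "\<not> ?thesis"
      then obtain k where "j < k" "k < n" "f = f * \<zeta> ^ k" using 2 c by auto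
      then show False using pos_inj[OF f0, of k 0] n_less_N by simp
    qed
  qed (rule 1)
qed

text \<open>The points of a window lie in an open half plane, so \<open>0\<close> is a new corner of
  the polygon: it replaces the edge from the last point back to \<open>f\<close> by two edges
  through \<open>0\<close> and leaves the other edges alone.\<close>

lemma ccw_succ_window:
  assumes Z: "Z \<subseteq> {f * \<zeta> ^ i | i. i < n}" and f: "f \<in> Z" "f \<in> mu N"
  shows "ccw_succ (insert 0 Z) 0 = f"
    and "z \<in> Z \<Longrightarrow> ccw_succ (insert 0 Z) z = (if nxt_in Z z = f then 0 else nxt_in Z z)"
proof -
  have f0: "f \<noteq> 0" using f mu_N_nz by auto
  have nz: "f * \<zeta> ^ i \<noteq> 0" for i using f0 by simp
  have Z0: "0 \<notin> Z" using Z nz by auto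
  have mem: "\<exists>i<n. v = f * \<zeta> ^ i" if "v \<in> Z" for v using Z that by auto
  have "(THE w. w \<in> insert 0 Z - {0} \<and> (\<forall>v\<in>insert 0 Z. orient 0 w v \<ge> 0)) = f"
  proof (rule the_equality)
    have "orient 0 f v \<ge> 0" if v: "v \<in> Z" for v
    proof -
      obtain i where "i < n" "v = f * \<zeta> ^ i" using mem v by auto
      then show ?thesis using orient_zero_pos(1)[OF f(2), of 0 i] by (cases "i = 0") auto
    qed
    then show "f \<in> insert 0 Z - {0} \<and> (\<forall>v\<in>insert 0 Z. orient 0 f v \<ge> 0)" using f f0 by auto
  next
    fix w assume w: "w \<in> insert 0 Z - {0} \<and> (\<forall>v\<in>insert 0 Z. orient 0 w v \<ge> 0)"
    then obtain i where i: "i < n" "w = f * \<zeta> ^ i" using mem by auto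
    have "orient 0 w f \<ge> 0" using w f by auto
    then show "w = f" using orient_zero_pos(2)[OF f(2), of 0 i] i by (cases "i = 0") auto
  qed
  moreover have "insert 0 Z \<noteq> {0}" using f f0 by auto
  ultimately show "ccw_succ (insert 0 Z) 0 = f"
    by (simp only: ccw_succ_def orient_def[symmetric] if_False)
  assume z: "z \<in> Z"
  then obtain j where j: "j < n" "z = f * \<zeta> ^ j" using mem by auto
  have o0: "orient z (f * \<zeta> ^ k) 0 = orient 0 z (f * \<zeta> ^ k)" for k by (rule orient_cyc(1))
  have "(THE w. w \<in> insert 0 Z - {z} \<and> (\<forall>v\<in>insert 0 Z. orient z w v \<ge> 0)) = (if nxt_in Z z = f
    then 0 else nxt_in Z z)"
  proof (cases "\<forall>i. j < i \<and> i < n \<longrightarrow> f * \<zeta> ^ i \<notin> Z")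
    case True
    have "(THE w. w \<in> insert 0 Z - {z} \<and> (\<forall>v\<in>insert 0 Z. orient z w v \<ge> 0)) = 0"
    proof (rule the_equality)
      have "orient z 0 v \<ge> 0" if v: "v \<in> Z" for v
      proof -
        obtain i where i: "i < n" "v = f * \<zeta> ^ i" using mem v by auto
        then have "i \<le> j" using True v by (meson not_le)
        moreover have "orient z 0 v = orient 0 v z" using orient_cyc(1) by metis
        ultimately show ?thesis using orient_zero_pos(1)[OF f(2), of i j] i j
          by (cases "i = j") auto
      qed
      then show "0 \<in> insert 0 Z - {z} \<and> (\<forall>v\<in>insert 0 Z. orient z 0 v \<ge> 0)" using z Z0 by auto
    next
      fix w assume w: "w \<in> insert 0 Z - {z} \<and> (\<forall>v\<in>insert 0 Z. orient z w v \<ge> 0)"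
      show "w = 0"
      proof (rule ccontr)
        assume "w \<noteq> 0"
        then obtain i where i: "i < n" "w = f * \<zeta> ^ i" using mem w by auto
        then have "i \<le> j" using True w by (metis Diff_iff insert_iff not_le nz)
        moreover have "i \<noteq> j" using i j w by auto
        moreover have "orient 0 z w \<ge> 0" using w o0[of i] i by auto
        ultimately show False using orient_zero_pos(2)[OF f(2), of i j] i j by auto
      qed
    qed
    then show ?thesis using window_nxt_in(1)[OF Z f j(1)] z j True by auto
  next
    case False
    then obtain k where k: "j < k" "k < n" "nxt_in Z z = f * \<zeta> ^ k" "f * \<zeta> ^ k \<in> Z" "\<And>i. j < i \<Longrightarrow>
      i < k \<Longrightarrow> f * \<zeta> ^ i \<notin> Z"
      using window_nxt_in(2)[OF Z f j(1)] z j by auto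
    have ne: "nxt_in Z z \<noteq> f" using k pos_inj[OF f0, of k 0] n_less_N by auto
    have "(THE w. w \<in> insert 0 Z - {z} \<and> (\<forall>v\<in>insert 0 Z. orient z w v \<ge> 0)) = f * \<zeta> ^ k"
    proof (rule the_equality)
      have "orient z (f * \<zeta> ^ k) v \<ge> 0" if v: "v \<in> Z" for v
      proof -
        obtain i where i: "i < n" "v = f * \<zeta> ^ i" using mem v by auto
        then show ?thesis using orient_pos_iff1[OF f(2), of j k i] k v n_less_N j by auto
      qed
      moreover have "orient z (f * \<zeta> ^ k) 0 \<ge> 0"
        using orient_zero_pos(1)[OF f(2), of j k] k j o0 by auto
      moreover have "f * \<zeta> ^ k \<noteq> z" using k j pos_inj[OF f0, of k j] n_less_N by auto
      ultimately show "f * \<zeta> ^ k \<in> insert 0 Z - {z} \<and> (\<forall>v\<in>insert 0 Z. orient z (f * \<zeta> ^ k) v \<ge> 0)"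
        using k by auto
    next
      fix w assume w: "w \<in> insert 0 Z - {z} \<and> (\<forall>v\<in>insert 0 Z. orient z w v \<ge> 0)"
      have "orient z 0 (f * \<zeta> ^ k) < 0"
        using orient_zero_pos(1)[OF f(2), of j k] k j o0[of k] orient_cyc(3)[of z 0 "f * \<zeta> ^ k"]
          by auto
      then have "w \<noteq> 0" using w k by (metis insertI2 not_le)
      then obtain i where i: "i < n" "w = f * \<zeta> ^ i" using mem w by auto
      then have ij: "i \<noteq> j" using w j by auto
      have "orient 0 z w \<ge> 0" using w o0[of i] i by auto
      then have "\<not> i < j" using orient_zero_pos(2)[OF f(2), of i j] i j by auto
      then have ij: "j < i" using ij by simp
      then have "\<not> i < k" using k(5)[of i] w i \<open>w \<noteq> 0\<close> by auto
      moreover have "orient z w (f * \<zeta> ^ k) \<ge> 0" using w k by auto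
      ultimately show "w = f * \<zeta> ^ k"
        using orient_pos_iff1[OF f(2), of j i k] i ij k n_less_N j by (cases "i = k") auto
    qed
    then show ?thesis using ne k by simp
  qed
  moreover have "insert 0 Z \<noteq> {z}" using z Z0 by auto
  ultimately show "ccw_succ (insert 0 Z) z = (if nxt_in Z z = f then 0 else nxt_in Z z)"
    by (simp only: ccw_succ_def orient_def[symmetric] if_False)
qed

text \<open>A line separates \<open>0\<close> from the hull, so \<open>P\<close> lies in an open
  half plane and has a first point \<open>f\<close> by angle. If \<open>P\<close> reached
  \<open>n\<close> or more steps beyond \<open>f\<close>, it would meet its rotation by
  \<open>zeta e\<close>, which is a shift by \<open>n\<close> steps.\<close>

lemma window_ex:
  assumes P: "P \<subseteq> mu N" "P \<noteq> {}" and z: "0 \<notin> convex hull P"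
    and d: "convex hull P \<inter> convex hull ((*) (zeta e) ` P) = {}"
  shows "\<exists>f\<in>P. P \<subseteq> {f * \<zeta> ^ i | i. i < n}"
proof -
  have fin: "finite P" using P mu_finite[of N] finite_subset by auto
  then have "closed (convex hull P)" by (simp add: compact_imp_closed
    finite_imp_compact_convex_hull)
  then obtain d where d0: "\<And>v. v \<in> convex hull P \<Longrightarrow> inner d v > 0"
    using separating_hyperplane_closed_0[of "convex hull P"] z convex_convex_hull
      by (metis less_trans)
  have dP: "inner d v > 0" if "v \<in> P" for v using d0 hull_inc[OF that] by blast
  \<comment> \<open>The tangent of the angle from \<open>d\<close> to \<open>v\<close>. It increases
    with the angle on the half plane \<open>inner d v > 0\<close>, so minimising it finds the first
    point without a choice of arguments.\<close>
  define sl where "sl v = orient 0 d v / inner d v" for v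
  obtain f where f: "f \<in> P" "\<And>v. v \<in> P \<Longrightarrow> sl f \<le> sl v"
    using finite_has_minimal[of "sl ` P"] fin P(2) arg_min_if_finite(1)[OF fin P(2), of sl] 
      arg_min_least[OF fin P(2), of _ sl] by blast
  have fN: "f \<in> mu N" using f P by auto
  have f0: "f \<noteq> 0" using fN mu_N_nz by auto
  have fv: "orient 0 f v \<ge> 0" if v: "v \<in> P" for v
  proof -
    have "orient 0 d f * inner d v \<le> orient 0 d v * inner d f"
      using f(2)[OF v] dP[OF v] dP[OF f(1)] by (simp add: sl_def field_simps)
    moreover have "orient 0 d v * inner d f - orient 0 d f * inner d v = (cmod d)\<^sup>2 * orient 0 f v"
      unfolding cmod_power2 by (simp add: orient_def inner_complex_def power2_eq_square
        algebra_simps)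
    ultimately have "(cmod d)\<^sup>2 * orient 0 f v \<ge> 0" by simp
    moreover have "d \<noteq> 0" using dP[OF v] by auto
    ultimately show ?thesis by (simp add: zero_le_mult_iff)
  qed
  have "\<exists>i<n. v = f * \<zeta> ^ i" if v: "v \<in> P" for v
  proof -
    obtain i where i: "i < N" "v = f * \<zeta> ^ i" using pos_ex[OF fN] v P by auto
    \<comment> \<open>By \<open>fv\<close> the angle from \<open>f\<close> to \<open>v\<close> is at
      most \<pi>, and \<pi> itself would mean \<open>v = - f\<close>, which is outside the open half
      plane.\<close>
    have "2 * i < N"
    proof (rule ccontr)
      assume "\<not> 2 * i < N"
      have s: "sin (real i * \<delta>) \<ge> 0" using fv[OF v] orient_zero[OF fN, of 0 i] i by simp
      have ge: "real i * \<delta> \<ge> pi" using mult_right_mono[of "real N" "2 * real i" \<delta>]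
        \<open>\<not> 2 * i < N\<close> delta_pos delta_N by simp
      have lt: "real i * \<delta> < 2 * pi" using i delta_pos delta_N
        by (metis mult_strict_right_mono of_nat_less_iff)
      have "real i * \<delta> = pi"
        using sin_lt_zero[of "real i * \<delta>"] s ge lt by (cases "pi < real i * \<delta>") auto
      then have "v = - f" using i by (simp add: pow_cis)
      then show False using dP[OF v] dP[OF f(1)] by simp
    qed
    have "\<not> n \<le> i"
    proof
      assume ni: "n \<le> i"
      let ?w = "zeta e"
      \<comment> \<open>The positions 0, n, i, i + n come in this order, so the chord from 0 to i in
        \<open>P\<close> crosses the chord from n to i + n in the rotation; for i = n the two sets
        share a point.\<close>
      have in1: "f * \<zeta> ^ n \<in> (*) ?w ` P" "f * \<zeta> ^ (i + n) \<in> (*) ?w ` P" 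
        using f v i by (auto simp: zeta_e power_add mult_ac)
      show False
      proof (cases "i = n")
        case True
        then show False using assms(4) hull_inc[OF in1(1), of convex] hull_inc[OF v, of convex] i
          by auto
      next
        case False
        have "convex hull {f, f * \<zeta> ^ i} \<inter> convex hull {f * \<zeta> ^ n, f * \<zeta> ^ (i + n)} \<noteq> {}"
          by (rule chords_cross) (use fN False ni i \<open>2 * i < N\<close> N_ge n1 in auto)
        moreover have "convex hull {f, f * \<zeta> ^ i} \<subseteq> convex hull P" using f v i
          by (intro hull_mono) auto
        moreover have "convex hull {f * \<zeta> ^ n, f * \<zeta> ^ (i + n)} \<subseteq> convex hull ((*) ?w ` P)"
          using in1 by (intro hull_mono) auto
        ultimately show False using assms(4) by blast
      qed
    qed
    then show ?thesis using i by (intro exI[of _ i]) auto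
  qed
  then show ?thesis using f by blast
qed

end

section \<open>Matrices of rank one\<close>

lemma sum_delta_mult:
  fixes f :: "nat \<Rightarrow> complex"
  assumes "j < m"
  shows "(\<Sum>k = 0..<m. (if k = j then f k else 0) * g k) = f j * g j"
proof -
  have "(\<Sum>k = 0..<m. (if k = j then f k else 0) * g k) = (\<Sum>k = 0..<m. if k = j then f k * g k else
    0)"
    by (intro sum.cong) auto
  then show ?thesis using assms by simp
qed

text \<open>The right-hand side is rank one: nonzero with vanishing 2x2 minors. The rank is the
  number of nonzero rows of an echelon form. Row operations preserve the vanishing of the minors,
  and two nonzero rows in echelon form have the minor 1 on their pivot columns.\<close>

lemma kernel_dim_pred_iff:
  fixes A :: "complex mat"
  assumes A: "A \<in> carrier_mat m m" and m: "m > 0"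
  shows "kernel_dim A = m - 1 \<longleftrightarrow> A \<noteq> 0\<^sub>m m m \<and>
    (\<forall>i<m. \<forall>j<m. \<forall>k<m. \<forall>l<m. A $$ (i, j) * A $$ (k, l) = A $$ (i, l) * A $$ (k, j))"
proof -
  define B where "B = gauss_jordan_single A"
  obtain P Q where B: "B \<in> carrier_mat m m" "row_echelon_form B" and PQ: "B = P * A"
    "P \<in> carrier_mat m m" "Q \<in> carrier_mat m m" "Q * P = 1\<^sub>m m"
    using gauss_jordan_single[OF A refl] unfolding B_def by blast
  have AQ: "A = Q * B" unfolding PQ(1) using A PQ by (simp flip: assoc_mult_mat)
  obtain f where f: "pivot_fun B f m" using B unfolding row_echelon_form_def by auto
  define R where "R = {i. i < m \<and> row B i \<noteq> 0\<^sub>v m}"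
  have finR: "finite R" unfolding R_def by simp
  have "card R \<le> m" using card_mono[of "{..<m}" R] by (auto simp: R_def)
  have "kernel_dim A = m - card R"
    unfolding kernel_dim_code B_def[symmetric] using pivot_positions(4)[OF B(1) f] A
      by (simp add: R_def)
  then have kd: "kernel_dim A = m - 1 \<longleftrightarrow> card R = 1" using \<open>card R \<le> m\<close> m by auto
  have dimB: "dim_row B = m" using B by auto
  show ?thesis
  proof (rule iffI)
    assume "kernel_dim A = m - 1"
    then obtain r where r: "R = {r}" using kd card_1_singletonE by blast
    have rm: "r < m" using r by (auto simp: R_def)
    have z: "B $$ (i, j) = (if i = r then B $$ (r, j) else 0)" if "i < m" "j < m" for i j
    proof (cases "i = r")
      case False
      then have "row B i = 0\<^sub>v m" using r that unfolding R_def by blast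
      then have "row B i $ j = 0" using that by simp
      then show ?thesis using that B False by simp
    qed auto
    have Aij: "A $$ (i, j) = Q $$ (i, r) * B $$ (r, j)" if "i < m" "j < m" for i j
    proof -
      have "A $$ (i, j) = (\<Sum>k = 0..<m. Q $$ (i, k) * B $$ (k, j))"
        unfolding AQ using that B PQ(2-4) by (simp add: scalar_prod_def)
      also have "\<dots> = (\<Sum>k = 0..<m. (if k = r then B $$ (r, j) else 0) * Q $$ (i, k))"
        using z that by (intro sum.cong) auto
      finally show ?thesis using sum_delta_mult[OF rm] by simp
    qed
    have "A \<noteq> 0\<^sub>m m m"
    proof
      assume "A = 0\<^sub>m m m"
      then have "B = 0\<^sub>m m m" using PQ by simp
      then have "R = {}" unfolding R_def by auto
      then show False using r by simp
    qed
    then show "A \<noteq> 0\<^sub>m m m \<and>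
      (\<forall>i<m. \<forall>j<m. \<forall>k<m. \<forall>l<m. A $$ (i, j) * A $$ (k, l) = A $$ (i, l) * A $$ (k, j))"
      by (auto simp: Aij)
  next
    assume a: "A \<noteq> 0\<^sub>m m m \<and>
      (\<forall>i<m. \<forall>j<m. \<forall>k<m. \<forall>l<m. A $$ (i, j) * A $$ (k, l) = A $$ (i, l) * A $$ (k, j))"
    have Bij: "B $$ (i, j) = (\<Sum>s = 0..<m. P $$ (i, s) * A $$ (s, j))" if "i < m" "j < m" for i j
      unfolding PQ(1) using that A PQ by (simp add: scalar_prod_def)
    have Bm: "B $$ (i, j) * B $$ (k, l) = B $$ (i, l) * B $$ (k, j)"
      if "i < m" "j < m" "k < m" "l < m" for i j k l
    proof -
      have "B $$ (i, j) * B $$ (k, l) = (\<Sum>s = 0..<m. \<Sum>t = 0..<m. P $$ (i, s) * P $$ (k,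
        t) * (A $$ (s, j) * A $$ (t, l)))"
        unfolding Bij[OF that(1,2)] Bij[OF that(3,4)] sum_product by (intro sum.cong) auto
      also have "\<dots> = (\<Sum>s = 0..<m. \<Sum>t = 0..<m. P $$ (i, s) * P $$ (k, t) * (A $$ (s, l) * A $$ (t,
        j)))"
        using a that by (intro sum.cong) auto
      also have "\<dots> = B $$ (i, l) * B $$ (k, j)"
        unfolding Bij[OF that(1,4)] Bij[OF that(3,2)] sum_product by (intro sum.cong) auto
      finally show ?thesis .
    qed
    have "R \<noteq> {}"
    proof
      assume "R = {}"
      then have "row B i = 0\<^sub>v m" if "i < m" for i using that unfolding R_def by blast
      then have "B $$ (i, j) = 0" if "i < m" "j < m" for i j
        using that B by (metis index_row(1) index_zero_vec(1) carrier_matD)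
      then have "B = 0\<^sub>m m m" using B by (intro eq_matI) auto
      then have "A = 0\<^sub>m m m" using PQ(3) by (simp add: AQ)
      then show False using a by simp
    qed
    moreover have "i = k" if "i \<in> R" "k \<in> R" for i k
    proof (rule ccontr)
      assume ik: "i \<noteq> k"
      have im: "i < m" "k < m" using that by (auto simp: R_def)
      have "f i \<noteq> m" "f k \<noteq> m" using that pivot_fun_zero_row_iff[OF f B(1)] by (auto simp: R_def)
      then have fm: "f i < m" "f k < m" using pivot_funD(1)[OF dimB f] im by (auto simp: le_less)
      show False using Bm[of i "f i" k "f k"] pivot_funD(4)[OF dimB f, of i]
        pivot_funD(4)[OF dimB f, of k]
         pivot_funD(5)[OF dimB f, of k i] fm im ik by simp
    qed
    ultimately have "\<exists>r. R = {r}" by blast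
    then show "kernel_dim A = m - 1" using kd by auto
  qed
qed

context refl_group
begin

section \<open>Monomial matrices\<close>

definition dm :: nat where "dm = n + 1"

lemma dm_pos: "0 < dm" by (simp add: dm_def)

lemmas G_ee_def' = G_ee_def[of e n, folded dm_def] and refls_def' = refls_def[of e n, folded dm_def]

text \<open>The data are attached to rows: coordinate \<open>i\<close> of the image of
  \<open>v\<close> is \<open>a i * v $ \<sigma> i\<close>. Permutations are therefore composed in
  the opposite order in \<open>mono_mat_mult\<close>.\<close>

definition mono_mat :: "(nat \<Rightarrow> nat) \<Rightarrow> (nat \<Rightarrow> complex) \<Rightarrow> complex mat" where
  "mono_mat \<sigma> a = mat dm dm (\<lambda>(i, j). if j = \<sigma> i then a i else 0)"

lemma mono_mat_carrier [simp]: "mono_mat \<sigma> a \<in> carrier_mat dm dm"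
  by (simp add: mono_mat_def)

lemma perm_less: "\<sigma> permutes {..<dm} \<Longrightarrow> i < dm \<Longrightarrow> \<sigma> i < dm"
  using permutes_in_image by fastforce

lemma mono_mat_mult_vec:
  assumes "\<sigma> permutes {..<dm}" "v \<in> carrier_vec dm" "i < dm"
  shows "(mono_mat \<sigma> a *\<^sub>v v) $ i = a i * v $ \<sigma> i"
proof -
  have "(mono_mat \<sigma> a *\<^sub>v v) $ i = (\<Sum>j = 0..<dm. (if j = \<sigma> i then a i else 0) * v $ j)"
    using assms by (simp add: mono_mat_def scalar_prod_def)
  then show ?thesis using sum_delta_mult[OF perm_less[OF assms(1,3)]] by simp
qed

lemma mono_mat_mult:
  assumes "\<sigma> permutes {..<dm}" "\<tau> permutes {..<dm}"
  shows "mono_mat \<sigma> a * mono_mat \<tau> b = mono_mat (\<tau> \<circ> \<sigma>) (\<lambda>i. a i * b (\<sigma> i))"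
proof (rule eq_matI)
  fix i j assume "i < dim_row (mono_mat (\<tau> \<circ> \<sigma>) (\<lambda>i. a i * b (\<sigma> i)))" "j < dim_col (mono_mat (\<tau> \<circ>
    \<sigma>) (\<lambda>i. a i * b (\<sigma> i)))"
  then have ij: "i < dm" "j < dm" by (auto simp: mono_mat_def)
  have "(mono_mat \<sigma> a * mono_mat \<tau> b) $$ (i, j) = (\<Sum>k = 0..<dm. (if k = \<sigma> i then a i else 0) * (if
    j = \<tau> k then b k else 0))"
    using ij by (simp add: mono_mat_def scalar_prod_def)
  then show "(mono_mat \<sigma> a * mono_mat \<tau> b) $$ (i, j) = mono_mat (\<tau> \<circ> \<sigma>) (\<lambda>i. a i * b (\<sigma> i)) $$ (i,
    j)"
    using sum_delta_mult[OF perm_less[OF assms(1) ij(1)]] ij by (simp add: mono_mat_def)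
qed (auto simp: mono_mat_def)

lemma mono_mat_cong: "(\<And>i. i < dm \<Longrightarrow> \<sigma> i = \<tau> i) \<Longrightarrow> (\<And>i. i < dm \<Longrightarrow> a i = b i) \<Longrightarrow>
  mono_mat \<sigma> a = mono_mat \<tau> b"
  unfolding mono_mat_def by (rule cong_mat) auto

lemma mono_mat_one: "(\<And>i. i < dm \<Longrightarrow> \<sigma> i = i) \<Longrightarrow> (\<And>i. i < dm \<Longrightarrow> a i = 1) \<Longrightarrow> mono_mat \<sigma> a = 1\<^sub>m dm"
  by (rule eq_matI) (auto simp: mono_mat_def)

text \<open>The condition is on the product of the nonzero entries and not on the determinant, which
  for a permutation matrix may be -1.\<close>

definition monomial :: "(nat \<Rightarrow> nat) \<Rightarrow> (nat \<Rightarrow> complex) \<Rightarrow> bool" where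
  "monomial \<sigma> a \<longleftrightarrow> \<sigma> permutes {..<dm} \<and> (\<forall>i<dm. a i \<in> mu e) \<and> prod a {..<dm} = 1"

lemma monomial_mult:
  assumes "monomial \<sigma> a" "monomial \<tau> b" shows "monomial (\<tau> \<circ> \<sigma>) (\<lambda>i. a i * b (\<sigma> i))"
proof -
  have s: "\<sigma> permutes {..<dm}" "\<tau> permutes {..<dm}" using assms by (auto simp: monomial_def)
  have "prod (\<lambda>i. b (\<sigma> i)) {..<dm} = prod b {..<dm}"
    using prod.permute[OF s(1), of b] by (simp add: o_def)
  then show ?thesis using assms permutes_compose[OF s] perm_less[OF s(1)]
    by (auto simp: monomial_def prod.distrib mu_mult)
qed

lemma mono_mat_inv:
  assumes "monomial \<sigma> a"
  shows "monomial (inv_into UNIV \<sigma>) (\<lambda>i. inverse (a (inv_into UNIV \<sigma> i)))"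
    "mono_mat \<sigma> a * mono_mat (inv_into UNIV \<sigma>) (\<lambda>i. inverse (a (inv_into UNIV \<sigma> i))) = 1\<^sub>m dm"
    "mono_mat (inv_into UNIV \<sigma>) (\<lambda>i. inverse (a (inv_into UNIV \<sigma> i))) * mono_mat \<sigma> a = 1\<^sub>m dm"
proof -
  have s: "\<sigma> permutes {..<dm}" using assms by (auto simp: monomial_def)
  have si: "inv_into UNIV \<sigma> permutes {..<dm}" using s by (rule permutes_inv)
  have "prod (\<lambda>i. inverse (a (inv_into UNIV \<sigma> i))) {..<dm} = prod (\<lambda>i. inverse (a i)) {..<dm}"
    using prod.permute[OF si, of "\<lambda>i. inverse (a i)"] by (simp add: o_def)
  also have "\<dots> = 1" using assms by (simp add: monomial_def prod_inversef[unfolded o_def])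
  finally show "monomial (inv_into UNIV \<sigma>) (\<lambda>i. inverse (a (inv_into UNIV \<sigma> i)))"
    using assms si perm_less[OF si] by (auto simp: monomial_def mu_inverse)
  have nz: "a i \<noteq> 0" if "i < dm" for i using assms that mu_e_nz by (auto simp: monomial_def)
  show "mono_mat \<sigma> a * mono_mat (inv_into UNIV \<sigma>) (\<lambda>i. inverse (a (inv_into UNIV \<sigma> i))) = 1\<^sub>m dm"
    unfolding mono_mat_mult[OF s si] by (rule mono_mat_one) (use s nz in \<open>auto simp:
      permutes_inverses\<close>)
  show "mono_mat (inv_into UNIV \<sigma>) (\<lambda>i. inverse (a (inv_into UNIV \<sigma> i))) * mono_mat \<sigma> a = 1\<^sub>m dm"
    unfolding mono_mat_mult[OF si s] by (rule mono_mat_one) (use s nz perm_less[OF si]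
      in \<open>auto simp: permutes_inverses\<close>)
qed

abbreviation "GLn \<equiv> GL dm"

lemma GL_simps: "mult GLn = (*)" "one GLn = 1\<^sub>m dm"
  by (simp_all add: GL_def units_of_def ring_mat_def)

lemma GL_group: "group GLn"
  unfolding GL_def by (rule monoid.units_group) (rule ring.is_monoid[OF ring_mat])

lemma mono_mat_GL: "monomial \<sigma> a \<Longrightarrow> mono_mat \<sigma> a \<in> carrier GLn"
  unfolding GL_def units_of_def Units_def using mono_mat_inv[of \<sigma> a]
  by (auto simp: ring_mat_def intro!: bexI[of _ "mono_mat (inv_into UNIV \<sigma>) (\<lambda>i. inverse (a
    (inv_into UNIV \<sigma> i)))"])

lemma mono_mat_GL_inv: "monomial \<sigma> a \<Longrightarrow> m_inv GLn (mono_mat \<sigma> a) = mono_mat (inv_into UNIV \<sigma>) (\<lambda>i.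
  inverse (a (inv_into UNIV \<sigma> i)))"
  by (rule group.inv_equality[OF GL_group]) (use mono_mat_inv[of \<sigma> a]
    mono_mat_GL in \<open>auto simp: GL_simps\<close>)

lemma perm_matrix_mono_mat:
  assumes "\<sigma> permutes {..<dm}"
  shows "mat dm dm (\<lambda>(i, j). if i = \<sigma> j then 1 else 0) = mono_mat (inv_into UNIV \<sigma>) (\<lambda>_. 1)"
  unfolding mono_mat_def by (rule cong_mat) (use assms in \<open>auto simp: permutes_inverses
    permutes_inv_eq\<close>)

lemma det_diag_mono_mat: "det (mono_mat id a) = prod a {..<dm}"
proof -
  have "det (mono_mat id a) = prod_list (diag_mat (mono_mat id a))"
    by (rule det_upper_triangular[of _ "dm"]) (auto simp: mono_mat_def upper_triangular_def)
  also have "diag_mat (mono_mat id a) = map a [0..<dm]"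
    by (auto simp: diag_mat_def mono_mat_def)
  also have "prod_list \<dots> = prod a {..<dm}"
    using prod.distinct_set_conv_list[of "[0..<dm]" a] by (simp add: atLeast0LessThan del: upt_Suc)
  finally show ?thesis .
qed

lemma special_diag_mono_mat:
  "special_diagonal_matrices e dm = {mono_mat id a | a. monomial id a}"
proof (intro equalityI subsetI)
  fix D assume "D \<in> special_diagonal_matrices e dm"
  then have D: "D \<in> carrier_mat dm dm" "diagonal_mat D" "\<forall>i<dm. D $$ (i, i) \<in> mu e" "det D = 1"
    by (auto simp: special_diagonal_matrices_def)
  have eq: "D = mono_mat id (\<lambda>i. D $$ (i, i))"
    by (rule eq_matI) (use D in \<open>auto simp: mono_mat_def diagonal_mat_def\<close>)
  then have "prod (\<lambda>i. D $$ (i, i)) {..<dm} = 1" using det_diag_mono_mat D by metis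
  then have "monomial id (\<lambda>i. D $$ (i, i))" using D by (auto simp: monomial_def permutes_id)
  then show "D \<in> {mono_mat id a | a. monomial id a}" using eq by blast
next
  fix D assume "D \<in> {mono_mat id a | a. monomial id a}"
  then obtain a where a: "D = mono_mat id a" "monomial id a" by auto
  then show "D \<in> special_diagonal_matrices e dm"
    using det_diag_mono_mat[of a] by (auto simp: special_diagonal_matrices_def monomial_def
      diagonal_mat_def) (auto simp: mono_mat_def)
qed

lemma monomial_perm: "\<sigma> permutes {..<dm} \<Longrightarrow> monomial \<sigma> (\<lambda>_. 1)"
  by (simp add: monomial_def mu_one)

lemma G_eq: "G_ee e n = {mono_mat \<sigma> a | \<sigma> a. monomial \<sigma> a}"
proof (intro equalityI subsetI)
  fix g assume "g \<in> G_ee e n"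
  then have "g \<in> generate GLn (permutation_matrices dm \<union> special_diagonal_matrices e dm)"
    by (simp add: G_ee_def')
  then show "g \<in> {mono_mat \<sigma> a | \<sigma> a. monomial \<sigma> a}"
  proof (induction rule: generate.induct)
    case one
    have "1\<^sub>m dm = mono_mat id (\<lambda>_. 1)" by (rule mono_mat_one[symmetric]) auto
    then show ?case using monomial_perm[OF permutes_id] by (auto simp: GL_simps)
  next
    case (incl h)
    then show ?case
    proof
      assume "h \<in> permutation_matrices dm"
      then obtain \<sigma> where "\<sigma> permutes {..<dm}" "h = mono_mat (inv_into UNIV \<sigma>) (\<lambda>_. 1)"
        using perm_matrix_mono_mat by (auto simp: permutation_matrices_def)
      then show ?thesis using monomial_perm permutes_inv by blast
    qed (auto simp: special_diag_mono_mat)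
  next
    case (inv h)
    then have "\<exists>\<sigma> a. h = mono_mat \<sigma> a \<and> monomial \<sigma> a"
    proof
      assume "h \<in> permutation_matrices dm"
      then obtain \<sigma> where "\<sigma> permutes {..<dm}" "h = mono_mat (inv_into UNIV \<sigma>) (\<lambda>_. 1)"
        using perm_matrix_mono_mat by (auto simp: permutation_matrices_def)
      then show ?thesis using monomial_perm permutes_inv by blast
    qed (auto simp: special_diag_mono_mat)
    then show ?case using mono_mat_GL_inv mono_mat_inv(1) by auto blast
  next
    case (eng h1 h2)
    then obtain \<sigma> a \<tau> b where *: "h1 = mono_mat \<sigma> a" "monomial \<sigma> a" "h2 = mono_mat \<tau> b" "monomial
      \<tau> b" by blast
    then have "h1 * h2 = mono_mat (\<tau> \<circ> \<sigma>) (\<lambda>i. a i * b (\<sigma> i))" using mono_mat_mult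
      by (auto simp: monomial_def)
    then show ?case using monomial_mult[OF *(2,4)] by (simp only: GL_simps) blast
  qed
next
  fix g assume "g \<in> {mono_mat \<sigma> a | \<sigma> a. monomial \<sigma> a}"
  then obtain \<sigma> a where g: "g = mono_mat \<sigma> a" "monomial \<sigma> a" by auto
  have s: "\<sigma> permutes {..<dm}" using g by (auto simp: monomial_def)
  have ai: "monomial id a" using g by (auto simp: monomial_def permutes_id)
  \<comment> \<open>A monomial matrix is its diagonal part times a permutation matrix, and both are
    generators.\<close>
  have "mono_mat id a * mono_mat \<sigma> (\<lambda>_. 1) = mono_mat \<sigma> a"
    using mono_mat_mult[OF permutes_id s] by simp
  moreover have "mono_mat id a \<in> generate GLn (permutation_matrices dm \<union> special_diagonal_matrices
    e dm)"
    by (rule generate.incl) (use ai in \<open>auto simp: special_diag_mono_mat\<close>)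
  moreover have "mono_mat \<sigma> (\<lambda>_. 1) \<in> permutation_matrices dm"
    using perm_matrix_mono_mat[OF permutes_inv[OF s]] permutes_inv[OF s] s
      unfolding permutation_matrices_def
    by (auto simp: permutes_inv_inv intro!: exI[of _ "inv_into UNIV \<sigma>"])
  then have "mono_mat \<sigma> (\<lambda>_. 1) \<in> generate GLn (permutation_matrices dm \<union>
    special_diagonal_matrices e dm)"
    by (intro generate.incl) auto
  ultimately show "g \<in> G_ee e n" unfolding G_ee_def' g using generate.eng GL_simps(1) by metis
qed

lemma G_mult: "g \<in> G_ee e n \<Longrightarrow> h \<in> G_ee e n \<Longrightarrow> g * h \<in> G_ee e n"
proof -
  assume "g \<in> G_ee e n" "h \<in> G_ee e n"
  then obtain \<sigma> a \<tau> b where *: "g = mono_mat \<sigma> a" "monomial \<sigma> a" "h = mono_mat \<tau> b" "monomial \<tau> b"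
    by (auto simp: G_eq)
  then have "g * h = mono_mat (\<tau> \<circ> \<sigma>) (\<lambda>i. a i * b (\<sigma> i))" using mono_mat_mult
    by (auto simp: monomial_def)
  then show "g * h \<in> G_ee e n" unfolding G_eq using monomial_mult[OF *(2,4)] by blast
qed

lemma G_one: "1\<^sub>m dm \<in> G_ee e n"
  unfolding G_ee_def' using generate.one[of GLn] by (simp add: GL_simps)

lemma G_carrier: "g \<in> G_ee e n \<Longrightarrow> g \<in> carrier_mat dm dm"
  unfolding G_eq by auto

definition refl_mat :: "nat \<Rightarrow> nat \<Rightarrow> complex \<Rightarrow> complex mat" where
  "refl_mat i j \<omega> = mono_mat (Transposition.transpose i j) (\<lambda>k. if k = i then \<omega> else if k = j then
    inverse \<omega> else 1)"

lemma refl_mat_monomial: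
  assumes "i < dm" "j < dm" "i \<noteq> j" "\<omega> \<in> mu e"
  shows "monomial (Transposition.transpose i j) (\<lambda>k. if k = i then \<omega> else if k = j then inverse \<omega>
    else 1)"
proof -
  have "prod (\<lambda>k. if k = i then \<omega> else if k = j then inverse \<omega> else 1) {..<dm} =
     prod (\<lambda>k. if k = i then \<omega> else if k = j then inverse \<omega> else 1) {i, j}"
    by (rule prod.mono_neutral_right) (use assms in auto)
  also have "\<dots> = 1" using assms mu_e_nz by simp
  finally show ?thesis using assms
    by (auto simp: monomial_def mu_one mu_inverse intro!: permutes_swap_id)
qed

text \<open>For a reflection the minors of \<open>t - 1\<close> vanish. If \<open>i\<close> is
  moved, the diagonal entry at \<open>i\<close> is -1, and the minor with any \<open>k\<close> other
  than \<open>i\<close> and \<open>\<sigma> i\<close> forces \<open>k\<close> to be fixed with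
  weight 1. What remains is a transposition, whose two weights are inverse because their product is
  1.\<close>

lemma refls_eq: "refls e n = {refl_mat i j \<omega> | i j \<omega>. i < dm \<and> j < dm \<and> i \<noteq> j \<and> \<omega> \<in> mu e}"
proof (intro equalityI subsetI)
  fix t assume "t \<in> {refl_mat i j \<omega> | i j \<omega>. i < dm \<and> j < dm \<and> i \<noteq> j \<and> \<omega> \<in> mu e}"
  then obtain i j \<omega> where t: "t = refl_mat i j \<omega>" and a: "i < dm" "j < dm" "i \<noteq> j" "\<omega> \<in> mu e"
    by auto
  define u where "u k = (if k = i then 1 else if k = j then - inverse \<omega> else 0)" for k
  define w where "w k = (if k = i then - 1 else if k = j then \<omega> else 0)" for k
  have w0: "\<omega> \<noteq> 0" using a mu_e_nz by auto
  have A: "(t - 1\<^sub>m dm) $$ (p, q) = u p * w q" if "p < dm" "q < dm" for p q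
    using that a w0 unfolding t refl_mat_def mono_mat_def u_def w_def
      by (auto simp: Transposition.transpose_def)
  have "t - 1\<^sub>m dm \<noteq> 0\<^sub>m dm dm"
  proof
    assume z: "t - 1\<^sub>m dm = 0\<^sub>m dm dm"
    have "(t - 1\<^sub>m dm) $$ (i, i) = 0" unfolding z using a by simp
    then show False using A[of i i] a by (simp add: u_def w_def)
  qed
  moreover have "t - 1\<^sub>m dm \<in> carrier_mat dm dm" by (rule minus_carrier_mat) simp
  ultimately have "kernel_dim (t - 1\<^sub>m dm) = dm - 1"
    using kernel_dim_pred_iff[of "t - 1\<^sub>m dm" "dm", OF _ dm_pos] A by simp
  moreover have "t \<in> G_ee e n" unfolding G_eq t refl_mat_def using refl_mat_monomial[OF a] by blast
  ultimately show "t \<in> refls e n" by (simp add: refls_def' dm_def)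
next
  fix t assume "t \<in> refls e n"
  then have t: "t \<in> G_ee e n" "kernel_dim (t - 1\<^sub>m dm) = dm - 1" by (auto simp: refls_def' dm_def)
  then obtain \<sigma> a where ts: "t = mono_mat \<sigma> a" "monomial \<sigma> a" by (auto simp: G_eq)
  have s: "\<sigma> permutes {..<dm}" using ts by (auto simp: monomial_def)
  define A where "A = t - 1\<^sub>m dm"
  have Ac: "A \<in> carrier_mat dm dm" unfolding A_def by (rule minus_carrier_mat) simp
  have Aij: "A $$ (i, j) = (if j = \<sigma> i then a i else 0) - (if i = j then 1 else 0)"
    if "i < dm" "j < dm" for i j
    unfolding A_def ts mono_mat_def using that by simp
  have nz: "A \<noteq> 0\<^sub>m dm dm" and min: "\<And>i j k l. i < dm \<Longrightarrow> j < dm \<Longrightarrow> k < dm \<Longrightarrow> l < dm \<Longrightarrow>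
       A $$ (i, j) * A $$ (k, l) = A $$ (i, l) * A $$ (k, j)"
    using kernel_dim_pred_iff[OF Ac dm_pos] t(2) unfolding A_def by auto
  \<comment> \<open>Otherwise \<open>t\<close> is diagonal; its entries have product 1, so at least
    two of them differ from 1, and these give a nonzero minor.\<close>
  have "\<exists>i<dm. \<sigma> i \<noteq> i"
  proof (rule ccontr)
    assume "\<not> ?thesis"
    then have id: "\<sigma> i = i" if "i < dm" for i using that by auto
    obtain i where i: "i < dm" "a i \<noteq> 1"
    proof (rule ccontr)
      assume "\<not> thesis"
      then have "a i = 1" if "i < dm" for i using that \<open>\<And>i. i < dm \<Longrightarrow> a i \<noteq> 1 \<Longrightarrow> thesis\<close> by blast
      then have "A = 0\<^sub>m dm dm" using Ac id Aij by (intro eq_matI) auto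
      then show False using nz by simp
    qed
    obtain k where k: "k < dm" "a k \<noteq> 1" "k \<noteq> i"
    proof (rule ccontr)
      assume "\<not> thesis"
      then have "a k = 1" if "k < dm" "k \<noteq> i" for k
        using that \<open>\<And>k. k < dm \<Longrightarrow> a k \<noteq> 1 \<Longrightarrow> k \<noteq> i \<Longrightarrow> thesis\<close> by blast
      then have "prod a {..<dm} = prod a {i}" by (intro prod.mono_neutral_right) (use i in auto)
      then show False using i ts by (simp add: monomial_def)
    qed
    show False using min[of i i k k] i k id by (simp add: Aij)
  qed
  then obtain i where i: "i < dm" "\<sigma> i \<noteq> i" by auto
  define j where "j = \<sigma> i"
  have j: "j < dm" "j \<noteq> i" using i perm_less[OF s] by (auto simp: j_def)
  have fx: "\<sigma> k = k \<and> a k = 1" if "k < dm" "k \<noteq> i" "k \<noteq> j" for k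
    using min[of i i k k] that i j by (auto simp: Aij j_def split: if_splits)
  have inj: "\<sigma> x = \<sigma> y \<Longrightarrow> x = y" for x y using permutes_inj[OF s] by (auto simp: inj_def)
  have "\<sigma> j = i"
  proof (rule ccontr)
    assume "\<sigma> j \<noteq> i"
    moreover have "\<sigma> j \<noteq> j" using inj[of j i] j by (auto simp: j_def)
    ultimately show False using fx[of "\<sigma> j"] inj[of "\<sigma> j" j] perm_less[OF s j(1)] by auto
  qed
  have "prod a {..<dm} = prod a {i, j}" by (rule prod.mono_neutral_right) (use i j fx in auto)
  then have "a i * a j = 1" using ts j by (auto simp: monomial_def)
  then have aj: "a j = inverse (a i)" by (metis inverse_unique)
  have "t = refl_mat i j (a i)" unfolding ts refl_mat_def
    by (rule mono_mat_cong) (use fx \<open>\<sigma> j = i\<close> aj in \<open>auto simp: Transposition.transpose_def j_def\<close>)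
  then show "t \<in> {refl_mat i j \<omega> | i j \<omega>. i < dm \<and> j < dm \<and> i \<noteq> j \<and> \<omega> \<in> mu e}"
    using i j ts by (auto simp: monomial_def)
qed

section \<open>The action on the coordinates of a regular vector\<close>

text \<open>Unlike \<open>x0\<close>, the vector \<open>x1\<close> has no zero entry, so that its image under \<open>g\<close> also records the weight of
  \<open>g\<close> in the column of $X_0$; the points \<open>2 * \<omega>\<close> do not lie on the unit circle, so they
  are not confused with elements of $\mu_{en}$.\<close>

definition x1 :: "complex vec" where
  "x1 = vec dm (\<lambda>i. if i = 0 then 2 else \<zeta> ^ i)"

definition Omega :: "complex set" where
  "Omega = mu N \<union> {z. z / 2 \<in> mu e}"

text \<open>An equivariant transposition of orbits: the form that a reflection of the group takes on
  \<open>Omega\<close>, see \<open>refl_mat_x1\<close>.\<close>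

definition swap :: "complex \<Rightarrow> complex \<Rightarrow> complex \<Rightarrow> complex" where
  "swap x y z = (if z / x \<in> mu e then z / x * y else if z / y \<in> mu e then z / y * x else z)"

text \<open>Only the entries of \<open>x1\<close>, one from each orbit of \<open>mu e\<close> on
  \<open>Omega\<close>, are tested. The maps used as \<open>\<phi>\<close> are equivariant, which
  determines them on the rest of \<open>Omega\<close>.\<close>

definition acts :: "complex mat \<Rightarrow> (complex \<Rightarrow> complex) \<Rightarrow> bool" where
  "acts g \<phi> \<longleftrightarrow> g \<in> G_ee e n \<and> (\<forall>i<dm. (g *\<^sub>v x1) $ i = \<phi> (x1 $ i))"

text \<open>Extends the coordinates of \<open>v\<close> to a $\mu_e$-equivariant function on \<open>Omega\<close>.\<close>

definition coord :: "complex vec \<Rightarrow> complex \<Rightarrow> complex" where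
  "coord v z = (let i = (THE i. i < dm \<and> z / x1 $ i \<in> mu e) in z / x1 $ i * v $ i)"

lemma x1_carrier [simp]: "x1 \<in> carrier_vec dm" by (simp add: x1_def)

lemma x1_nz: "i < dm \<Longrightarrow> x1 $ i \<noteq> 0" by (simp add: x1_def)

lemma two_not_unit: "z \<in> mu N \<Longrightarrow> z / 2 \<notin> mu e" "z \<in> mu N \<Longrightarrow> 2 / z \<notin> mu e"
  using mu_norm[of N z] mu_norm[of e "z / 2"] mu_norm[of e "2 / z"] by (auto simp: norm_divide)

text \<open>As \<open>N = e * n\<close>, a power of \<open>\<zeta>\<close> has e-th power 1 exactly
  when \<open>n\<close> divides its exponent. So any \<open>n\<close> consecutive positions
  represent each orbit of \<open>mu e\<close> once.\<close>

lemma mu_e_pow_iff: "\<zeta> ^ i / \<zeta> ^ j \<in> mu e \<longleftrightarrow> i mod n = j mod n"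
proof -
  have *: "\<zeta> ^ i / \<zeta> ^ j \<in> mu e \<longleftrightarrow> i mod n = j mod n" if "j \<le> i" for i j
  proof -
    have "\<zeta> ^ i / \<zeta> ^ j = \<zeta> ^ (i - j)" using that by (simp add: power_diff)
    moreover have "(\<zeta> ^ (i - j)) ^ e = 1 \<longleftrightarrow> N dvd (i - j) * e"
      using pos_eq[of 1 "(i - j) * e" 0] by (simp add: power_mult[symmetric] mod_eq_0_iff_dvd)
    moreover have "N dvd (i - j) * e \<longleftrightarrow> n dvd (i - j)"
      using dvd_mult_cancel_left[of e n "i - j"] N_pos(2)
        by (simp add: N_def mult.commute del: N_pos)
    ultimately show ?thesis using that mod_eq_dvd_iff_nat[of j i n] by (simp add: mu_def)
  qed
  show ?thesis
  proof (cases "j \<le> i")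
    case False
    then have "\<zeta> ^ j / \<zeta> ^ i \<in> mu e \<longleftrightarrow> i mod n = j mod n" using *[of i j] by auto
    moreover have "\<zeta> ^ i / \<zeta> ^ j = inverse (\<zeta> ^ j / \<zeta> ^ i)" by simp
    moreover have "inverse z \<in> mu e \<longleftrightarrow> z \<in> mu e" for z
      using mu_inverse[of z e] mu_inverse[of "inverse z" e] by auto
    ultimately show ?thesis by metis
  qed (rule *)
qed

lemma mod_n_eq: "1 \<le> i \<Longrightarrow> i \<le> n \<Longrightarrow> 1 \<le> j \<Longrightarrow> j \<le> n \<Longrightarrow> i mod n = j mod n \<Longrightarrow> i = j"
  by (cases "i = n"; cases "j = n") auto

lemma x1_ineq: 
  assumes "i < dm" "j < dm" "x1 $ i / x1 $ j \<in> mu e" shows "i = j"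
proof -
  consider "i = 0" "j = 0" | "i = 0" "j > 0" | "i > 0" "j = 0" | "i > 0" "j > 0" by auto
  then show ?thesis
    by cases (use assms two_not_unit[of "\<zeta> ^ i"] two_not_unit[of "\<zeta> ^ j"] mu_pow[OF zeta_mu]
      mu_e_pow_iff[of i j] mod_n_eq[of i j]
      in \<open>auto simp: x1_def dm_def\<close>)
qed

lemma x1_Omega: "i < dm \<Longrightarrow> x1 $ i \<in> Omega"
  by (auto simp: x1_def Omega_def mu_one intro: mu_pow zeta_mu)

lemma Omega_rot: "\<omega> \<in> mu e \<Longrightarrow> z \<in> Omega \<Longrightarrow> \<omega> * z \<in> Omega"
  unfolding Omega_def using mu_N_rot[of \<omega> z] mu_mult[of \<omega> e "z / 2"] by auto

lemma Omega_ex: assumes "z \<in> Omega" shows "\<exists>i<dm. \<exists>\<alpha>\<in>mu e. z = \<alpha> * x1 $ i"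
proof (cases "z \<in> mu N")
  case True
  then obtain k where k: "k < N" "z = \<zeta> ^ k" using mu_eq[of N] by auto
  define i where "i = (if k mod n = 0 then n else k mod n)"
  have i: "0 < i" "i \<le> n" using n1 mod_less_divisor[of n k]
    by (auto simp: i_def simp del: mod_less_divisor)
  have "\<zeta> ^ k / \<zeta> ^ i \<in> mu e" unfolding mu_e_pow_iff by (simp add: i_def)
  then show ?thesis using i k by (intro exI[of _ i]
    conjI bexI[of _ "\<zeta> ^ k / \<zeta> ^ i"]) (auto simp: x1_def dm_def)
next
  case False
  then have "z / 2 \<in> mu e" using assms by (auto simp: Omega_def)
  then show ?thesis using dm_pos by (intro exI[of _ 0] conjI bexI[of _ "z / 2"]) (auto simp: x1_def)
qed

lemma Omega_nz: "z \<in> Omega \<Longrightarrow> z \<noteq> 0"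
  using Omega_ex mu_e_nz x1_nz by fastforce

lemma unit_div_rot: "\<omega> \<in> mu e \<Longrightarrow> \<omega> * z / x \<in> mu e \<longleftrightarrow> z / x \<in> mu e"
  using mu_mult[of \<omega> e "z / x"] mu_mult[of "inverse \<omega>" e "\<omega> * z / x"] mu_inverse[of \<omega> e]
    mu_e_nz[of \<omega>]
  by (auto simp: field_simps)

lemma unit_div_rot2: "\<omega> \<in> mu e \<Longrightarrow> z / (\<omega> * x) \<in> mu e \<longleftrightarrow> z / x \<in> mu e"
  using unit_div_rot[of "inverse \<omega>" z x] mu_inverse[of \<omega> e] mu_e_nz[of \<omega>]
  by (auto simp: field_simps)

lemma unit_div_sym: "z / x \<in> mu e \<Longrightarrow> x / z \<in> mu e"
  using mu_inverse[of "z / x" e] by simp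

lemma swap_rot: "\<omega> \<in> mu e \<Longrightarrow> swap x y (\<omega> * z) = \<omega> * swap x y z"
  by (simp add: swap_def unit_div_rot del: times_divide_eq_left)

lemma swap_scale: "\<omega> \<in> mu e \<Longrightarrow> swap (\<omega> * x) (\<omega> * y) z = swap x y z"
proof -
  assume w: "\<omega> \<in> mu e"
  have "z / (\<omega> * x) * (\<omega> * y) = z / x * y" for x y using mu_e_nz[OF w] by simp
  then show ?thesis by (simp only: swap_def unit_div_rot2[OF w])
qed

lemma coord_eq:
  assumes "i < dm" "\<alpha> \<in> mu e" shows "coord v (\<alpha> * x1 $ i) = \<alpha> * v $ i"
proof -
  have "(THE k. k < dm \<and> \<alpha> * x1 $ i / x1 $ k \<in> mu e) = i"
    using assms x1_ineq x1_nz by (intro the_equality) (auto simp: unit_div_rot)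
  then show ?thesis using x1_nz assms by (simp add: coord_def)
qed

lemma coord_rot: "\<omega> \<in> mu e \<Longrightarrow> z \<in> Omega \<Longrightarrow> coord v (\<omega> * z) = \<omega> * coord v z"
  using Omega_ex[of z] coord_eq mu_mult[of \<omega> e] by (auto simp flip: mult.assoc)

lemma acts_ex:
  assumes "g \<in> G_ee e n"
  obtains \<sigma> a where "monomial \<sigma> a" "\<And>v i. v \<in> carrier_vec dm \<Longrightarrow> i < dm \<Longrightarrow>
    (g *\<^sub>v v) $ i = a i * v $ \<sigma> i"
    "\<And>i. i < dm \<Longrightarrow> \<sigma> i < dm" "\<And>i. i < dm \<Longrightarrow> a i \<in> mu e" "g = mono_mat \<sigma> a"
proof -
  obtain \<sigma> a where g: "g = mono_mat \<sigma> a" "monomial \<sigma> a" using assms by (auto simp: G_eq)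
  then have "\<sigma> permutes {..<dm}" by (simp add: monomial_def)
  then show thesis using that[of \<sigma> a] g mono_mat_mult_vec perm_less by (auto simp: monomial_def)
qed

lemma coord_acts:
  assumes "acts g \<phi>" "v \<in> carrier_vec dm" "i < dm"
  shows "(g *\<^sub>v v) $ i = coord v (\<phi> (x1 $ i))"
proof -
  obtain \<sigma> a where *: "\<And>v i. v \<in> carrier_vec dm \<Longrightarrow> i < dm \<Longrightarrow> (g *\<^sub>v v) $ i = a i * v $ \<sigma> i"
    "\<And>i. i < dm \<Longrightarrow> \<sigma> i < dm" "\<And>i. i < dm \<Longrightarrow> a i \<in> mu e"
    using acts_ex assms(1) by (metis acts_def)
  have "\<phi> (x1 $ i) = a i * x1 $ \<sigma> i" using assms *(1)[of x1 i] by (simp add: acts_def)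
  then show ?thesis using * assms coord_eq by simp
qed

lemma refl_mat_x1:
  assumes "i < dm" "j < dm" "i \<noteq> j" "\<omega> \<in> mu e" "k < dm"
  shows "(refl_mat i j \<omega> *\<^sub>v x1) $ k = swap (x1 $ i) (\<omega> * x1 $ j) (x1 $ k)"
proof -
  have p: "Transposition.transpose i j permutes {..<dm}" using assms
    by (intro permutes_swap_id) auto
  have w: "\<omega> \<noteq> 0" using assms mu_e_nz by auto
  have nz: "x1 $ i \<noteq> 0" "x1 $ j \<noteq> 0" using assms x1_nz by auto
  have 1: "x1 $ k / x1 $ i \<in> mu e \<longleftrightarrow> k = i" "x1 $ k / (\<omega> * x1 $ j) \<in> mu e \<longleftrightarrow> k = j"
    using assms x1_ineq[of k i] x1_ineq[of k j] nz by (auto simp: unit_div_rot2 mu_one)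
  show ?thesis unfolding refl_mat_def mono_mat_mult_vec[OF p x1_carrier assms(5)] swap_def 1
    using assms w nz by (auto simp: field_simps)
qed

text \<open>A coordinate of the image under \<open>g\<close> is a coordinate of the vector times an
  element of \<open>mu e\<close>. Equivariance of \<open>swap\<close> lets this factor pass inside,
  which turns multiplication on the right into composition on the left.\<close>

lemma acts_refl_mat:
  assumes "acts g \<phi>" "i < dm" "j < dm" "i \<noteq> j" "\<omega> \<in> mu e"
  shows "acts (g * refl_mat i j \<omega>) (swap (x1 $ i) (\<omega> * x1 $ j) \<circ> \<phi>)"
proof -
  obtain \<sigma> a where *: "\<And>v i. v \<in> carrier_vec dm \<Longrightarrow> i < dm \<Longrightarrow> (g *\<^sub>v v) $ i = a i * v $ \<sigma> i"
    "\<And>i. i < dm \<Longrightarrow> \<sigma> i < dm" "\<And>i. i < dm \<Longrightarrow> a i \<in> mu e"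
    using acts_ex assms(1) by (metis acts_def)
  have g: "g \<in> carrier_mat dm dm" using assms(1) G_carrier by (auto simp: acts_def)
  have Rc: "refl_mat i j \<omega> \<in> carrier_mat dm dm" by (simp add: refl_mat_def)
  have "refl_mat i j \<omega> \<in> G_ee e n" unfolding G_eq refl_mat_def
    using refl_mat_monomial[OF assms(2-5)] by blast
  then have "g * refl_mat i j \<omega> \<in> G_ee e n" using assms G_mult by (auto simp: acts_def)
  moreover have "(g * refl_mat i j \<omega> *\<^sub>v x1) $ k = swap (x1 $ i) (\<omega> * x1 $ j) (\<phi> (x1 $ k))"
    if k: "k < dm" for k
  proof -
    have "(g * refl_mat i j \<omega> *\<^sub>v x1) $ k = (g *\<^sub>v (refl_mat i j \<omega> *\<^sub>v x1)) $ k"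
      using g Rc by (simp add: assoc_mult_mat_vec[of g dm dm _ dm])
    also have "\<dots> = a k * (refl_mat i j \<omega> *\<^sub>v x1) $ \<sigma> k" using *(1)[OF _ k] Rc by simp
    also have "\<dots> = a k * swap (x1 $ i) (\<omega> * x1 $ j) (x1 $ \<sigma> k)"
      using refl_mat_x1[OF assms(2-5)] * k by simp
    also have "\<dots> = swap (x1 $ i) (\<omega> * x1 $ j) (a k * x1 $ \<sigma> k)" using * k swap_rot by simp
    also have "a k * x1 $ \<sigma> k = \<phi> (x1 $ k)" using *(1)[of x1 k] k assms(1) by (simp add: acts_def)
    finally show ?thesis .
  qed
  ultimately show ?thesis by (simp add: acts_def)
qed

lemma refl_mat_sq:
  assumes "i < dm" "j < dm" "i \<noteq> j" "\<omega> \<in> mu e"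
  shows "refl_mat i j \<omega> * refl_mat i j \<omega> = 1\<^sub>m dm"
proof -
  have p: "Transposition.transpose i j permutes {..<dm}" using assms
    by (intro permutes_swap_id) auto
  have w: "\<omega> \<noteq> 0" using assms mu_e_nz by auto
  show ?thesis unfolding refl_mat_def mono_mat_mult[OF p p]
    by (rule mono_mat_one) (use assms w in \<open>auto simp: Transposition.transpose_def\<close>)
qed

text \<open>Collects what is used of a reflection, so that the later arguments need no matrix
  entries: the exchange it induces, its hyperplane in terms of \<open>coord\<close>, and a linear
  form for that hyperplane.\<close>

lemma refl_swap:
  assumes "t \<in> refls e n"
  shows "\<exists>x\<in>Omega. \<exists>y\<in>Omega. y / x \<notin> mu e \<and> (\<forall>g \<phi>. acts g \<phi> \<longrightarrow> acts (g * t) (swap x y \<circ> \<phi>)) \<and>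
     (\<forall>v\<in>carrier_vec dm. t *\<^sub>v v = v \<longleftrightarrow> coord v x = coord v y) \<and>
     (\<exists>w\<in>carrier_vec dm. \<forall>v\<in>carrier_vec dm. t *\<^sub>v v = v \<longleftrightarrow> w \<bullet> v = 0)"
proof -
  obtain i j \<omega> where t: "t = refl_mat i j \<omega>" and a: "i < dm" "j < dm" "i \<noteq> j" "\<omega> \<in> mu e"
    using assms by (auto simp: refls_eq)
  have p: "Transposition.transpose i j permutes {..<dm}" using a by (intro permutes_swap_id) auto
  have w: "\<omega> \<noteq> 0" using a mu_e_nz by auto
  have ineq: "\<omega> * x1 $ j / x1 $ i \<notin> mu e" using x1_ineq[of j i] a by (auto simp: unit_div_rot)
  have e: "t *\<^sub>v v = v \<longleftrightarrow> v $ i = \<omega> * v $ j" if v: "v \<in> carrier_vec dm" for v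
  proof
    assume "t *\<^sub>v v = v"
    then have "(t *\<^sub>v v) $ i = v $ i" by simp
    then show "v $ i = \<omega> * v $ j" using mono_mat_mult_vec[OF p v a(1)] unfolding t refl_mat_def
      by simp
  next
    assume "v $ i = \<omega> * v $ j"
    then show "t *\<^sub>v v = v" using v a w unfolding t
      by (intro eq_vecI) (auto simp: refl_mat_def mono_mat_mult_vec[OF p v]
        Transposition.transpose_def, auto simp: mono_mat_def)
  qed
  have f: "coord v (x1 $ i) = v $ i" "coord v (\<omega> * x1 $ j) = \<omega> * v $ j" for v
    using coord_eq[of i 1 v] coord_eq[of j \<omega> v] a by (auto simp: mu_one)
  define u where "u = vec dm (\<lambda>k. if k = i then 1 else if k = j then - \<omega> else 0)"
  have "u \<bullet> v = v $ i - \<omega> * v $ j" if v: "v \<in> carrier_vec dm" for v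
  proof -
    have "u \<bullet> v = (\<Sum>k = 0..<dm. (if k = i then 1 else if k = j then - \<omega> else 0) * v $ k)"
      using v by (simp add: u_def scalar_prod_def)
    also have "\<dots> = (\<Sum>k \<in> {i, j}. (if k = i then 1 else if k = j then - \<omega> else 0) * v $ k)"
      by (rule sum.mono_neutral_right) (use a in auto)
    finally show ?thesis using a by simp
  qed
  then have "\<exists>w\<in>carrier_vec dm. \<forall>v\<in>carrier_vec dm. t *\<^sub>v v = v \<longleftrightarrow> w \<bullet> v = 0"
    using e by (intro bexI[of _ u]) (auto simp: u_def)
  then show ?thesis
    using e f ineq a acts_refl_mat x1_Omega Omega_rot unfolding t
    by (intro bexI[of _ "x1 $ i"] bexI[of _ "\<omega> * x1 $ j"]) auto
qed

lemma swap_refl: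
  assumes "x \<in> Omega" "y \<in> Omega" "y / x \<notin> mu e"
  shows "\<exists>t\<in>refls e n. t * t = 1\<^sub>m dm \<and> (\<forall>g \<phi>. acts g \<phi> \<longrightarrow> acts (g * t) (swap x y \<circ> \<phi>))"
proof -
  obtain i \<alpha> where i: "i < dm" "\<alpha> \<in> mu e" "x = \<alpha> * x1 $ i" using Omega_ex[OF assms(1)] by auto
  obtain j \<beta> where j: "j < dm" "\<beta> \<in> mu e" "y = \<beta> * x1 $ j" using Omega_ex[OF assms(2)] by auto
  have ij: "i \<noteq> j"
  proof
    assume "i = j"
    then have "y / x = \<beta> / \<alpha>" using i j x1_nz by simp
    then show False using assms(3) i j mu_divide by metis
  qed
  have w: "\<beta> / \<alpha> \<in> mu e" using i j mu_divide by auto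
  have "swap x y = swap (x1 $ i) (\<beta> / \<alpha> * x1 $ j)"
    using swap_scale[OF i(2), of "x1 $ i" "\<beta> / \<alpha> * x1 $ j"] i j mu_e_nz[OF i(2)]
      by (auto simp: fun_eq_iff)
  then show ?thesis
    using acts_refl_mat[OF _ i(1) j(1) ij w] refl_mat_sq[OF i(1) j(1) ij w] i j ij w
    by (intro bexI[of _ "refl_mat i j (\<beta> / \<alpha>)"]) (auto simp: refls_eq)
qed

lemma x0_eq: "i < dm \<Longrightarrow> x0 e n $ i = (if i = 0 then 0 else \<zeta> ^ i)" "x0 e n \<in> carrier_vec dm"
  by (auto simp: x0_def dm_def N_def)

text \<open>The image of \<open>x0\<close> shows every weight except the one in the column of the
  zero entry, and the condition that the weights have product 1 supplies the missing one.\<close>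

lemma G_x0_inj:
  assumes "g \<in> G_ee e n" "h \<in> G_ee e n" "\<And>i. i < dm \<Longrightarrow> (g *\<^sub>v x0 e n) $ i = (h *\<^sub>v x0 e n) $ i"
  shows "g = h"
proof -
  obtain \<sigma> a where g: "monomial \<sigma> a" "\<And>v i. v \<in> carrier_vec dm \<Longrightarrow> i < dm \<Longrightarrow>
    (g *\<^sub>v v) $ i = a i * v $ \<sigma> i"
    "\<And>i. i < dm \<Longrightarrow> \<sigma> i < dm" "\<And>i. i < dm \<Longrightarrow> a i \<in> mu e" "g = mono_mat \<sigma> a"
      by (rule acts_ex[OF assms(1)]) blast
  obtain \<tau> b where h: "monomial \<tau> b" "\<And>v i. v \<in> carrier_vec dm \<Longrightarrow> i < dm \<Longrightarrow>
    (h *\<^sub>v v) $ i = b i * v $ \<tau> i"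
    "\<And>i. i < dm \<Longrightarrow> \<tau> i < dm" "\<And>i. i < dm \<Longrightarrow> b i \<in> mu e" "h = mono_mat \<tau> b"
      by (rule acts_ex[OF assms(2)]) blast
  have eq: "a i * x0 e n $ \<sigma> i = b i * x0 e n $ \<tau> i" if "i < dm" for i
    using assms(3) g(2) h(2) x0_eq(2) that by simp
  have nz: "a i \<noteq> 0" "b i \<noteq> 0" if "i < dm" for i using that g h mu_e_nz by auto
  have st: "\<sigma> i = \<tau> i \<and> (\<sigma> i \<noteq> 0 \<longrightarrow> a i = b i)" if i: "i < dm" for i
  proof (cases "\<sigma> i = 0")
    case True
    then have "x0 e n $ \<tau> i = 0" using eq[OF i] nz i g h x0_eq(1) by simp
    then show ?thesis using True x0_eq(1) h i by (auto split: if_splits)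
  next
    case False
    then have t0: "\<tau> i \<noteq> 0" using eq[OF i] nz i g h x0_eq(1) by (auto split: if_splits)
    have e: "a i * \<zeta> ^ \<sigma> i = b i * \<zeta> ^ \<tau> i" using eq[OF i] g h i x0_eq(1) False t0 by simp
    then have "\<zeta> ^ \<sigma> i / \<zeta> ^ \<tau> i = b i / a i" using nz i by (simp add: field_simps)
    then have "\<zeta> ^ \<sigma> i / \<zeta> ^ \<tau> i \<in> mu e" using g h i mu_divide by metis
    then have "x1 $ \<sigma> i / x1 $ \<tau> i \<in> mu e" using g h i False t0 by (simp add: x1_def)
    then have "\<sigma> i = \<tau> i" using x1_ineq g h i by blast
    then show ?thesis using e by simp
  qed
  have s: "\<sigma> permutes {..<dm}" using g by (simp add: monomial_def)
  define k where "k = inv_into UNIV \<sigma> 0"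
  have k: "k < dm" "\<sigma> k = 0" using s dm_pos perm_less[OF permutes_inv[OF s]]
    by (auto simp: k_def permutes_inverses)
  have ab: "a i = b i" if "i < dm" "i \<noteq> k" for i
    using st[OF that(1)] that k permutes_inj[OF s] by (metis injD)
  have "prod a {..<dm} = a k * prod a ({..<dm} - {k})" "prod b {..<dm} = b k * prod b ({..<dm} -
    {k})"
    using k by (auto intro!: prod.remove)
  moreover have "prod a ({..<dm} - {k}) = prod b ({..<dm} - {k})" using ab by (intro prod.cong) auto
  moreover have "prod a {..<dm} = 1" "prod b {..<dm} = 1" using g h by (auto simp: monomial_def)
  ultimately have "a k = b k" by (metis mult_cancel_right mult_zero_right zero_neq_one)
  then show "g = h" unfolding g h using st ab by (intro mono_mat_cong) metis+
qed

section \<open>Factorisations of the Coxeter element\<close>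

lemmas c_mult_vec = c_elt_mult_vec[OF n1, folded dm_def]

text \<open>A fixed vector has equal entries at 1, ..., n. This common value equals
  \<open>zeta e\<close> times itself, and the entry at 0 equals \<open>inverse (zeta e)\<close>
  times itself, so both vanish.\<close>

lemma c_fixed:
  assumes v: "v \<in> carrier_vec dm" and c: "c_elt e n *\<^sub>v v = v"
  shows "v = 0\<^sub>v dm"
proof -
  have z: "zeta e \<noteq> 1"
  proof
    assume "zeta e = 1"
    then have "zeta e ^ 1 = zeta e ^ 0" by simp
    then show False using zeta_inj[of 1 e 0] e2 by simp
  qed
  have e: "v $ i = (if i = 0 then inverse (zeta e) * v $ 0
     else if i = n then zeta e * v $ 1 else v $ (i + 1))" if "i < dm" for i
  proof -
    have "v $ i = (c_elt e n *\<^sub>v v) $ i" using c by simp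
    then show ?thesis unfolding c_mult_vec[OF v, of e] using that by simp
  qed
  have nm: "n < dm" "1 < dm" using n1 by (auto simp: dm_def)
  have "v $ 0 * zeta e = v $ 0" using e[OF dm_pos] by (simp add: field_simps)
  then have 0: "v $ 0 = 0" using z by simp
  have st: "v $ (n - k) = v $ n" if "k < n" for k
    using that
  proof (induction k)
    case (Suc k)
    then have "v $ (n - Suc k) = v $ (n - Suc k + 1)" using e[of "n - Suc k"] by (auto simp: dm_def)
    then show ?case using Suc by (simp add: Suc_diff_Suc)
  qed simp
  then have all: "v $ i = v $ n" if "1 \<le> i" "i \<le> n" for i
    using st[of "n - i"] that by simp
  have "v $ n = zeta e * v $ n" using e[OF nm(1)] all[of 1] n1 by auto
  then have "v $ n = 0" using z by simp
  then have "v $ i = 0" if "i < dm" for i using all[of i] 0 that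
    by (cases "i = 0") (auto simp: dm_def)
  then show ?thesis using v by (intro eq_vecI) auto
qed

lemma c_acts: "acts (c_elt e n) (\<lambda>z. if z \<in> mu N then \<zeta> * z else inverse (zeta e) * z)"
proof -
  define \<sigma> where "\<sigma> i = (if i = 0 then 0 else if i = n then 1 else if i < n then i + 1 else i)"
    for i
  define a where "a i = (if i = 0 then inverse (zeta e) else if i = n then zeta e else 1)" for i
  have "c_elt e n = mono_mat \<sigma> a"
    by (rule eq_matI) (auto simp: c_elt_def mono_mat_def \<sigma>_def a_def dm_def)
  moreover have "\<sigma> permutes {..<dm}"
  proof (rule bij_imp_permutes)
    have "inj_on \<sigma> {..<dm}" by (auto simp: inj_on_def \<sigma>_def dm_def split: if_splits)
    moreover have "\<sigma> ` {..<dm} \<subseteq> {..<dm}" using n1 by (auto simp: \<sigma>_def dm_def)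
    ultimately show "bij_betw \<sigma> {..<dm} {..<dm}" by (simp add: bij_betw_def endo_inj_surj)
  qed (auto simp: \<sigma>_def dm_def)
  moreover have "prod a {..<dm} = prod a {0, n}"
    by (rule prod.mono_neutral_right) (auto simp: a_def dm_def)
  then have "prod a {..<dm} = 1" using n1 by (simp add: a_def)
  ultimately have G: "c_elt e n \<in> G_ee e n"
    unfolding G_eq by (intro CollectI exI[of _ \<sigma>] exI[of _ a]) (auto simp: monomial_def a_def
      mu_one mu_inverse zeta_mu)
  have "(c_elt e n *\<^sub>v x1) $ i = (if x1 $ i \<in> mu N then \<zeta> * x1 $ i else inverse (zeta e) * x1 $
    i)" if i: "i < dm" for i
  proof (cases "i = 0")
    case True
    have "(2 :: complex) \<notin> mu N" using mu_norm[of N "2 :: complex"] by auto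
    then show ?thesis using True i c_mult_vec[OF x1_carrier, of e] by (simp add: x1_def)
  next
    case False
    then have xi: "x1 $ i = \<zeta> ^ i" "x1 $ 1 = \<zeta>" using i n1 by (auto simp: x1_def dm_def)
    have "(c_elt e n *\<^sub>v x1) $ i = (if i = n then zeta e * x1 $ 1 else x1 $ (i + 1))"
      unfolding c_mult_vec[OF x1_carrier, of e] using False i by simp
    also have "\<dots> = \<zeta> * \<zeta> ^ i" using xi i by (auto simp: zeta_e mult.commute x1_def dm_def)
    finally show ?thesis using mu_pow[OF zeta_mu] xi by simp
  qed
  then show ?thesis using G by (simp add: acts_def)
qed

lemma mat_prod_simps: "mat_prod n [] = 1\<^sub>m dm" "mat_prod n (t # ts) = t * mat_prod n ts"
  by (simp_all add: mat_prod_def dm_def)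

lemma refl_carrier: "t \<in> refls e n \<Longrightarrow> t \<in> carrier_mat dm dm"
  by (simp add: refls_def G_carrier)

lemma mat_prod_carrier: "set ts \<subseteq> refls e n \<Longrightarrow> mat_prod n ts \<in> carrier_mat dm dm"
  by (induction ts) (auto simp: mat_prod_simps refl_carrier intro!: mult_carrier_mat[where n = dm])

lemma mat_prod_append: "set ts \<subseteq> refls e n \<Longrightarrow> set ss \<subseteq> refls e n \<Longrightarrow>
  mat_prod n (ts @ ss) = mat_prod n ts * mat_prod n ss"
proof (induction ts)
  case Nil
  then show ?case using mat_prod_carrier[of ss] by (simp add: mat_prod_simps)
next
  case (Cons t ts)
  then show ?case using mat_prod_carrier[of ss] mat_prod_carrier[of ts] refl_carrier[of t]
    by (simp add: mat_prod_simps assoc_mult_mat[of t dm dm _ dm _ dm])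
qed

lemma mat_prod_fix:
  "set ts \<subseteq> refls e n \<Longrightarrow> v \<in> carrier_vec dm \<Longrightarrow> (\<And>t. t \<in> set ts \<Longrightarrow> t *\<^sub>v v = v) \<Longrightarrow>
    mat_prod n ts *\<^sub>v v = v"
proof (induction ts)
  case (Cons t ts)
  then show ?case using mat_prod_carrier[of ts] refl_carrier[of t]
    by (simp add: mat_prod_simps assoc_mult_mat_vec[of t dm dm _ dm])
qed (simp add: mat_prod_simps)

text \<open>The linear forms of the reflections have no common zero, so the matrix formed by them is invertible.\<close>

lemma c_factorisation:
  assumes ts: "set ts \<subseteq> refls e n" and c: "mat_prod n ts = c_elt e n" and len: "length ts \<le> dm"
  shows "length ts = dm \<and> (\<forall>l<dm. \<exists>v\<in>carrier_vec dm. (\<forall>k<l. ts ! k *\<^sub>v v = v) \<and> ts ! l *\<^sub>v v \<noteq> v)"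
proof -
  have "\<exists>w\<in>carrier_vec dm. \<forall>v\<in>carrier_vec dm. ts ! k *\<^sub>v v = v \<longleftrightarrow> w \<bullet> v = 0" if "k < length ts" for k
    using refl_swap[of "ts ! k"] ts that nth_mem by blast
  then obtain w where w: "\<And>k. k < length ts \<Longrightarrow> w k \<in> carrier_vec dm"
    "\<And>k v. k < length ts \<Longrightarrow> v \<in> carrier_vec dm \<Longrightarrow> ts ! k *\<^sub>v v = v \<longleftrightarrow> w k \<bullet> v = 0" by metis
  \<comment> \<open>Missing forms are replaced by zero rows, so that \<open>L\<close> is square. A
    vector in its kernel is fixed by all factors and hence by \<open>c_elt e n\<close>.\<close>
  define L where "L = mat dm dm (\<lambda>(k, j). if k < length ts then w k $ j else 0)"
  have Lc: "L \<in> carrier_mat dm dm" by (simp add: L_def)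
  have L: "(L *\<^sub>v v) $ k = (if k < length ts then w k \<bullet> v else 0)"
    if "k < dm" "v \<in> carrier_vec dm" for k v
    using that w(1)[of k] by (auto simp: L_def scalar_prod_def)
  have ker: "v = 0\<^sub>v dm" if v: "v \<in> carrier_vec dm" "L *\<^sub>v v = 0\<^sub>v dm" for v
  proof -
    have "w k \<bullet> v = 0" if "k < length ts" for k
      using L[of k v] v that len by simp
    then have "t *\<^sub>v v = v" if "t \<in> set ts" for t
      using w(2) v that by (metis in_set_conv_nth)
    then have "c_elt e n *\<^sub>v v = v" using mat_prod_fix[OF ts v(1)] c by simp
    then show ?thesis using c_fixed v by simp
  qed
  then have "det L \<noteq> 0" using det_0_iff_vec_prod_zero[OF Lc] by blast
  then have "L \<in> Units (ring_mat TYPE(complex) dm ())" by (rule det_non_zero_imp_unit[OF Lc])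
  then obtain B where B: "B \<in> carrier_mat dm dm" "L * B = 1\<^sub>m dm"
    by (auto simp: Units_def ring_mat_def)
  \<comment> \<open>The basis dual to the forms: the form of factor \<open>k\<close> is 0 on
    \<open>v l\<close> unless \<open>k = l\<close>. A zero row admits no such vector, which rules
    out a shorter factorisation.\<close>
  define v where "v l = B *\<^sub>v unit_vec dm l" for l
  have vc: "v l \<in> carrier_vec dm" for l using B by (simp add: v_def)
  have Lv: "L *\<^sub>v v l = unit_vec dm l" for l
    unfolding v_def using B Lc assoc_mult_mat_vec[of L dm dm B dm "unit_vec dm l"] by simp
  have "length ts = dm"
  proof (rule ccontr)
    assume "length ts \<noteq> dm"
    then have "length ts < dm" using len by simp
    then show False using L[of "length ts" "v (length ts)"] vc Lv[of "length ts"] by simp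
  qed
  moreover have "(\<forall>k<l. ts ! k *\<^sub>v v l = v l) \<and> ts ! l *\<^sub>v v l \<noteq> v l" if l: "l < dm" for l
  proof -
    have "w k \<bullet> v l = (if k = l then 1 else 0)" if "k < dm" for k
      using L[of k "v l"] that vc Lv[of l] calculation l by auto
    then show ?thesis using w(2)[of _ "v l"] vc calculation l by auto
  qed
  ultimately show ?thesis using vc by blast
qed

section \<open>Symmetric non-crossing partitions\<close>

definition rot :: "complex \<Rightarrow> complex set \<Rightarrow> complex set" where
  "rot \<omega> p = (*) \<omega> ` p"

lemma rot_mem: "\<omega> \<in> mu e \<Longrightarrow> \<omega> * z \<in> rot \<omega> p \<longleftrightarrow> z \<in> p"
  using mu_e_nz[of \<omega>] by (auto simp: rot_def)

lemma rot_iff: "\<omega> \<in> mu e \<Longrightarrow> z \<in> rot \<omega> p \<longleftrightarrow> z / \<omega> \<in> p"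
  using rot_mem[of \<omega> "z / \<omega>" p] mu_e_nz[of \<omega>] by simp

lemma rot_rot: "rot \<omega> (rot \<omega>' p) = rot (\<omega> * \<omega>') p"
  by (auto simp: rot_def image_image mult.assoc)

lemma rot_one [simp]: "rot 1 p = p" by (simp add: rot_def)

lemma rot_mono: "p \<subseteq> q \<Longrightarrow> rot \<omega> p \<subseteq> rot \<omega> q" by (auto simp: rot_def)

lemma rot_inverse: "\<omega> \<in> mu e \<Longrightarrow> rot \<omega> (rot (inverse \<omega>) p) = p" "\<omega> \<in> mu e \<Longrightarrow>
  rot (inverse \<omega>) (rot \<omega> p) = p"
  using mu_e_nz[of \<omega>] by (auto simp: rot_rot)

lemma rot_inject: "\<omega> \<in> mu e \<Longrightarrow> rot \<omega> p = rot \<omega> q \<longleftrightarrow> p = q"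
  using rot_inverse(2) by metis

lemma rot_empty [simp]: "rot \<omega> p = {} \<longleftrightarrow> p = {}" by (simp add: rot_def)

lemma rot_insert0: "rot \<omega> (insert 0 p) = insert 0 (rot \<omega> p)" by (simp add: rot_def)

lemma hull_rot: "convex hull (rot \<omega> p) = rot \<omega> (convex hull p)"
  unfolding rot_def
  by (rule convex_hull_linear_image[symmetric]) (rule bounded_linear.linear[OF
    bounded_linear_mult_right])

lemma hull_rot_disjoint: "\<omega> \<in> mu e \<Longrightarrow>
    convex hull (rot \<omega> p) \<inter> convex hull (rot \<omega> q) = {} \<longleftrightarrow> convex hull p \<inter> convex hull q = {}"
  unfolding hull_rot using mu_e_nz[of \<omega>] by (auto simp: rot_def)

lemma zero_hull_rot: "\<omega> \<in> mu e \<Longrightarrow> 0 \<in> convex hull (rot \<omega> p) \<longleftrightarrow> 0 \<in> convex hull p"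
  unfolding hull_rot using mu_e_nz[of \<omega>] by (auto simp: rot_def)

text \<open>The average of the \<open>e\<close> points \<open>\<omega> ^ k * z\<close> of
  \<open>p\<close> is \<open>0\<close>, because the first \<open>e\<close> powers of a nontrivial
  e-th root of unity sum to \<open>0\<close>.\<close>

lemma zero_hull:
  assumes w: "\<omega> \<in> mu e" "\<omega> \<noteq> 1" and z: "z \<in> p" and inv: "rot \<omega> p \<subseteq> p"
  shows "0 \<in> convex hull p"
proof -
  have k: "\<omega> ^ k * z \<in> p" for k
  proof (induction k)
    case (Suc k)
    then have "\<omega> * (\<omega> ^ k * z) \<in> rot \<omega> p" by (auto simp: rot_def)
    then show ?case using inv by (auto simp: mult.assoc)
  qed (use z in simp)
  have "(\<Sum>k<e. (1 / real e) *\<^sub>R (\<omega> ^ k * z)) \<in> convex hull p"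
    by (rule convex_sum) (use k hull_inc[of _ p convex] in auto)
  moreover have "(\<Sum>k<e. (1 / real e) *\<^sub>R (\<omega> ^ k * z)) = (1 / real e) *\<^sub>R ((\<Sum>k<e. \<omega> ^ k) * z)"
    by (simp add: scaleR_sum_right sum_distrib_right)
  moreover have "(\<Sum>k<e. \<omega> ^ k) = 0" using w geometric_sum[of \<omega> e] by (simp add: mu_def)
  ultimately show ?thesis by simp
qed

text \<open>Invariance is stated as closure only; applied to inverse rotations it yields the
  equality demanded in \<open>NCP_e1\<close>.\<close>

definition sym_nc :: "complex set set \<Rightarrow> bool" where
  "sym_nc V \<longleftrightarrow> partition_on (mu N) V \<and> (\<forall>p\<in>V. \<forall>q\<in>V. convex hull p \<inter> convex hull q \<noteq> {} \<longrightarrow> p = q) \<and>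
     (\<forall>\<omega>\<in>mu e. \<forall>p\<in>V. rot \<omega> p \<in> V)"

lemma NCP_e1_iff: "V \<in> NCP_e1 e n \<longleftrightarrow> sym_nc V"
proof -
  have "(\<lambda>p. (*) \<omega> ` p) ` V = V" if "\<forall>\<omega>\<in>mu e. \<forall>p\<in>V. rot \<omega> p \<in> V" "\<omega> \<in> mu e" for \<omega>
  proof (intro equalityI subsetI)
    fix p assume "p \<in> V"
    then have "rot (inverse \<omega>) p \<in> V" using that mu_inverse by auto
    then have "rot \<omega> (rot (inverse \<omega>) p) \<in> (\<lambda>p. (*) \<omega> ` p) ` V" by (auto simp: rot_def)
    then show "p \<in> (\<lambda>p. (*) \<omega> ` p) ` V" using that(2) rot_inverse by simp
  qed (use that in \<open>auto simp: rot_def\<close>)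
  then have "(\<forall>\<omega>\<in>mu e. (\<lambda>p. (*) \<omega> ` p) ` V = V) \<longleftrightarrow> (\<forall>\<omega>\<in>mu e. \<forall>p\<in>V. rot \<omega> p \<in> V)"
    unfolding rot_def by blast
  then show ?thesis by (simp only: NCP_e1_def NCP_def sym_nc_def N_def mem_Collect_eq conj_assoc)
qed

lemma zeta_e_ne_1: "zeta e \<noteq> 1"
  using zeta_inj[of 1 e 0] e2 by auto

definition part_at :: "complex set set \<Rightarrow> complex \<Rightarrow> complex set" where
  "part_at V z = (THE p. p \<in> V \<and> z \<in> p)"

definition psucc :: "complex set set \<Rightarrow> complex \<Rightarrow> complex" where
  "psucc V z = nxt_in (part_at V z) z"

context
  fixes V assumes V: "sym_nc V"
begin

lemma sym_nc_sub: "p \<in> V \<Longrightarrow> p \<subseteq> mu N"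
  and sym_nc_ne: "p \<in> V \<Longrightarrow> p \<noteq> {}"
  and sym_nc_ex: "z \<in> mu N \<Longrightarrow> \<exists>p\<in>V. z \<in> p"
  using V by (auto simp: sym_nc_def partition_on_def)

lemma sym_nc_eq: "p \<in> V \<Longrightarrow> q \<in> V \<Longrightarrow> z \<in> p \<Longrightarrow> z \<in> q \<Longrightarrow> p = q"
  using V by (auto simp: sym_nc_def partition_on_def disjoint_def)

lemma sym_nc_hull: "p \<in> V \<Longrightarrow> q \<in> V \<Longrightarrow> p \<noteq> q \<Longrightarrow> convex hull p \<inter> convex hull q = {}"
  using V unfolding sym_nc_def by blast

lemma sym_nc_rot: "\<omega> \<in> mu e \<Longrightarrow> p \<in> V \<Longrightarrow> rot \<omega> p \<in> V"
  using V unfolding sym_nc_def by blast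

lemma sym_nc_finite: "finite V" "p \<in> V \<Longrightarrow> finite p"
proof -
  have "V \<subseteq> Pow (mu N)" using sym_nc_sub by auto
  then show "finite V" "p \<in> V \<Longrightarrow> finite p" using mu_finite[of N] by (auto dest: finite_subset)
qed

text \<open>Rotations fix \<open>0\<close>, so the hulls of \<open>p\<close> and of its rotation
  meet there.\<close>

lemma sym_nc_long_rot: "p \<in> V \<Longrightarrow> 0 \<in> convex hull p \<Longrightarrow> \<omega> \<in> mu e \<Longrightarrow> rot \<omega> p = p"
  using sym_nc_hull[of p "rot \<omega> p"] sym_nc_rot zero_hull_rot by blast

lemma sym_nc_rot_meet:
  assumes "p \<in> V" "\<omega> \<in> mu e" "z \<in> p" "\<omega> * z \<in> p" shows "rot \<omega> p = p"
  using sym_nc_eq[OF sym_nc_rot[OF assms(2,1)] assms(1), of "\<omega> * z"] assms rot_mem by auto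

text \<open>Two points of \<open>p\<close> in one orbit force \<open>p\<close> to be invariant under
  the rotation between them, and by \<open>zero_hull\<close> a nontrivial rotation would put
  \<open>0\<close> in the hull.\<close>

lemma sym_nc_short:
  assumes "p \<in> V" "0 \<notin> convex hull p" "\<omega> \<in> mu e" "z \<in> p" "\<omega> * z \<in> p" shows "\<omega> = 1"
  using sym_nc_rot_meet[OF assms(1,3-5)] zero_hull[of \<omega> z p] assms by auto

lemma part_at_eq: "p \<in> V \<Longrightarrow> z \<in> p \<Longrightarrow> part_at V z = p"
  unfolding part_at_def using sym_nc_eq by (intro the_equality) auto

lemma part_at_in: "z \<in> mu N \<Longrightarrow> part_at V z \<in> V \<and> z \<in> part_at V z"
  using sym_nc_ex part_at_eq by metis

lemma psucc_eq: "p \<in> V \<Longrightarrow> z \<in> p \<Longrightarrow> psucc V z = nxt_in p z"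
  by (simp add: psucc_def part_at_eq)

lemma psucc_in: "p \<in> V \<Longrightarrow> z \<in> p \<Longrightarrow> psucc V z \<in> p"
  by (simp add: psucc_eq nxt_in_in)

lemma psucc_mu: "z \<in> mu N \<Longrightarrow> psucc V z \<in> mu N"
  using psucc_in part_at_in sym_nc_sub by blast

lemma psucc_inj: "z \<in> mu N \<Longrightarrow> w \<in> mu N \<Longrightarrow> psucc V z = psucc V w \<Longrightarrow> z = w"
proof -
  assume a: "z \<in> mu N" "w \<in> mu N" "psucc V z = psucc V w"
  then obtain p q where p: "p \<in> V" "z \<in> p" and q: "q \<in> V" "w \<in> q" using sym_nc_ex by blast
  have "p = q" using sym_nc_eq[of p q "psucc V z"] p q psucc_in[of p z] psucc_in[of q w] a(3)
    by simp
  then show "z = w" using nxt_in_inj[OF sym_nc_sub] p q a(3) psucc_eq by auto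
qed

lemma psucc_rot: "\<omega> \<in> mu e \<Longrightarrow> z \<in> mu N \<Longrightarrow> psucc V (\<omega> * z) = \<omega> * psucc V z"
proof -
  assume a: "\<omega> \<in> mu e" "z \<in> mu N"
  then obtain p where p: "p \<in> V" "z \<in> p" using sym_nc_ex by blast
  have "psucc V (\<omega> * z) = nxt_in (rot \<omega> p) (\<omega> * z)" using p a sym_nc_rot rot_mem
    by (intro psucc_eq) auto
  then show ?thesis using nxt_in_rot mu_e_nz a p psucc_eq by (simp add: rot_def)
qed

lemma sym_nc_window: "p \<in> V \<Longrightarrow> 0 \<notin> convex hull p \<Longrightarrow> \<exists>f\<in>p. p \<subseteq> {f * \<zeta> ^ i | i. i < n}"
proof -
  assume p: "p \<in> V" "0 \<notin> convex hull p"
  obtain z where z: "z \<in> p" using sym_nc_ne p by auto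
  have "rot (zeta e) p \<noteq> p"
    using sym_nc_short[OF p zeta_mu z] rot_mem[OF zeta_mu, of z p] z zeta_e_ne_1 by auto
  then have "convex hull p \<inter> convex hull (rot (zeta e) p) = {}"
    using sym_nc_hull sym_nc_rot zeta_mu p by metis
  then show ?thesis using window_ex[OF sym_nc_sub sym_nc_ne] p by (auto simp: rot_def)
qed

end

definition first_pt :: "complex set \<Rightarrow> complex" where
  "first_pt p = (THE f. f \<in> p \<and> p \<subseteq> {f * \<zeta> ^ i | i. i < n})"

lemma first_eq: "f \<in> p \<Longrightarrow> p \<subseteq> {f * \<zeta> ^ i | i. i < n} \<Longrightarrow> f \<in> mu N \<Longrightarrow> first_pt p = f"
proof -
  assume f: "f \<in> p" "p \<subseteq> {f * \<zeta> ^ i | i. i < n}" "f \<in> mu N"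
  show "first_pt p = f" unfolding first_pt_def
  proof (rule the_equality)
    fix g assume g: "g \<in> p \<and> p \<subseteq> {g * \<zeta> ^ i | i. i < n}"
    obtain i where i: "i < n" "g = f * \<zeta> ^ i" using f g by blast
    obtain j where j: "j < n" "f = g * \<zeta> ^ j" using f g by blast
    \<comment> \<open>Going from \<open>f\<close> to \<open>g\<close> and on to \<open>f\<close>
      takes fewer than \<open>2 * n\<close> steps, which is less than a full turn.\<close>
    have "f * \<zeta> ^ (i + j) = f * \<zeta> ^ 0"
      by (metis i(2) j(2) mult.assoc power_add power_0 mult_1_right)
    moreover have "i + j < N" using i(1) j(1) N_ge by linarith
    ultimately have "i + j = 0" using pos_inj[OF mu_N_nz[OF f(3)], of "i + j" 0] by simp
    then show "g = f" using i by simp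
  qed (use f in auto)
qed

text \<open>The pair \<open>(V, Z)\<close> encodes the element \<open>partition_of V Z\<close> of $NCP(e,e,n+1)$: \<open>V\<close> is $u^\flat$, and
  \<open>Z\<close> is the part of \<open>u\<close> that contains 0, without the 0. So \<open>u\<close> is long symmetric if
  \<open>0 \<in> convex hull Z\<close>, short symmetric if \<open>Z = {}\<close>, and asymmetric otherwise.\<close>

definition config :: "complex set set \<Rightarrow> complex set \<Rightarrow> bool" where
  "config V Z \<longleftrightarrow> sym_nc V \<and> (Z = {} \<or> Z \<in> V) \<and>
     (\<forall>p\<in>V. p \<noteq> Z \<longrightarrow> convex hull (insert 0 Z) \<inter> convex hull p = {})"

text \<open>In the asymmetric case the cycle through 0 arises from the cyclic order of \<open>Z\<close> by inserting a point
  of radius 2 in front of the first element, which is what \<open>swap\<close> does.\<close>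

definition succ_map :: "complex set set \<Rightarrow> complex set \<Rightarrow> complex \<Rightarrow> complex" where
  "succ_map V Z z = (let z' = (if z \<in> mu N then psucc V z else if 0 \<in> convex hull Z then inverse
    (zeta e) * z else z) in
     if Z \<noteq> {} \<and> 0 \<notin> convex hull Z then swap (first_pt Z) 2 z' else z')"

definition partition_of :: "complex set set \<Rightarrow> complex set \<Rightarrow> complex set set" where
  "partition_of V Z = insert (insert 0 Z) (V - {Z})"

lemma zero_notin_mu: "0 \<notin> mu N" using mu_N_nz by auto

text \<open>The hulls of \<open>p\<close> and of \<open>insert 0 Z\<close> share the point
  \<open>0\<close>.\<close>

lemma config_long: "config V Z \<Longrightarrow> p \<in> V \<Longrightarrow> 0 \<in> convex hull p \<Longrightarrow> p = Z"
  unfolding config_def using hull_inc[of 0 "insert 0 Z" convex] by blast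

lemma config_sub: "config V Z \<Longrightarrow> Z \<subseteq> mu N"
  unfolding config_def using sym_nc_sub by auto

lemma first_props:
  assumes "config V Z" "Z \<noteq> {}" "0 \<notin> convex hull Z"
  shows "first_pt Z \<in> Z" "Z \<subseteq> {first_pt Z * \<zeta> ^ i | i. i < n}" "first_pt Z \<in> mu N"
proof -
  have V: "sym_nc V" "Z \<in> V" using assms by (auto simp: config_def)
  obtain f where f: "f \<in> Z" "Z \<subseteq> {f * \<zeta> ^ i | i. i < n}" using sym_nc_window[OF V assms(3)] by auto
  have fm: "f \<in> mu N" using f sym_nc_sub[OF V] by auto
  show "first_pt Z \<in> Z" "Z \<subseteq> {first_pt Z * \<zeta> ^ i | i. i < n}" "first_pt Z \<in> mu N"
    unfolding first_eq[OF f fm] using f fm by auto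
qed

lemma flat_build:
  assumes "config V Z" shows "flat e n (partition_of V Z) = V"
proof -
  have V: "sym_nc V" "Z = {} \<or> Z \<in> V" using assms by (auto simp: config_def)
  have 1: "p \<inter> mu N = p" "p \<noteq> {}" if "p \<in> V" for p
    using sym_nc_sub[OF V(1) that] sym_nc_ne[OF V(1) that] by auto
  have 2: "insert 0 Z \<inter> mu N = Z" using config_sub[OF assms] zero_notin_mu by auto
  show ?thesis unfolding flat_def partition_of_def N_def[symmetric]
    using 1 2 V(2) by (auto simp: image_iff) (metis 1 2)+
qed

lemma NCP_ee_eq: "NCP_ee e n = {partition_of V Z | V Z. config V Z}"
proof (intro equalityI subsetI)
  fix u assume "u \<in> {partition_of V Z | V Z. config V Z}"
  then obtain V Z where u: "u = partition_of V Z" and c: "config V Z" by auto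
  have V: "sym_nc V" "Z = {} \<or> Z \<in> V" using c by (auto simp: config_def)
  have Zm: "Z \<subseteq> mu N" using config_sub[OF c] .
  have "partition_on (mu N \<union> {0}) u"
  proof (rule partition_onI)
    show "\<Union> u = mu N \<union> {0}"
      unfolding u partition_of_def using Zm sym_nc_sub[OF V(1)] sym_nc_ex[OF V(1)] by auto blast
    show "disjnt p q" if "p \<in> u" "q \<in> u" "p \<noteq> q" for p q
      using that sym_nc_eq[OF V(1)] V(2) sym_nc_sub[OF V(1)] zero_notin_mu
        unfolding u partition_of_def disjnt_iff by blast
    show "{} \<notin> u" using sym_nc_ne[OF V(1)] unfolding u partition_of_def by auto
  qed
  moreover have "p = q" if "p \<in> u" "q \<in> u" "convex hull p \<inter> convex hull q \<noteq> {}" for p q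
    using that sym_nc_hull[OF V(1)] c unfolding u partition_of_def config_def
      by (auto simp: Int_commute)
  ultimately have "u \<in> NCP (mu N \<union> {0})" by (auto simp: NCP_def)
  then show "u \<in> NCP_ee e n" using flat_build[OF c] V(1) unfolding NCP_ee_def NCP_e1_iff u
    by (simp add: N_def NCP_e1_iff)
next
  fix u assume "u \<in> NCP_ee e n"
  then have u: "u \<in> NCP (mu N \<union> {0})" "sym_nc (flat e n u)"
    by (auto simp: NCP_ee_def N_def NCP_e1_iff)
  then have p: "partition_on (mu N \<union> {0}) u" and h: "\<And>p q. p \<in> u \<Longrightarrow> q \<in> u \<Longrightarrow> p \<noteq> q \<Longrightarrow>
    convex hull p \<inter> convex hull q = {}"
    unfolding NCP_def by blast+
  have sub: "q \<subseteq> mu N \<union> {0}" "q \<noteq> {}" if "q \<in> u" for q using p that by (auto simp: partition_on_def)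
  have dis: "q = q'" if "q \<in> u" "q' \<in> u" "z \<in> q" "z \<in> q'" for q q' z
    using p that by (auto simp: partition_on_def disjoint_def)
  obtain Q where Q: "Q \<in> u" "0 \<in> Q" using p by (auto simp: partition_on_def)
  define V where "V = flat e n u"
  define Z where "Z = Q - {0}"
  have Q0: "Q = insert 0 Z" using Q by (auto simp: Z_def)
  have other: "q \<inter> mu N = q" if "q \<in> u" "q \<noteq> Q" for q
    using sub[OF that(1)] dis[OF that(1) Q(1) _ Q(2)] that by auto
  have QZ: "Q \<inter> mu N = Z" using sub[OF Q(1)] zero_notin_mu by (auto simp: Z_def)
  have Vq: "q \<inter> mu N \<in> V" if "q \<in> u" "q \<inter> mu N \<noteq> {}" for q using that
    by (auto simp: V_def flat_def N_def)
  have VD: "p = Z \<or> (p \<in> u \<and> p \<noteq> Q)" if pV: "p \<in> V" for p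
  proof -
    obtain q where q: "q \<in> u" "p = q \<inter> mu N" using pV by (auto simp: V_def flat_def N_def)
    then show ?thesis using other[of q] QZ by (cases "q = Q") auto
  qed
  have Z1: "Z = {} \<or> Z \<in> V" using Vq[OF Q(1)] QZ by auto
  have uV: "p \<in> V \<and> p \<noteq> Z" if "p \<in> u" "p \<noteq> Q" for p
    using Vq[OF that(1)] other[OF that] sub[OF that(1)] dis[OF that(1) Q(1)] that(2) Q0 by auto
  have "u = partition_of V Z"
    unfolding partition_of_def Q0[symmetric] using uV VD Q(1) by blast
  moreover have "config V Z" unfolding config_def
  proof (intro conjI ballI impI)
    show "convex hull (insert 0 Z) \<inter> convex hull p = {}" if "p \<in> V" "p \<noteq> Z" for p
      using VD[OF that(1)] that h[OF Q(1), of p] Q0 by auto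
  qed (use u(2) Z1 in \<open>auto simp: V_def\<close>)
  ultimately show "u \<in> {partition_of V Z | V Z. config V Z}" by blast
qed

section \<open>Successor maps and the elements \<open>g_elt\<close>\<close>

lemma succ_map_mu: "z \<in> mu N \<Longrightarrow> succ_map V Z z = (if Z \<noteq> {} \<and>
  0 \<notin> convex hull Z then swap (first_pt Z) 2 (psucc V z) else psucc V z)"
  by (simp add: succ_map_def)

lemma two_notin_mu: "2 * \<omega> \<notin> mu N" if "\<omega> \<in> mu e"
  using mu_norm[of N "2 * \<omega>"] mu_norm[of e \<omega>] that by (auto simp: norm_mult)

lemma swap_right: "x \<noteq> 0 \<Longrightarrow> y \<noteq> 0 \<Longrightarrow> y / x \<notin> mu e \<Longrightarrow> swap x y y = x"
  by (simp add: swap_def mu_one)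

lemma swap_left: "x \<noteq> 0 \<Longrightarrow> swap x y x = y"
  by (simp add: swap_def mu_one)

text \<open>Resolves the definite descriptions in \<open>nxt\<close>,
  \<open>is_special_index\<close> and \<open>g_elt\<close>. Since \<open>x0\<close> is
  \<open>x1\<close> with the entry 2 replaced by 0, a coordinate of the image of \<open>x0\<close>
  is the value of \<open>succ_map\<close> when this is on the unit circle, and 0 when it has radius
  2.\<close>

lemma g_elt_build:
  assumes c: "config V Z" and g: "acts g (succ_map V Z)"
  shows "g_elt e n (partition_of V Z) = g"
proof -
  let ?u = "partition_of V Z"
  have V: "sym_nc V" "Z = {} \<or> Z \<in> V" using c by (auto simp: config_def)
  have Zm: "Z \<subseteq> mu N" using config_sub[OF c] .
  have Z0: "0 \<notin> Z" using Zm zero_notin_mu by auto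
  have long: "long (flat e n ?u) \<longleftrightarrow> 0 \<in> convex hull Z"
    unfolding flat_build[OF c] long_def using config_long[OF c] V(2)
      by (auto simp: convex_hull_empty) 
  have zu: "{0} \<in> ?u \<longleftrightarrow> Z = {}"
    unfolding partition_of_def using sym_nc_sub[OF V(1)] zero_notin_mu Z0 by auto
  have as: "asymmetric e n ?u \<longleftrightarrow> Z \<noteq> {} \<and> 0 \<notin> convex hull Z"
    unfolding asymmetric_def long zu by auto
  have ls: "long_symmetric e n ?u \<longleftrightarrow> 0 \<in> convex hull Z"
    unfolding long_symmetric_def long ..
  have the0: "(THE p. p \<in> ?u \<and> 0 \<in> p) = insert 0 Z"
    by (rule the_equality) (use sym_nc_sub[OF V(1)] zero_notin_mu in \<open>auto simp: partition_of_def\<close>)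
  have the1: "(THE p. p \<in> ?u \<and> z \<in> p) = (if part_at V z = Z then insert 0 Z else part_at V z)"
    if z: "z \<in> mu N" for z
  proof (rule the_equality)
    show "(if part_at V z = Z then insert 0 Z else part_at V z) \<in> ?u \<and>
      z \<in> (if part_at V z = Z then insert 0 Z else part_at V z)"
      using part_at_in[OF V(1) z] by (auto simp: partition_of_def)
    fix p assume p: "p \<in> ?u \<and> z \<in> p"
    show "p = (if part_at V z = Z then insert 0 Z else part_at V z)"
    proof (cases "p = insert 0 Z")
      case True
      then have "z \<in> Z" using p z zero_notin_mu by auto
      then have "part_at V z = Z" using V part_at_eq by auto
      then show ?thesis using True by simp
    next
      case False
      then have "p \<in> V" "p \<noteq> Z" using p by (auto simp: partition_of_def)
      then show ?thesis using part_at_eq[OF V(1), of p z] p by auto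
    qed
  qed
  define f where "f = first_pt Z"
  have fp: "f \<in> Z" "Z \<subseteq> {f * \<zeta> ^ i | i. i < n}" "f \<in> mu N" if "Z \<noteq> {} \<and> 0 \<notin> convex hull Z"
    using first_props[OF c] that by (auto simp: f_def)
  have ptm: "part_at V z \<subseteq> mu N" "z \<in> part_at V z" if "z \<in> mu N" for z
    using part_at_in[OF V(1) that] sym_nc_sub[OF V(1)] by auto
  \<comment> \<open>Inserting \<open>0\<close> into an asymmetric part affects a single point of the
    circle, the one whose successor in \<open>Z\<close> would be the first point
    \<open>f\<close>.\<close>
  have nx: "nxt e n ?u z = (if Z \<noteq> {} \<and> 0 \<notin> convex hull Z \<and> psucc V z = f then 0 else psucc V z)"
    if z: "z \<in> mu N" for z
  proof (cases "part_at V z = Z")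
    case True
    have zz: "z \<in> Z" "z \<noteq> 0" using ptm[OF z] True Z0 by auto
    show ?thesis
    proof (cases "0 \<in> convex hull Z")
      case True
      then show ?thesis using \<open>part_at V z = Z\<close> the1[OF z] zz Z0 ccw_succ_nxt_in[OF Zm zz(1)]
        by (simp add: nxt_def ls psucc_def)
    next
      case False
      then have "Z \<noteq> {} \<and> 0 \<notin> convex hull Z" using zz by auto
      then show ?thesis using \<open>part_at V z = Z\<close> the1[OF z] ccw_succ_window(2)[of Z f z] fp zz
        by (simp add: nxt_def ls psucc_def)
    qed
  next
    case False
    have "\<not> (Z \<noteq> {} \<and> 0 \<notin> convex hull Z \<and> psucc V z = f)"
    proof
      assume that': "Z \<noteq> {} \<and> 0 \<notin> convex hull Z \<and> psucc V z = f"
      then have that: "Z \<noteq> {} \<and> 0 \<notin> convex hull Z" by simp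
      from that' have "f \<in> part_at V z" using psucc_in[OF V(1), of "part_at V z" z]
        part_at_in[OF V(1) z] by auto
      then show False using sym_nc_eq[OF V(1), of "part_at V z" Z f]
        fp(1) that part_at_in[OF V(1) z] V(2) False by auto
    qed
    moreover have "0 \<notin> part_at V z" using ptm z zero_notin_mu by blast
    moreover have "nxt e n ?u z = psucc V z" using False the1[OF z] ccw_succ_nxt_in[OF ptm[OF z]]
      calculation(2)
      by (simp add: nxt_def ls psucc_def)
    ultimately show ?thesis by (simp only: if_False)
  qed
  have nx0: "nxt e n ?u 0 = (if Z \<noteq> {} \<and> 0 \<notin> convex hull Z then f else 0)"
  proof (cases "Z \<noteq> {} \<and> 0 \<notin> convex hull Z")
    case True
    then show ?thesis using ccw_succ_window(1)[OF fp(2,1,3)] by (simp add: nxt_def ls the0)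
  next
    case False
    then show ?thesis by (auto simp: nxt_def ls the0 ccw_succ_def)
  qed
  have f2: "f / 2 \<notin> mu e" "2 / f \<notin> mu e" "f \<noteq> 0" if "Z \<noteq> {} \<and> 0 \<notin> convex hull Z"
    using two_not_unit fp[OF that] mu_N_nz by auto
  have sp: "is_special_index e n ?u j \<longleftrightarrow> Z \<noteq> {} \<and> 0 \<notin> convex hull Z \<and> psucc V (\<zeta> ^ j) / f \<in> mu e"
    if j: "j \<in> {1..n}" for j
  proof (cases "Z \<noteq> {} \<and> 0 \<notin> convex hull Z")
    case True
    note f = fp[OF True]
    have jm: "\<zeta> ^ j \<in> mu N" by (intro mu_pow zeta_mu)
    have Zv: "Z \<in> V" using True V by auto
    \<comment> \<open>An injective self-map of a finite set is onto; this provides the last point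
      \<open>l\<close> of \<open>Z\<close>, the one whose successor is \<open>f\<close>.\<close>
    have "inj_on (nxt_in Z) Z" using nxt_in_inj[OF Zm] by (auto simp: inj_on_def)
    then have "nxt_in Z ` Z = Z" using endo_inj_surj[of Z "nxt_in Z"] sym_nc_finite(2)[OF V(1) Zv]
      nxt_in_in by auto
    then obtain l where l: "l \<in> Z" "nxt_in Z l = f" using f(1) by (metis imageE)
    have lm: "l \<in> mu N" using l Zm by auto
    have lf: "psucc V l = f" using l psucc_eq[OF V(1) Zv] by simp
    have "(THE z. z \<in> mu (e * n) \<and> nxt e n ?u z = 0) = l"
    proof (rule the_equality)
      show "l \<in> mu (e * n) \<and> nxt e n ?u l = 0" using lm nx[OF lm] lf True by (simp add: N_def)
      fix z assume "z \<in> mu (e * n) \<and> nxt e n ?u z = 0"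
      then have z: "z \<in> mu N" "nxt e n ?u z = 0" by (auto simp: N_def)
      then have "psucc V z = f" using nx[OF z(1)] mu_N_nz[OF psucc_mu[OF V(1) z(1)]]
        by (auto split: if_splits)
      then show "z = l" using psucc_inj[OF V(1) z(1) lm] lf by simp
    qed
    then have "is_special_index e n ?u j \<longleftrightarrow> (\<exists>\<omega>\<in>mu e. l = \<omega> * \<zeta> ^ j)"
      using True j as by (auto simp: is_special_index_def N_def)
    \<comment> \<open>Equivariance and injectivity of \<open>psucc\<close> carry the condition from
      \<open>l\<close> to its image \<open>f\<close>.\<close>
    also have "\<dots> \<longleftrightarrow> (\<exists>\<omega>\<in>mu e. f = \<omega> * psucc V (\<zeta> ^ j))"
      using psucc_rot[OF V(1) _ jm] lf psucc_inj[OF V(1) lm] mu_N_rot jm by metis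
    also have "\<dots> \<longleftrightarrow> f / psucc V (\<zeta> ^ j) \<in> mu e"
      using mu_N_nz[OF psucc_mu[OF V(1) jm]] by (auto simp: divide_eq_eq intro!: bexI[of _ "f /
        psucc V (\<zeta> ^ j)"])
    finally show ?thesis using True unit_div_sym by blast
  qed (auto simp: is_special_index_def as)
  have gG: "g \<in> G_ee e n" using g by (simp add: acts_def)
  obtain \<sigma> a where ga: "\<And>v i. v \<in> carrier_vec dm \<Longrightarrow> i < dm \<Longrightarrow> (g *\<^sub>v v) $ i = a i * v $ \<sigma> i"
    "\<And>i. i < dm \<Longrightarrow> \<sigma> i < dm" "\<And>i. i < dm \<Longrightarrow> a i \<in> mu e"
    using acts_ex[OF gG] by metis
  have key: "(g *\<^sub>v x0 e n) $ i = (if succ_map V Z (x1 $ i) \<in> mu N then succ_map V Z (x1 $ i) else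
    0)" if i: "i < dm" for i
  proof -
    have p: "succ_map V Z (x1 $ i) = a i * x1 $ \<sigma> i" using g ga(1)[OF x1_carrier i] i
      by (simp add: acts_def)
    have ai: "a i \<in> mu e" "\<sigma> i < dm" using ga i by auto
    show ?thesis
    proof (cases "\<sigma> i = 0")
      case True
      then show ?thesis using p ga(1)[OF x0_eq(2) i] ai x0_eq(1)[of 0] dm_pos two_notin_mu[OF ai(1)]
        by (simp add: x1_def mult.commute)
    next
      case False
      then have "x1 $ \<sigma> i = \<zeta> ^ \<sigma> i" "x0 e n $ \<sigma> i = \<zeta> ^ \<sigma> i" using ai x0_eq(1)
        by (auto simp: x1_def)
      then show ?thesis using p ga(1)[OF x0_eq(2) i] mu_N_rot[OF ai(1) mu_pow[OF zeta_mu]] by simp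
    qed
  qed
  let ?y = "vec dm (\<lambda>j. if j = 0 then nxt e n ?u 0
       else if is_special_index e n ?u j then 0 else nxt e n ?u (\<zeta> ^ j))"
  have "g *\<^sub>v x0 e n = ?y"
  proof (rule eq_vecI)
    fix i assume "i < dim_vec ?y"
    then have i: "i < dm" by simp
    show "(g *\<^sub>v x0 e n) $ i = ?y $ i"
    proof (cases "i = 0")
      case True
      have "(2 :: complex) \<notin> mu N" using two_notin_mu[OF mu_one] by simp
      moreover have "inverse (zeta e) * 2 \<notin> mu N" using two_notin_mu[OF mu_inverse[OF zeta_mu]]
        by (simp add: mult.commute)
      ultimately show ?thesis
        using True i key[OF i] nx0 f2 fp(3) by (auto simp: x1_def succ_map_def swap_right f_def)
    next
      case False
      then have j: "i \<in> {1..n}" using i by (auto simp: dm_def)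
      have jm: "\<zeta> ^ i \<in> mu N" by (intro mu_pow zeta_mu)
      have xi: "x1 $ i = \<zeta> ^ i" using i False by (simp add: x1_def)
      note sm = psucc_mu[OF V(1) jm]
      show ?thesis
      proof (cases "Z \<noteq> {} \<and> 0 \<notin> convex hull Z")
        case True
        have "succ_map V Z (\<zeta> ^ i) = swap f 2 (psucc V (\<zeta> ^ i))" using True jm
          by (simp add: succ_map_mu f_def)
        moreover have "swap f 2 (psucc V (\<zeta> ^ i)) = (if psucc V (\<zeta> ^ i) / f \<in> mu e then 2 * (psucc
          V (\<zeta> ^ i) / f) else psucc V (\<zeta> ^ i))"
          using two_not_unit(1)[OF sm] by (simp add: swap_def)
        ultimately show ?thesis
          using key[OF i] xi i False sp[OF j] nx[OF jm]
            True two_notin_mu[of "psucc V (\<zeta> ^ i) / f"] sm f2(3)[OF True]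
          by (auto simp: mu_one)
      next
        case F: False
        then have "succ_map V Z (\<zeta> ^ i) = psucc V (\<zeta> ^ i)"
          by (simp only: succ_map_mu[OF jm] if_False)
        then show ?thesis using key[OF i] xi i False sp[OF j] nx[OF jm] F sm by auto
      qed
    qed
  qed (use G_carrier[OF gG] in simp)
  then show ?thesis
    unfolding g_elt_def N_def[symmetric] dm_def[symmetric]
    using gG G_x0_inj by (intro the_equality) (auto simp: dm_def)
qed

section \<open>Splitting off an arc\<close>

lemma swap_invol:
  assumes "x \<noteq> 0" "y \<noteq> 0" "y / x \<notin> mu e" shows "swap x y (swap x y z) = z"
proof (cases "z / x \<in> mu e")
  case True
  then have "swap x y (swap x y z) = z / x * swap x y y" using swap_rot[OF True]
    by (simp add: swap_def)
  then show ?thesis using swap_right[OF assms] assms by simp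
next
  case False
  show ?thesis
  proof (cases "z / y \<in> mu e")
    case True
    then have "swap x y z = z / y * x" using False by (simp add: swap_def)
    then have "swap x y (swap x y z) = z / y * swap x y x" using swap_rot[OF True] by metis
    then show ?thesis using swap_left assms by simp
  qed (use False in \<open>simp add: swap_def\<close>)
qed

lemma swap_nz: "x \<noteq> 0 \<Longrightarrow> y \<noteq> 0 \<Longrightarrow> z \<noteq> 0 \<Longrightarrow> swap x y z \<noteq> 0"
  by (auto simp: swap_def)

lemma swap_id: "z / x \<notin> mu e \<Longrightarrow> z / y \<notin> mu e \<Longrightarrow> swap x y z = z"
  by (simp add: swap_def)

text \<open>Conjugation by an equivariant involution relabels the orbits of an exchange. This serves
  to move the insertion of the radius 2 point past the exchange of a splitting.\<close>

lemma swap_conj: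
  assumes xy: "x \<noteq> 0" "y \<noteq> 0" "y / x \<notin> mu e" and u: "u \<noteq> 0" "w \<noteq> 0"
  shows "swap x y (swap u w z) = swap (swap x y u) (swap x y w) (swap x y z)"
proof -
  have ratio: "swap x y z / swap x y u = z / u" if "z / u \<in> mu e" "u \<noteq> 0" for u
    using swap_rot[OF that(1), of x y u] that swap_nz[OF xy(1,2) that(2)] by simp
  have iff: "swap x y z / swap x y u \<in> mu e \<longleftrightarrow> z / u \<in> mu e" if u: "u \<noteq> 0" for u
  proof
    assume a: "swap x y z / swap x y u \<in> mu e"
    have "swap x y z = swap x y z / swap x y u * swap x y u" using swap_nz[OF xy(1,2) u] by simp
    then have "swap x y (swap x y z) = swap x y z / swap x y u * swap x y (swap x y u)"
      using swap_rot[OF a] by metis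
    then have "z = swap x y z / swap x y u * u" unfolding swap_invol[OF xy] .
    then have "z / u = swap x y z / swap x y u" using u by (metis nonzero_mult_div_cancel_right)
    then show "z / u \<in> mu e" using a by simp
  qed (use ratio u in auto)
  show ?thesis
    unfolding swap_def[of u w] swap_def[of "swap x y u" "swap x y w"] iff[OF u(1)] iff[OF u(2)]
    using swap_rot[of "z / u" x y w] swap_rot[of "z / w" x y u] ratio[OF _ u(1)] ratio[OF _ u(2)]
      by auto
qed

definition satur :: "complex set \<Rightarrow> complex set" where
  "satur r = {\<omega> * z | \<omega> z. \<omega> \<in> mu e \<and> z \<in> r}"

text \<open>All rotations of \<open>r\<close> are detached at the same time, which keeps the
  symmetry. An empty remainder arises when nothing of a part is left, and is dropped.\<close>

definition split_off :: "complex set set \<Rightarrow> complex set \<Rightarrow> complex set set" where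
  "split_off V r = ({p - satur r | p. p \<in> V} - {{}}) \<union> {rot \<omega> r | \<omega>. \<omega> \<in> mu e}"

text \<open>This is \<open>e\<close> times the dimension of the fixed space of $g_u$.\<close>

definition rank :: "complex set set \<Rightarrow> complex set \<Rightarrow> nat" where
  "rank V Z = card {p \<in> V. 0 \<notin> convex hull p} + (if Z = {} then e else 0)"

lemma satur_rot: "\<omega> \<in> mu e \<Longrightarrow> \<omega> * z \<in> satur r \<longleftrightarrow> z \<in> satur r"
proof -
  have *: "\<omega> * z \<in> satur r" if w: "\<omega> \<in> mu e" and z: "z \<in> satur r" for \<omega> z
  proof -
    obtain \<omega>' y where "\<omega>' \<in> mu e" "y \<in> r" "z = \<omega>' * y" using z unfolding satur_def by auto
    then have "\<omega> * z = (\<omega> * \<omega>') * y" "\<omega> * \<omega>' \<in> mu e" using w mu_mult by auto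
    then show ?thesis using \<open>y \<in> r\<close> unfolding satur_def by blast
  qed
  assume w: "\<omega> \<in> mu e"
  then show ?thesis using *[of \<omega> z] *[of "inverse \<omega>" "\<omega> * z"] mu_inverse[OF w] mu_e_nz[OF w]
    by (auto simp flip: mult.assoc)
qed

lemma satur_incl: "r \<subseteq> satur r"
  unfolding satur_def using mu_one by force

lemma satur_alt: "z \<in> satur r \<longleftrightarrow> (\<exists>\<omega>\<in>mu e. z \<in> rot \<omega> r)"
  unfolding satur_def rot_def by auto

lemma rot_diff_satur: "\<omega> \<in> mu e \<Longrightarrow> rot \<omega> (p - satur r) = rot \<omega> p - satur r"
  using satur_rot[of \<omega>] by (auto simp: rot_def)

lemma rots_rot: 
  assumes w: "\<omega> \<in> mu e"
  shows "{rot \<omega>' (rot \<omega> r) | \<omega>'. \<omega>' \<in> mu e} = {rot \<omega>' r | \<omega>'. \<omega>' \<in> mu e}"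
proof -
  have "rot \<omega>' r \<in> {rot \<omega>' (rot \<omega> r) | \<omega>'. \<omega>' \<in> mu e}" if "\<omega>' \<in> mu e" for \<omega>'
  proof -
    have "rot \<omega>' r = rot (\<omega>' / \<omega>) (rot \<omega> r)" using mu_e_nz[OF w] by (simp add: rot_rot)
    then show ?thesis using mu_divide[OF that w] by blast
  qed
  then show ?thesis using mu_mult[OF _ w] by (auto simp: rot_rot)
qed

lemma satur_rot_eq: "\<omega> \<in> mu e \<Longrightarrow> satur (rot \<omega> r) = satur r"
proof -
  have *: "satur r = \<Union> {rot \<omega>' r | \<omega>'. \<omega>' \<in> mu e}" for r using satur_alt by blast
  assume "\<omega> \<in> mu e"
  then show ?thesis unfolding * by (simp only: rots_rot)
qed

lemma split_rot: "\<omega> \<in> mu e \<Longrightarrow> split_off V (rot \<omega> r) = split_off V r"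
  by (simp only: split_off_def satur_rot_eq rots_rot)

end

text \<open>\<open>H2\<close> and \<open>H3\<close> concern \<open>succ_map\<close> and not
  \<open>psucc\<close>, so that \<open>r\<close> may be all of an asymmetric \<open>Z\<close>: there
  only the point of radius 2 interrupts the cycle, and the splitting detaches \<open>0\<close>.
  \<open>PZ\<close> selects a representative among the rotations of \<open>P\<close>;
  \<open>arc_move\<close> removes this condition.\<close>

locale arc_split = refl_group +
  fixes V :: "complex set set" and Z P r :: "complex set" and a l :: complex and k :: nat
  assumes c: "config V Z" and P: "P \<in> V" and aP: "a \<in> P" and l: "l = a * \<zeta> ^ k" and lP: "l \<in> P"
    and k: "k < N"
    and r: "r = {z \<in> P. \<exists>i\<le>k. z = a * \<zeta> ^ i}"
    and H1: "\<And>z \<omega>. z \<in> r \<Longrightarrow> \<omega> \<in> mu e \<Longrightarrow> \<omega> * z \<in> r \<Longrightarrow> \<omega> = 1"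
    and H2: "\<And>z. z \<in> r \<Longrightarrow> z \<noteq> l \<Longrightarrow> succ_map V Z z \<in> r"
    and H3: "succ_map V Z l \<notin> satur r"
    and PZ: "P = Z \<or> (\<forall>\<omega>\<in>mu e. rot \<omega> P \<noteq> Z)"
begin

lemma V: "sym_nc V" and ZV: "Z = {} \<or> Z \<in> V" using c by (auto simp: config_def)

lemma aN: "a \<in> mu N" and lN: "l \<in> mu N" and a0: "a \<noteq> 0" and l0: "l \<noteq> 0"
  using sym_nc_sub[OF V P] aP lP mu_N_nz by auto

lemma a_r: "a \<in> r" and l_r: "l \<in> r" and r_P: "r \<subseteq> P"
  using aP lP l unfolding r by (auto intro: exI[of _ 0])

lemma r_N: "r \<subseteq> mu N" using r_P sym_nc_sub[OF V P] by auto

lemma P_pos: "z \<in> P \<Longrightarrow> \<exists>i<N. z = a * \<zeta> ^ i \<and> (z \<in> r \<longleftrightarrow> i \<le> k)"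
proof -
  assume z: "z \<in> P"
  then obtain i where i: "i < N" "z = a * \<zeta> ^ i" using pos_ex[OF aN] sym_nc_sub[OF V P] by blast
  have "z \<in> r \<longleftrightarrow> i \<le> k"
  proof
    assume "z \<in> r"
    then obtain i' where i': "i' \<le> k" "z = a * \<zeta> ^ i'" unfolding r by auto
    then show "i \<le> k" using pos_inj[OF a0, of i i'] i k by auto
  qed (use z i in \<open>auto simp: r\<close>)
  then show ?thesis using i by auto
qed

definition b where "b = psucc V l"

lemma bP: "b \<in> P" unfolding b_def using psucc_in[OF V P lP] .

lemma bN: "b \<in> mu N" and b0: "b \<noteq> 0" using bP sym_nc_sub[OF V P] mu_N_nz by auto

lemma b_pos: "\<exists>j. 0 < j \<and> j \<le> N \<and> b = l * \<zeta> ^ j \<and> (\<forall>i. 0 < i \<and> i < j \<longrightarrow> l * \<zeta> ^ i \<notin> P)"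
  using nxt_in_ex[OF lP] psucc_eq[OF V P lP] unfolding b_def by metis

lemma inner_succ:
  assumes y: "y \<in> r" "y \<noteq> l"
  shows "psucc V y \<in> r \<and> psucc V y \<noteq> a"
proof -
  obtain i where i: "i < N" "y = a * \<zeta> ^ i" "i \<le> k" using P_pos[of y] y r_P by auto
  have yP: "y \<in> P" using y r_P by auto
  obtain j where j: "0 < j" "nxt_in P y = y * \<zeta> ^ j" "y * \<zeta> ^ j \<in> P" "\<forall>i. 0 < i \<and>
    i < j \<longrightarrow> y * \<zeta> ^ i \<notin> P"
    using nxt_in_ex[OF yP] by auto
  have ik: "i < k" using i y l by (cases "i = k") auto
  have "y * \<zeta> ^ (k - i) = l" using i ik l by (simp add: mult.assoc flip: power_add)
  then have "\<not> k - i < j" using j(4)[rule_format, of "k - i"] ik lP by auto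
  then have ijk: "i + j \<le> k" using ik by simp
  have eq: "psucc V y = a * \<zeta> ^ (i + j)" using psucc_eq[OF V P yP] j i
    by (simp add: power_add mult.assoc)
  have "a * \<zeta> ^ (i + j) \<noteq> a * \<zeta> ^ 0" using pos_inj[OF a0, of "i + j" 0] ijk k j(1) N_pos by linarith
  then show ?thesis using eq ijk psucc_in[OF V P yP] unfolding r by auto
qed

text \<open>The step into \<open>r\<close> starts outside the arc and passes no point of
  \<open>P\<close>, so it cannot pass \<open>a\<close>.\<close>

lemma enter_arc:
  assumes z: "z \<in> P" "z \<notin> r" "psucc V z \<in> r"
  shows "psucc V z = a"
proof (rule ccontr)
  assume ne: "psucc V z \<noteq> a"
  obtain i where i: "0 < i" "nxt_in P z = z * \<zeta> ^ i" "\<forall>j. 0 < j \<and> j < i \<longrightarrow> z * \<zeta> ^ j \<notin> P"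
    using nxt_in_ex[OF z(1)] by auto
  obtain t where t: "t \<le> k" "z * \<zeta> ^ i = a * \<zeta> ^ t" using z(3) psucc_eq[OF V P z(1)] i unfolding r
    by auto
  have "t \<noteq> 0" using ne t psucc_eq[OF V P z(1)] i by (cases "t = 0") auto
  show False
  proof (cases "i \<le> t")
    case True
    have "z * \<zeta> ^ i = a * \<zeta> ^ (t - i) * \<zeta> ^ i" using t True
      by (simp add: mult.assoc flip: power_add)
    then have "z = a * \<zeta> ^ (t - i)" by simp
    moreover have "t - i \<le> k" using t(1) by simp
    ultimately show False using z(1,2) unfolding r by blast
  next
    case False
    have "z * \<zeta> ^ (i - t) * \<zeta> ^ t = a * \<zeta> ^ t" using t False
      by (simp add: mult.assoc flip: power_add)
    then have "z * \<zeta> ^ (i - t) = a" by simp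
    then show False using i(3)[rule_format, of "i - t"] False \<open>t \<noteq> 0\<close> aP by auto
  qed
qed

text \<open>The step from \<open>l\<close> leaves the end of the arc and cannot pass
  \<open>a\<close>, so if it ends in \<open>r\<close> then it ends at \<open>a\<close>. No point of
  \<open>P\<close> lies on the way, so the arc is all of \<open>P\<close>.\<close>

lemma b_in_r:
  assumes "b \<in> r" shows "b = a \<and> r = P"
proof -
  obtain t where t: "t \<le> k" "b = a * \<zeta> ^ t" using assms unfolding r by auto
  obtain j where j: "0 < j" "j \<le> N" "b = l * \<zeta> ^ j" "\<forall>i. 0 < i \<and> i < j \<longrightarrow> l * \<zeta> ^ i \<notin> P"
    using b_pos by auto
  have "a * \<zeta> ^ (k + j) = l * \<zeta> ^ j" by (simp add: l power_add mult.assoc)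
  also have "\<dots> = a * \<zeta> ^ t" using j t by simp
  finally have "a * \<zeta> ^ (k + j) = a * \<zeta> ^ t" .
  then have "(k + j) mod N = t mod N" using pos_eq[OF a0] by blast
  then have mod: "(k + j) mod N = t" using t k by simp
  have ge: "N \<le> k + j"
  proof (rule ccontr)
    assume "\<not> N \<le> k + j" then show False using mod t j by simp
  qed
  then have kj: "k + j = N + t" using mod j k by (simp add: mod_if split: if_splits)
  have t0: "t = 0"
  proof (rule ccontr)
    assume "t \<noteq> 0"
    have "l * \<zeta> ^ (N - k) = a" using k l by (simp add: mult.assoc flip: power_add)
    moreover have "0 < N - k" "N - k < j" using kj k \<open>t \<noteq> 0\<close> by auto
    ultimately show False using j(4) aP by metis
  qed
  have "z \<in> r" if z: "z \<in> P" for z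
  proof (rule ccontr)
    assume "z \<notin> r"
    then obtain i where i: "i < N" "z = a * \<zeta> ^ i" "k < i" using P_pos[OF z] by auto
    then have "l * \<zeta> ^ (i - k) = z" using l by (simp add: mult.assoc flip: power_add)
    then show False using j(4)[rule_format, of "i - k"] i kj t0 z by auto
  qed
  then show ?thesis using r_P t0 t by auto
qed

lemma satur_part:
  assumes p: "p \<in> V" "z \<in> p" "z \<in> satur r" shows "\<exists>\<omega>\<in>mu e. p = rot \<omega> P"
proof -
  obtain \<omega> where w: "\<omega> \<in> mu e" "z \<in> rot \<omega> r" using p satur_alt by auto
  then have "z \<in> rot \<omega> P" using rot_mono[OF r_P] by auto
  then show ?thesis using sym_nc_eq[OF V p(1) sym_nc_rot[OF V w(1) P] p(2)] w by blast
qed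

lemma satur_in_r:
  assumes "z \<in> P" "0 \<notin> convex hull P" "z \<in> satur r" shows "z \<in> r"
proof -
  obtain \<omega> y where w: "\<omega> \<in> mu e" "y \<in> r" "z = \<omega> * y" using assms(3) unfolding satur_def by auto
  then have "\<omega> = 1" using sym_nc_short[OF V P assms(2) w(1), of y] r_P assms(1) by auto
  then show ?thesis using w by simp
qed

lemma hull_r:
  assumes q: "q \<subseteq> Q" "Q \<in> V" "q \<inter> r = {}"
  shows "convex hull r \<inter> convex hull q = {}"
proof (cases "Q = P")
  case True
  show ?thesis
  proof (rule arc_hulls_disjoint[OF aN k])
    show "q \<subseteq> {a * \<zeta> ^ i | i. k < i \<and> i < N} \<union> {0}"
    proof
      fix z assume z: "z \<in> q"
      then have "z \<in> P" "z \<notin> r" using q True by auto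
      then show "z \<in> {a * \<zeta> ^ i | i. k < i \<and> i < N} \<union> {0}" using P_pos[of z] by auto
    qed
    show "2 * k + 1 < N" if "0 \<in> q" using that q sym_nc_sub[OF V] zero_notin_mu by blast
  qed (auto simp: r)
next
  case False
  then have "convex hull P \<inter> convex hull Q = {}" using sym_nc_hull[OF V P q(2)] by auto
  then show ?thesis using hull_mono[OF r_P, of convex] hull_mono[OF q(1), of convex] by blast
qed

definition f where "f = first_pt Z"

abbreviation asy where "asy \<equiv> Z \<noteq> {} \<and> 0 \<notin> convex hull Z"

lemma fp: assumes asy shows "f \<in> Z" "Z \<subseteq> {f * \<zeta> ^ i | i. i < n}" "f \<in> mu N" "f \<noteq> 0"
  "f / 2 \<notin> mu e" "2 / f \<notin> mu e"
  using first_props[OF c] assms mu_N_nz two_not_unit[of "first_pt Z"] unfolding f_def by auto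

lemma succ_map_N: "z \<in> mu N \<Longrightarrow> succ_map V Z z = (if asy then swap f 2 (psucc V z) else psucc V z)"
  unfolding succ_map_mu f_def by auto

text \<open>If the first point of \<open>Z\<close> were in the arc but not its start, its
  predecessor would be a point of the arc other than \<open>l\<close>. As \<open>succ_map\<close>
  sends this predecessor to \<open>2\<close>, this contradicts \<open>H2\<close>.\<close>

lemma f_in_r:
  assumes as: asy and PZ': "P = Z" and fr: "f \<in> r" shows "f = a"
proof (rule ccontr)
  assume fa: "f \<noteq> a"
  have "inj_on (nxt_in P) P" using nxt_in_inj[OF sym_nc_sub[OF V P]] by (auto simp: inj_on_def)
  then have "nxt_in P ` P = P" using endo_inj_surj[of P "nxt_in P"] sym_nc_finite(2)[OF V P]
    nxt_in_in by auto
  then obtain z where z: "z \<in> P" "nxt_in P z = f" using fp(1)[OF as] PZ' by (metis imageE)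
  then have sz: "psucc V z = f" using psucc_eq[OF V P] by simp
  have zr: "z \<in> r" using enter_arc[OF z(1)] sz fr fa by auto
  have "z \<noteq> l"
  proof
    assume "z = l"
    then have "b = f" using sz by (simp add: b_def)
    then show False using b_in_r fr fa by simp
  qed
  then have "succ_map V Z z \<in> r" using H2 zr by auto
  moreover have "succ_map V Z z = 2" using succ_map_N[of z] zr r_N sz as fp[OF as]
    by (auto simp: swap_left)
  ultimately show False using r_N two_notin_mu[OF mu_one] by auto
qed

text \<open>A long part contains \<open>zeta e * a\<close>, which is \<open>n\<close> steps after
  \<open>a\<close>, so a longer arc would violate \<open>H1\<close>. An asymmetric part lies in a
  window, so a longer arc would wrap around through the first point \<open>f\<close>; by
  \<open>f_in_r\<close> this is its start, which leaves nothing to wrap around.\<close>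

lemma short_arc:
  assumes PZ': "P = Z" shows "k < n"
proof (rule ccontr)
  assume "\<not> k < n"
  then have kn: "n \<le> k" by simp
  show False
  proof (cases "0 \<in> convex hull Z")
    case True
    have "zeta e * a \<in> rot (zeta e) P" using rot_mem[OF zeta_mu] aP by auto
    then have "a * \<zeta> ^ n \<in> P" using sym_nc_long_rot[OF V P _ zeta_mu] True PZ'
      by (simp add: zeta_e mult.commute)
    then have "zeta e * a \<in> r" using kn unfolding r zeta_e by (auto simp: mult.commute)
    then show False using H1[OF a_r zeta_mu] zeta_e_ne_1 by auto
  next
    case False
    then have as: asy using PZ' aP by auto
    obtain i where i: "i < n" "a = f * \<zeta> ^ i" using fp(2)[OF as] aP PZ' by auto
    obtain j where j: "j < n" "l = f * \<zeta> ^ j" using fp(2)[OF as] lP PZ' by auto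
    have "f * \<zeta> ^ (i + k) = f * \<zeta> ^ j" using i j l by (simp add: power_add mult.assoc)
    then have "(i + k) mod N = j mod N" using pos_eq[OF fp(4)[OF as]] by blast
    then have mod: "(i + k) mod N = j" using j n_less_N by simp
    have ge: "N \<le> i + k"
    proof (rule ccontr)
      assume "\<not> N \<le> i + k" then show False using mod kn j by simp
    qed
    then have ik: "i + k = N + j" using mod i k n_less_N by (simp add: mod_if split: if_splits)
    have "a * \<zeta> ^ (N - i) = f" using i n_less_N by (simp add: mult.assoc flip: power_add)
    moreover have "N - i \<le> k" using ik by simp
    ultimately have "f \<in> r" using fp(1)[OF as] PZ' unfolding r by (auto intro!: exI[of _ "N - i"])
    then have "f = a" using f_in_r as PZ' by simp
    then have "f * \<zeta> ^ 0 = f * \<zeta> ^ i" using i by simp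
    then have "i = 0" using pos_inj[OF fp(4)[OF as], of 0 i] i n_less_N by simp
    then show False using ik k by simp
  qed
qed

abbreviation "V' \<equiv> split_off V r"
abbreviation "Z' \<equiv> Z - satur r"

lemma hull_r_zero:
  assumes w: "\<omega> \<in> mu e"
  shows "convex hull (rot \<omega> r) \<inter> convex hull (insert 0 Z') = {}"
proof (cases "rot \<omega> P = Z")
  case False
  then have "convex hull (insert 0 Z) \<inter> convex hull (rot \<omega> P) = {}"
    using c sym_nc_rot[OF V w P] unfolding config_def by blast
  then show ?thesis using hull_mono[OF rot_mono[OF r_P], of convex \<omega>]
    hull_mono[of "insert 0 Z'" "insert 0 Z" convex] by blast
next
  case True
  then have PZ': "P = Z" using PZ w by auto
  have 1: "convex hull r \<inter> convex hull (insert 0 Z') = {}"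
  proof (rule arc_hulls_disjoint[OF aN k])
    show "insert 0 Z' \<subseteq> {a * \<zeta> ^ i | i. k < i \<and> i < N} \<union> {0}"
    proof
      fix z assume z: "z \<in> insert 0 Z'"
      show "z \<in> {a * \<zeta> ^ i | i. k < i \<and> i < N} \<union> {0}"
      proof (cases "z = 0")
        case False
        then have "z \<in> P" "z \<notin> r" using z PZ' satur_incl by auto
        then show ?thesis using P_pos[of z] by auto
      qed simp
    qed
    \<comment> \<open>By \<open>k < n\<close> the left side is at most \<open>2 * n - 1\<close>. The
      condition places \<open>0\<close> on the far side of the chord that cuts off
      \<open>r\<close>.\<close>
    show "2 * k + 1 < N" using short_arc[OF PZ'] N_ge by linarith
  qed (auto simp: r)
  have "rot \<omega> (insert 0 Z') = insert 0 Z'" unfolding rot_insert0 rot_diff_satur[OF w]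
    using True PZ' by simp
  then show ?thesis using hull_rot_disjoint[OF w, of r "insert 0 Z'"] 1 by simp
qed

lemma hull_r_rot:
  assumes w: "\<omega> \<in> mu e" and q: "q \<subseteq> Q" "Q \<in> V" "q \<inter> rot \<omega> r = {}"
  shows "convex hull (rot \<omega> r) \<inter> convex hull q = {}"
proof -
  have wi: "inverse \<omega> \<in> mu e" using mu_inverse[OF w] .
  have "rot (inverse \<omega>) q \<inter> r = {}"
  proof (rule ccontr)
    assume "\<not> ?thesis"
    then obtain z where "z \<in> r" "z \<in> rot (inverse \<omega>) q" by auto
    then have "\<omega> * z \<in> rot \<omega> r" "\<omega> * z \<in> q"
      using rot_mem[OF w, of z r] rot_iff[OF wi, of z q]
        by (simp_all add: divide_inverse mult.commute)
    then show False using q by auto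
  qed
  then have "convex hull r \<inter> convex hull (rot (inverse \<omega>) q) = {}"
    using hull_r[OF rot_mono[OF q(1)] sym_nc_rot[OF V wi q(2)]] by blast
  then show ?thesis using hull_rot_disjoint[OF w, of r "rot (inverse \<omega>) q"] rot_inverse[OF w]
    by simp
qed

lemma rot_r_disjoint:
  assumes "\<omega> \<in> mu e" "\<omega>' \<in> mu e" "\<omega> \<noteq> \<omega>'" shows "rot \<omega> r \<inter> rot \<omega>' r = {}"
proof (rule ccontr)
  assume "\<not> ?thesis"
  then obtain y y' where y: "y \<in> r" "y' \<in> r" "\<omega> * y = \<omega>' * y'" by (auto simp: rot_def)
  then have "y = \<omega>' / \<omega> * y'" using mu_e_nz[OF assms(1)] by (simp add: field_simps)
  then have "\<omega>' / \<omega> = 1" using H1[OF y(2) mu_divide[OF assms(2,1)]] y by auto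
  then show False using assms mu_e_nz by auto
qed

lemma rot_r_V': "\<omega> \<in> mu e \<Longrightarrow> rot \<omega> r \<in> V'" by (auto simp: split_off_def)

lemma sym_nc_V': "sym_nc V'"
proof -
  have cases: "(\<exists>p\<in>V. q = p - satur r \<and> q \<noteq> {}) \<or> (\<exists>\<omega>\<in>mu e. q = rot \<omega> r)" if "q \<in> V'" for q
    using that by (auto simp: split_off_def)
  have rn: "rot \<omega> r \<inter> (p - satur r) = {}" if "\<omega> \<in> mu e" for \<omega> p using that satur_alt by auto
  have h1: "convex hull (rot \<omega> r) \<inter> convex hull (p - satur r) = {}" if "\<omega> \<in> mu e" "p \<in> V" for \<omega> p
    using hull_r_rot[OF that(1) _ that(2)] rn[OF that(1)] by (metis Diff_subset Int_commute)
  have h2: "convex hull (rot \<omega> r) \<inter> convex hull (rot \<omega>' r) = {}"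
    if "\<omega> \<in> mu e" "\<omega>' \<in> mu e" "\<omega> \<noteq> \<omega>'" for \<omega> \<omega>'
    using hull_r_rot[OF that(1) rot_mono[OF r_P] sym_nc_rot[OF V that(2) P]]
      rot_r_disjoint[OF that] by (metis Int_commute)
  have h3: "convex hull (p - satur r) \<inter> convex hull (q - satur r) = {}" if "p \<in> V" "q \<in> V" "p \<noteq> q"
    for p q
    using sym_nc_hull[OF V that] hull_mono[of "p - satur r" p convex]
      hull_mono[of "q - satur r" q convex] by blast
  have hull: "p = q" if pq: "p \<in> V'" "q \<in> V'" and m: "convex hull p \<inter> convex hull q \<noteq> {}" for p q
  proof (rule ccontr)
    assume ne: "p \<noteq> q"
    show False
      using cases[OF pq(1)] cases[OF pq(2)]
    proof (elim disjE bexE conjE)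
      fix p' q' assume "p' \<in> V" "p = p' - satur r" "q' \<in> V" "q = q' - satur r"
      then show False using h3[of p' q'] ne m by auto
    next
      fix p' \<omega> assume "p' \<in> V" "p = p' - satur r" "\<omega> \<in> mu e" "q = rot \<omega> r"
      then show False using h1[of \<omega> p'] m by auto
    next
      fix p' \<omega> assume "p' \<in> V" "q = p' - satur r" "\<omega> \<in> mu e" "p = rot \<omega> r"
      then show False using h1[of \<omega> p'] m by auto
    next
      fix \<omega> \<omega>' assume "\<omega> \<in> mu e" "p = rot \<omega> r" "\<omega>' \<in> mu e" "q = rot \<omega>' r"
      then show False using h2[of \<omega> \<omega>'] ne m by auto
    qed
  qed
  have sub: "p \<subseteq> mu N" if "p \<in> V'" for p
    using cases[OF that] sym_nc_sub[OF V] sym_nc_rot[OF V _ P] rot_mono[OF r_P] by blast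
  have cover: "z \<in> \<Union> V'" if z: "z \<in> mu N" for z
  proof (cases "z \<in> satur r")
    case True
    then show ?thesis using rot_r_V' satur_alt by auto
  next
    case False
    obtain p where "p \<in> V" "z \<in> p" using sym_nc_ex[OF V z] by auto
    then have "p - satur r \<in> V'" "z \<in> p - satur r" using False by (auto simp: split_off_def)
    then show ?thesis by blast
  qed
  have "partition_on (mu N) V'"
  proof (rule partition_onI)
    show "\<Union> V' = mu N" using sub cover by auto
    show "disjnt p q" if "p \<in> V'" "q \<in> V'" "p \<noteq> q" for p q
      using hull[OF that(1,2)] that(3) hull_subset[of p convex] hull_subset[of q convex]
        unfolding disjnt_iff by blast
    show "{} \<notin> V'" using a_r by (auto simp: split_off_def eq_commute[of "{}"])
  qed
  moreover have "rot \<omega> p \<in> V'" if w: "\<omega> \<in> mu e" and p: "p \<in> V'" for \<omega> p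
    using cases[OF p]
  proof (elim disjE bexE conjE)
    fix q assume q: "q \<in> V" "p = q - satur r" "p \<noteq> {}"
    then have "rot \<omega> p = rot \<omega> q - satur r" using rot_diff_satur[OF w] by simp
    moreover have "rot \<omega> p \<noteq> {}" using q(3) rot_empty by blast
    ultimately have "rot \<omega> p = rot \<omega> q - satur r" "rot \<omega> p \<noteq> {}" by auto
    then show ?thesis using sym_nc_rot[OF V w q(1)] by (auto simp: split_off_def)
  next
    fix \<omega>' assume "\<omega>' \<in> mu e" "p = rot \<omega>' r"
    then show ?thesis using mu_mult[OF w] rot_r_V' by (simp add: rot_rot)
  qed
  ultimately show ?thesis unfolding sym_nc_def using hull by blast
qed

lemma config_V': "config V' Z'"
  unfolding config_def
proof (intro conjI ballI impI)
  show "Z' = {} \<or> Z' \<in> V'" using ZV by (auto simp: split_off_def)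
  fix p assume p: "p \<in> V'" "p \<noteq> Z'"
  then consider q where "q \<in> V" "p = q - satur r" | \<omega> where "\<omega> \<in> mu e" "p = rot \<omega> r"
    by (auto simp: split_off_def)
  then show "convex hull (insert 0 Z') \<inter> convex hull p = {}"
  proof cases
    case 1
    then have "q \<noteq> Z" using p by auto
    then have "convex hull (insert 0 Z) \<inter> convex hull q = {}" using c 1 unfolding config_def
      by blast
    moreover have "convex hull (insert 0 Z') \<subseteq> convex hull (insert 0 Z)" by (intro hull_mono) auto
    moreover have "convex hull p \<subseteq> convex hull q" using 1 by (intro hull_mono) auto
    ultimately show ?thesis by blast
  next
    case 2
    then show ?thesis using hull_r_zero by (auto simp: Int_commute)
  qed
qed (rule sym_nc_V')

lemma r_short: "\<omega> \<in> mu e \<Longrightarrow> 0 \<notin> convex hull (rot \<omega> r)"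
  using hull_r_zero[of \<omega>] hull_inc[of 0 "insert 0 Z'" convex] by blast


text \<open>By \<open>H3\<close> the exchange with the radius 2 point must have moved
  \<open>b\<close>, so \<open>b\<close> is in the orbit of the first point of an asymmetric
  \<open>Z\<close>. With \<open>b_in_r\<close> only one case remains: \<open>r\<close> is all of
  \<open>Z\<close>, and the move detaches \<open>0\<close> from it.\<close>

lemma special_case:
  assumes bs: "b \<in> satur r"
  shows "P = Z" "r = P" "asy" "b = a" "f = a"
proof -
  have "succ_map V Z l \<noteq> b" using H3 bs by auto
  then have as: asy and pb: "swap f 2 b \<noteq> b" using succ_map_N[OF lN]
    by (auto simp: b_def split: if_splits)
  then have bf: "b / f \<in> mu e" using two_not_unit(1)[OF bN]
    by (auto simp: swap_def split: if_splits)
  define \<omega> where "\<omega> = b / f"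
  have bw: "b = \<omega> * f" "\<omega> \<in> mu e" using fp[OF as] bf by (auto simp: \<omega>_def)
  have Zv: "Z \<in> V" using as ZV by auto
  have "b \<in> rot \<omega> Z" using bw rot_mem fp(1)[OF as] by auto
  then have RP: "rot \<omega> Z = P" using sym_nc_eq[OF V sym_nc_rot[OF V bw(2) Zv] P _ bP] by auto
  then have "rot (inverse \<omega>) P = Z" using rot_inverse[OF bw(2)] by auto
  then show PZ': "P = Z" using PZ mu_inverse[OF bw(2)] by blast
  then have "\<omega> = 1" using sym_nc_short[OF V Zv _ bw(2) fp(1)[OF as]] as bP bw by auto
  then have fb: "b = f" using bw by simp
  have "b \<in> r" using satur_in_r[OF bP _ bs] as PZ' by auto
  then show "r = P" "b = a" using b_in_r by auto
  then show "f = a" using fb by simp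
  show asy by (rule as)
qed

lemma special_split:
  assumes bs: "b \<in> satur r"
  shows "V' = V" "Z' = {}"
proof -
  note sp = special_case[OF bs]
  have sP: "P = r" using sp by simp
  show "Z' = {}" using sp satur_incl[of P] by auto
  have 1: "p - satur r = p \<or> (p - satur r = {} \<and> (\<exists>\<omega>\<in>mu e. p = rot \<omega> r))" if p: "p \<in> V" for p
  proof (cases "p \<inter> satur r = {}")
    case False
    then obtain \<omega> where "\<omega> \<in> mu e" "p = rot \<omega> P" using satur_part[OF p] by auto
    then show ?thesis using sP satur_alt by auto
  qed auto
  have ne: "p \<noteq> {}" if "p \<in> V" for p using sym_nc_ne[OF V that] .
  have rV: "rot \<omega> r \<in> V" if "\<omega> \<in> mu e" for \<omega> using sym_nc_rot[OF V that P] sP by simp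
  show "V' = V"
  proof (intro equalityI subsetI)
    fix p assume "p \<in> V'"
    then consider q where "q \<in> V" "p = q - satur r" "p \<noteq> {}" | \<omega> where "\<omega> \<in> mu e" "p = rot \<omega> r"
      by (auto simp: split_off_def)
    then show "p \<in> V" using 1 rV by cases metis+
  next
    fix p assume p: "p \<in> V"
    then show "p \<in> V'" using 1[OF p] ne[OF p] rot_r_V' by (auto simp: split_off_def)
  qed
qed

lemma part_minus_ne:
  assumes nb: "b \<notin> satur r" and p: "p \<in> V" shows "p - satur r \<noteq> {}"
proof (cases "p \<inter> satur r = {}")
  case True
  then show ?thesis using sym_nc_ne[OF V p] by auto
next
  case False
  then obtain \<omega> where w: "\<omega> \<in> mu e" "p = rot \<omega> P" using satur_part[OF p] by auto
  then have "\<omega> * b \<in> p - satur r" using rot_mem[OF w(1)] satur_rot[OF w(1)] bP nb by auto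
  then show ?thesis by auto
qed

lemma a_b_ineq: assumes nb: "b \<notin> satur r" shows "b / a \<notin> mu e" "a / b \<notin> mu e"
proof -
  show "b / a \<notin> mu e"
  proof
    assume "b / a \<in> mu e"
    moreover have "b = b / a * a" using a0 by simp
    ultimately show False using nb a_r unfolding satur_def by blast
  qed
  then show "a / b \<notin> mu e" using unit_div_sym by blast
qed

lemma satur_cases: "z \<in> satur r \<Longrightarrow> \<exists>\<omega>\<in>mu e. \<exists>y\<in>r. z = \<omega> * y" by (auto simp: satur_def)

text \<open>Up to rotation two successors change. The point \<open>l\<close>, which led to
  \<open>b\<close>, now closes the arc at \<open>a\<close>; the point that led to \<open>a\<close>
  now jumps over the arc to \<open>b\<close>.\<close>

lemma psucc_split:
  assumes nb: "b \<notin> satur r" and z: "z \<in> mu N"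
  shows "psucc V' z = swap a b (psucc V z)"
proof -
  note V'_sym_nc = sym_nc_V'
  obtain j where j: "0 < j" "j \<le> N" "b = l * \<zeta> ^ j" "\<forall>i. 0 < i \<and> i < j \<longrightarrow> l * \<zeta> ^ i \<notin> P"
    using b_pos by auto
  have not_b: "y / b \<notin> mu e" if "y \<in> satur r" for y
  proof
    assume *: "y / b \<in> mu e"
    have "y = y / b * b" using b0 by simp
    then show False using satur_rot[OF *, of b] that nb by metis
  qed
  show ?thesis
  proof (cases "z \<in> satur r")
    case True
    then obtain \<omega> y where w: "\<omega> \<in> mu e" "y \<in> r" "z = \<omega> * y" using satur_cases by blast
    have yP: "y \<in> P" and yN: "y \<in> mu N" using w r_P r_N by auto
    have rV: "r \<in> V'" using rot_r_V'[OF mu_one] by simp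
    have "psucc V' y = swap a b (psucc V y)"
    proof (cases "y = l")
      case True
      have "nxt_in r l = l * \<zeta> ^ (N - k)"
      proof (rule nxt_in_eqI)
        show "0 < N - k" using k by simp
        show "l * \<zeta> ^ (N - k) \<in> r" using k l a_r by (simp add: mult.assoc flip: power_add)
        fix i assume i: "0 < i" "i < N - k"
        show "l * \<zeta> ^ i \<notin> r"
        proof
          assume "l * \<zeta> ^ i \<in> r"
          then obtain t where t: "t \<le> k" "l * \<zeta> ^ i = a * \<zeta> ^ t" unfolding r by auto
          then have "a * \<zeta> ^ (k + i) = a * \<zeta> ^ t" by (simp add: l power_add mult.assoc)
          moreover have "k + i < N" using i by linarith
          ultimately have "k + i = t" using pos_inj[OF a0, of "k + i" t] t k by simp
          then show False using t i by simp
        qed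
      qed
      also have "\<dots> = a" using k l by (simp add: mult.assoc flip: power_add)
      finally have "psucc V' l = a" using psucc_eq[OF V'_sym_nc rV l_r] by simp
      moreover have "swap a b b = a" using swap_right[OF a0 b0 a_b_ineq(1)[OF nb]] .
      ultimately show ?thesis using True by (simp add: b_def)
    next
      case False
      have s: "psucc V y \<in> r" "psucc V y \<noteq> a" using inner_succ[OF w(2) False] by auto
      obtain i where i: "0 < i" "nxt_in P y = y * \<zeta> ^ i" "\<forall>j. 0 < j \<and> j < i \<longrightarrow> y * \<zeta> ^ j \<notin> P"
        using nxt_in_ex[OF yP] by auto
      have "nxt_in r y = y * \<zeta> ^ i"
        by (rule nxt_in_eqI) (use i s r_P psucc_eq[OF V P yP] in auto)
      then have e: "psucc V' y = psucc V y" using psucc_eq[OF V'_sym_nc rV w(2)]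
        psucc_eq[OF V P yP] i by simp
      have "psucc V y / a \<notin> mu e"
      proof
        assume *: "psucc V y / a \<in> mu e"
        have "psucc V y = psucc V y / a * a" using a0 by simp
        then have "psucc V y / a = 1" using H1[OF a_r *] s by metis
        then show False using s a0 by simp
      qed
      moreover have "psucc V y / b \<notin> mu e" using not_b s satur_incl by blast
      ultimately show ?thesis using e swap_id by simp
    qed
    then show ?thesis using psucc_rot[OF V'_sym_nc w(1) yN] psucc_rot[OF V w(1) yN]
      swap_rot[OF w(1)] w by simp
  next
    case False
    obtain p where p: "p \<in> V" "z \<in> p" using sym_nc_ex[OF V z] by auto
    have pV': "p - satur r \<in> V'" "z \<in> p - satur r" using p False by (auto simp: split_off_def)
    have e: "psucc V' z = nxt_in (p - satur r) z" using psucc_eq[OF V'_sym_nc pV'] .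
    show ?thesis
    proof (cases "psucc V z \<in> satur r")
      case False
      obtain i where i: "0 < i" "nxt_in p z = z * \<zeta> ^ i" "z * \<zeta> ^ i \<in> p" "\<forall>j. 0 < j \<and>
        j < i \<longrightarrow> z * \<zeta> ^ j \<notin> p"
        using nxt_in_ex[OF p(2)] by auto
      have "nxt_in (p - satur r) z = z * \<zeta> ^ i"
        by (rule nxt_in_eqI) (use i False psucc_eq[OF V p] in auto)
      then have e': "psucc V' z = psucc V z" using e i psucc_eq[OF V p] by simp
      have "psucc V z / a \<notin> mu e"
      proof
        assume *: "psucc V z / a \<in> mu e"
        have "psucc V z = psucc V z / a * a" using a0 by simp
        then show False using False a_r * unfolding satur_def by blast
      qed
      moreover have "psucc V z / b \<notin> mu e"
      proof
        assume *: "psucc V z / b \<in> mu e"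
        have "psucc V z = psucc V z / b * psucc V l" using b0 by (simp add: b_def)
        also have "\<dots> = psucc V (psucc V z / b * l)" using psucc_rot[OF V * lN] by simp
        finally have "z = psucc V z / b * l" using psucc_inj[OF V z] mu_N_rot[OF * lN] by blast
        then show False using \<open>z \<notin> satur r\<close> l_r * unfolding satur_def by blast
      qed
      ultimately show ?thesis using e' swap_id by simp
    next
      case True
      then obtain \<omega> y where w: "\<omega> \<in> mu e" "y \<in> r" "psucc V z = \<omega> * y" using satur_cases by blast
      \<comment> \<open>Rotated so that the step ends in \<open>r\<close> itself; by
        \<open>enter_arc\<close> it then ends at \<open>a\<close>.\<close>
      define z0 where "z0 = inverse \<omega> * z"
      have wi: "inverse \<omega> \<in> mu e" using mu_inverse[OF w(1)] .
      have w0: "\<omega> \<noteq> 0" using mu_e_nz w by auto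
      have zz: "z = \<omega> * z0" using w0 by (simp add: z0_def)
      have z0N: "z0 \<in> mu N" using mu_N_rot[OF wi z] by (simp add: z0_def)
      have sz0: "psucc V z0 = y" using psucc_rot[OF V w(1) z0N] w zz w0 by simp
      have z0s: "z0 \<notin> satur r" using satur_rot[OF w(1)] False zz by auto
      obtain p0 where p0: "p0 \<in> V" "z0 \<in> p0" using sym_nc_ex[OF V z0N] by auto
      have "y \<in> p0" using psucc_in[OF V p0] sz0 by simp
      then have "p0 = P" using sym_nc_eq[OF V p0(1) P, of y] w r_P by auto
      then have z0P: "z0 \<in> P" using p0 by simp
      have ya: "y = a" using enter_arc[OF z0P] sz0 w z0s satur_incl by blast
      obtain i where i: "0 < i" "nxt_in P z0 = z0 * \<zeta> ^ i" "z0 * \<zeta> ^ i \<in> P" "\<forall>j. 0 < j \<and>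
        j < i \<longrightarrow> z0 * \<zeta> ^ j \<notin> P"
        using nxt_in_ex[OF z0P] by auto
      have zi: "z0 * \<zeta> ^ i = a" using sz0 ya psucc_eq[OF V P z0P] i by simp
      have step: "z0 * \<zeta> ^ (i + t) = a * \<zeta> ^ t" for t using zi
        by (simp add: power_add flip: mult.assoc)
      \<comment> \<open>The new step consists of the old step to \<open>a\<close>, \<open>k\<close>
        positions along the arc, and the \<open>j\<close> positions from \<open>l\<close> to
        \<open>b\<close>.\<close>
      have "nxt_in (P - satur r) z0 = z0 * \<zeta> ^ (i + (k + j))"
      proof (rule nxt_in_eqI)
        show "0 < i + (k + j)" using i by simp
        have eb: "z0 * \<zeta> ^ (i + (k + j)) = b" unfolding step using j
          by (simp add: l power_add mult.assoc)
        then show "z0 * \<zeta> ^ (i + (k + j)) \<in> P - satur r" using bP nb by simp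
        fix t assume t: "0 < t" "t < i + (k + j)"
        show "z0 * \<zeta> ^ t \<notin> P - satur r"
        proof (cases "t < i")
          case False
          define s where "s = t - i"
          have ts: "t = i + s" "s < k + j" using False t by (auto simp: s_def)
          show ?thesis
          proof (cases "s \<le> k")
            case True
            then show ?thesis unfolding ts step using satur_incl[of r] unfolding r by blast
          next
            case False
            have "a * \<zeta> ^ s = l * \<zeta> ^ (s - k)" using False
              by (simp add: l mult.assoc flip: power_add)
            moreover have "l * \<zeta> ^ (s - k) \<notin> P" using j(4) False ts by simp
            ultimately show ?thesis unfolding ts step by simp
          qed
        qed (use i t in auto)
      qed
      also have "\<dots> = b" unfolding step using j by (simp add: l power_add mult.assoc)
      finally have cb: "nxt_in (P - satur r) z0 = b" .
      have "P - satur r \<in> V'" "z0 \<in> P - satur r" using P z0P z0s by (auto simp: split_off_def)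
      then have "psucc V' z0 = b" using psucc_eq[OF V'_sym_nc] cb by simp
      then have "psucc V' z = \<omega> * b" using psucc_rot[OF V'_sym_nc w(1) z0N] zz by simp
      moreover have "swap a b (psucc V z) = \<omega> * b"
        using swap_rot[OF w(1)] w(3) ya swap_left[OF a0] by simp
      ultimately show ?thesis by simp
    qed
  qed
qed

lemma Z'_disjoint: "P \<noteq> Z \<Longrightarrow> Z' = Z"
proof (rule ccontr)
  assume "P \<noteq> Z" "Z' \<noteq> Z"
  then obtain z where z: "z \<in> Z" "z \<in> satur r" by auto
  then have "Z \<in> V" using ZV by auto
  then obtain \<omega> where "\<omega> \<in> mu e" "Z = rot \<omega> P" using satur_part z by blast
  then show False using PZ \<open>P \<noteq> Z\<close> by auto
qed

lemma Z'_ne: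
  assumes nb: "b \<notin> satur r" and "Z \<noteq> {}" shows "Z' \<noteq> {}"
  using part_minus_ne[OF nb, of Z] assms ZV by auto

text \<open>What is left of a long part is nonempty and still invariant under \<open>zeta e\<close>,
  so \<open>zero_hull\<close> applies to it.\<close>

lemma long_Z':
  assumes nb: "b \<notin> satur r" shows "0 \<in> convex hull Z' \<longleftrightarrow> 0 \<in> convex hull Z"
proof
  assume "0 \<in> convex hull Z'"
  then show "0 \<in> convex hull Z" using hull_mono[of Z' Z convex] by auto
next
  assume h: "0 \<in> convex hull Z"
  then have Zv: "Z \<in> V" using ZV by auto
  then obtain z where z: "z \<in> Z'" using part_minus_ne[OF nb] by blast
  have "rot (zeta e) Z' = Z'" using rot_diff_satur[OF zeta_mu] sym_nc_long_rot[OF V Zv h zeta_mu]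
    by simp
  then show "0 \<in> convex hull Z'" using zero_hull[OF zeta_mu zeta_e_ne_1 z] by simp
qed

text \<open>In the asymmetric case the exchange with the radius 2 point is applied last in both
  maps, and \<open>swap_conj\<close> interchanges it with that of \<open>a\<close> and
  \<open>b\<close>. If the first point is split off then it is \<open>a\<close>, and
  \<open>b\<close> becomes the first point of the remainder.\<close>

lemma succ_map_split:
  assumes z: "z \<in> Omega"
  shows "succ_map V' Z' z = swap a (succ_map V Z l) (succ_map V Z z)"
proof (cases "b \<in> satur r")
  case True
  note sp = special_case[OF True] and sp' = special_split[OF True]
  have f0: "f \<noteq> 0" using fp(4) sp by blast
  have pl: "succ_map V Z l = 2" using succ_map_N[OF lN] sp swap_left[OF f0] by (auto simp: b_def)
  have 1: "succ_map V {} z = (if z \<in> mu N then psucc V z else z)"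
    by (simp add: succ_map_def convex_hull_empty)
  have 2: "succ_map V Z z = swap f 2 (if z \<in> mu N then psucc V z else z)" using sp
    by (auto simp: succ_map_def f_def)
  have "swap f 2 (swap f 2 y) = y" for y using swap_invol[of f 2] f0 fp(6) sp by auto
  then show ?thesis unfolding sp' pl using 1 2 sp(5) by simp
next
  case nb: False
  note V'_sym_nc = sym_nc_V'
  define y where "y = (if z \<in> mu N then psucc V z else if 0 \<in> convex hull Z then inverse (zeta e)
    * z else z)"
  have inn: "swap a b w = w" if "w / 2 \<in> mu e" for w
  proof (rule swap_id)
    have *: "w / c \<notin> mu e" if c: "c \<in> mu N" for c
    proof
      assume "w / c \<in> mu e"
      then have "c / w \<in> mu e" using unit_div_sym by blast
      then have "c / w * (w / 2) \<in> mu e" using \<open>w / 2 \<in> mu e\<close> mu_mult by blast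
      moreover have "w \<noteq> 0" using mu_e_nz[OF \<open>w / 2 \<in> mu e\<close>] by simp
      ultimately show False using two_not_unit(1)[OF c] by simp
    qed
    show "w / a \<notin> mu e" "w / b \<notin> mu e" using * aN bN by auto
  qed
  have y': "(if z \<in> mu N then psucc V' z else if 0 \<in> convex hull Z' then inverse (zeta e) * z else
    z) = swap a b y"
  proof (cases "z \<in> mu N")
    case True
    then show ?thesis using psucc_split[OF nb True] by (simp add: y_def)
  next
    case False
    then have z2: "z / 2 \<in> mu e" using z by (auto simp: Omega_def)
    then have "inverse (zeta e) * z / 2 \<in> mu e" using mu_mult[OF mu_inverse[OF zeta_mu] z2] by simp
    then show ?thesis using False inn z2 unfolding long_Z'[OF nb] y_def by auto
  qed
  show ?thesis
  proof (cases asy)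
    case False
    then have "\<not> (Z' \<noteq> {} \<and> 0 \<notin> convex hull Z')" using long_Z'[OF nb] by auto
    then have "succ_map V' Z' z = swap a b y" by (simp only: succ_map_def Let_def y' if_False)
    moreover have "succ_map V Z z = y" using False by (auto simp: succ_map_def y_def)
    moreover have "succ_map V Z l = b" using succ_map_N[OF lN] False by (auto simp: b_def)
    ultimately show ?thesis by simp
  next
    case as: True
    have "Z' \<noteq> {} \<and> 0 \<notin> convex hull Z'" using as Z'_ne[OF nb] long_Z'[OF nb] by auto
    then have e': "succ_map V' Z' z = swap (first_pt Z') 2 (swap a b y)" using y'
      by (simp add: succ_map_def)
    have e: "succ_map V Z z = swap f 2 y" using as by (simp add: succ_map_def y_def f_def)
    have el: "succ_map V Z l = swap f 2 b" using succ_map_N[OF lN] as by (simp add: b_def)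
    note fs = fp[OF as]
    have a2: "2 / a \<notin> mu e" "a / 2 \<notin> mu e" "2 / b \<notin> mu e" using two_not_unit aN bN by auto
    show ?thesis
    proof (cases "f \<in> satur r")
      case False
      have "f \<in> Z'" using fs False by auto
      then have "first_pt Z' = f" using fs by (intro first_eq) auto
      moreover have "a / f \<notin> mu e"
      proof
        assume "a / f \<in> mu e"
        then have "f / a \<in> mu e" using unit_div_sym by blast
        moreover have "f = f / a * a" using a0 by simp
        ultimately show False using False a_r unfolding satur_def by blast
      qed
      then have "swap f 2 a = a" using a2 swap_id by simp
      ultimately show ?thesis using swap_conj[OF fs(4) _ fs(6) a0 b0, of y] e' e el by simp
    next
      case True
      have PZ': "P = Z" using Z'_disjoint fs(1) True by auto
      have "f \<in> r" using satur_in_r[OF _ _ True] fs(1) as PZ' by auto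
      then have fa: "f = a" using f_in_r[OF as PZ'] by simp
      have "first_pt Z' = b"
      proof (rule first_eq[OF _ _ bN])
        show "b \<in> Z'" using bP PZ' nb by auto
        obtain j where j: "0 < j" "j \<le> N" "b = l * \<zeta> ^ j" "\<forall>i. 0 < i \<and> i < j \<longrightarrow> l * \<zeta> ^ i \<notin> P"
          using b_pos by auto
        show "Z' \<subseteq> {b * \<zeta> ^ i | i. i < n}"
        proof
          fix w assume w: "w \<in> Z'"
          then have wP: "w \<in> P" "w \<notin> r" using PZ' satur_incl by auto
          obtain i where i: "i < n" "w = a * \<zeta> ^ i" using fs(2) w fa by auto
          have ik: "k < i" using wP i unfolding r by (auto simp: not_le[symmetric])
          have wl: "w = l * \<zeta> ^ (i - k)" using i ik l by (simp add: mult.assoc flip: power_add)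
          then have "\<not> i - k < j" using j(4) wP ik by auto
          then have "w = b * \<zeta> ^ (i - k - j)" using wl j by (simp add: mult.assoc flip: power_add)
          then show "w \<in> {b * \<zeta> ^ i | i. i < n}" using i by (auto intro!: exI[of _ "i - k - j"])
        qed
      qed
      moreover have "swap a 2 b = b" using a_b_ineq[OF nb] bN two_not_unit swap_id by simp
      moreover have "swap a b 2 = 2" using a2 swap_id by simp
      ultimately show ?thesis
        using swap_conj[OF a0 b0 a_b_ineq(1)[OF nb] a0, of 2 y] e' e el fa swap_left[OF a0, of b]
          by simp
    qed
  qed
qed

text \<open>In general the remainders of the short parts stay nonempty and distinct, and the
  \<open>e\<close> rotations of \<open>r\<close> are added. In the special case the partition is
  unchanged, and the gain of \<open>e\<close> comes from \<open>Z\<close> becoming empty.\<close>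

lemma rank_split: "rank V Z + e \<le> rank V' Z'"
proof (cases "b \<in> satur r")
  case True
  then show ?thesis using special_split[OF True] special_case[OF True] by (simp add: rank_def)
next
  case nb: False
  let ?A = "{p \<in> V. 0 \<notin> convex hull p}"
  let ?B = "{p \<in> V'. 0 \<notin> convex hull p}"
  let ?A1 = "(\<lambda>p. p - satur r) ` ?A" and ?A2 = "(\<lambda>\<omega>. rot \<omega> r) ` mu e"
  have "inj_on (\<lambda>p. p - satur r) ?A"
  proof (rule inj_onI)
    fix p q assume pq: "p \<in> ?A" "q \<in> ?A" "p - satur r = q - satur r"
    obtain z where "z \<in> p - satur r" using part_minus_ne[OF nb] pq by blast
    then show "p = q" using sym_nc_eq[OF V] pq by blast
  qed
  then have c1: "card ?A1 = card ?A" by (rule card_image)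
  have "inj_on (\<lambda>\<omega>. rot \<omega> r) (mu e)"
    using rot_r_disjoint a_r unfolding inj_on_def by (metis Int_absorb empty_iff rot_empty)
  then have "card ?A2 = card (mu e)" by (rule card_image)
  then have c2: "card ?A2 = e" using mu_card[of e] by simp
  have fin: "finite ?A" "finite ?B" using sym_nc_finite(1)[OF V] sym_nc_finite(1)[OF sym_nc_V']
    by auto
  have "?A1 \<inter> ?A2 = {}"
  proof (rule ccontr)
    assume "?A1 \<inter> ?A2 \<noteq> {}"
    then obtain p \<omega> where w: "\<omega> \<in> mu e" "p - satur r = rot \<omega> r" by auto
    then have "\<omega> * a \<in> p - satur r" using rot_mem a_r by simp
    then show False using satur_rot[OF w(1)] a_r satur_incl by auto
  qed
  then have cU: "card (?A1 \<union> ?A2) = card ?A + e" using c1 c2 fin mu_finite[of e]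
    by (subst card_Un_disjoint) auto
  have "?A1 \<union> ?A2 \<subseteq> ?B"
  proof -
    have "p - satur r \<in> ?B" if "p \<in> ?A" for p
      using that part_minus_ne[OF nb, of p] hull_mono[of "p - satur r" p convex]
        by (auto simp: split_off_def)
    moreover have "rot \<omega> r \<in> ?B" if "\<omega> \<in> mu e" for \<omega> using r_short[OF that] rot_r_V'[OF that]
      by auto
    ultimately show ?thesis by blast
  qed
  then have "card ?A + e \<le> card ?B" unfolding cU[symmetric] by (rule card_mono[OF fin(2)])
  then show ?thesis using Z'_ne[OF nb] by (auto simp: rank_def)
qed

lemma ineq: "succ_map V Z l / a \<notin> mu e"
proof
  assume *: "succ_map V Z l / a \<in> mu e"
  have "succ_map V Z l = succ_map V Z l / a * a" using a0 by simp
  then show False using H3 a_r * unfolding satur_def by blast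
qed

end

context refl_group
begin

lemma succ_map_rot:
  assumes c: "config V Z" and w: "\<omega> \<in> mu e" and z: "z \<in> Omega"
  shows "succ_map V Z (\<omega> * z) = \<omega> * succ_map V Z z"
proof -
  have V: "sym_nc V" using c by (auto simp: config_def)
  have iff: "\<omega> * z \<in> mu N \<longleftrightarrow> z \<in> mu N"
    using mu_N_rot[OF w, of z] mu_N_rot[OF mu_inverse[OF w], of "\<omega> * z"] mu_e_nz[OF w]
      by (auto simp flip: mult.assoc)
  have "inverse (zeta e) * (\<omega> * z) = \<omega> * (inverse (zeta e) * z)" by simp
  then show ?thesis unfolding succ_map_def Let_def iff using psucc_rot[OF V w] swap_rot[OF w]
    by auto
qed

lemma Omega_cases: "z \<in> Omega \<Longrightarrow> (z \<in> mu N \<and> z / 2 \<notin> mu e) \<or> (z \<notin> mu N \<and> z / 2 \<in> mu e)"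
  unfolding Omega_def using two_not_unit(1) by auto

lemma mu_N_Omega: "z \<in> mu N \<Longrightarrow> z \<in> Omega" by (simp add: Omega_def)

lemma two_Omega: "\<omega> \<in> mu e \<Longrightarrow> 2 * \<omega> \<in> Omega" by (simp add: Omega_def)

lemma swap_Omega: assumes "x \<in> Omega" "y \<in> Omega" "z \<in> Omega" shows "swap x y z \<in> Omega"
  using Omega_rot[of "z / x" y] Omega_rot[of "z / y" x] assms by (auto simp: swap_def)

lemma swap_sym: "x \<noteq> 0 \<Longrightarrow> y \<noteq> 0 \<Longrightarrow> y / x \<notin> mu e \<Longrightarrow> swap x y z = swap y x z"
proof -
  assume a: "x \<noteq> 0" "y \<noteq> 0" "y / x \<notin> mu e"
  have "\<not> (z / x \<in> mu e \<and> z / y \<in> mu e)"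
  proof
    assume b: "z / x \<in> mu e \<and> z / y \<in> mu e"
    then have "z \<noteq> 0" using mu_e_nz[of "z / x"] by auto
    then have "(z / x) / (z / y) = y / x" using a by simp
    then show False using a(3) b mu_divide by metis
  qed
  then show ?thesis by (auto simp: swap_def)
qed

lemma succ_map_Omega:
  assumes c: "config V Z" and z: "z \<in> Omega" shows "succ_map V Z z \<in> Omega"
proof -
  have V: "sym_nc V" using c by (auto simp: config_def)
  have "(if z \<in> mu N then psucc V z else if 0 \<in> convex hull Z then inverse (zeta e) * z else z) \<in>
    Omega"
    using z psucc_mu[OF V] mu_N_Omega Omega_rot[OF mu_inverse[OF zeta_mu] z] by auto
  moreover have "first_pt Z \<in> Omega" if "Z \<noteq> {} \<and> 0 \<notin> convex hull Z"
    using first_props(3)[OF c] that mu_N_Omega by auto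
  ultimately show ?thesis unfolding succ_map_def Let_def using swap_Omega two_Omega[OF mu_one]
    by auto
qed

lemma succ_map_mu_N:
  assumes c: "config V Z" and na: "\<not> (Z \<noteq> {} \<and> 0 \<notin> convex hull Z)" and z: "z \<in> Omega"
  shows "succ_map V Z z \<in> mu N \<longleftrightarrow> z \<in> mu N"
proof -
  have V: "sym_nc V" using c by (auto simp: config_def)
  have e: "succ_map V Z z = (if z \<in> mu N then psucc V z else if 0 \<in> convex hull Z then inverse
    (zeta e) * z else z)"
    by (simp only: succ_map_def Let_def na if_False)
  show ?thesis
  proof (cases "z \<in> mu N")
    case False
    then have "z / 2 \<in> mu e" using Omega_cases[OF z] by auto
    then have "inverse (zeta e) * (z / 2) \<in> mu e" using mu_mult[OF mu_inverse[OF zeta_mu]] by blast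
    then have "2 * (inverse (zeta e) * (z / 2)) \<notin> mu N" by (rule two_notin_mu)
    then show ?thesis unfolding e using False by auto
  qed (use e psucc_mu[OF V] in auto)
qed

lemma succ_map_inj:
  assumes c: "config V Z" and z: "z \<in> Omega" and w: "w \<in> Omega"
    and eq: "succ_map V Z z = succ_map V Z w"
  shows "z = w"
proof -
  have V: "sym_nc V" using c by (auto simp: config_def)
  define g where "g z = (if z \<in> mu N then psucc V z else if 0 \<in> convex hull Z then inverse (zeta
    e) * z else z)" for z
  have g2: "g z \<in> mu N \<longleftrightarrow> z \<in> mu N" if "z \<in> Omega" for z
  proof (cases "z \<in> mu N")
    case False
    then have "z / 2 \<in> mu e" using Omega_cases[OF that] by auto
    then have "inverse (zeta e) * (z / 2) \<in> mu e" using mu_mult[OF mu_inverse[OF zeta_mu]] by blast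
    then have "2 * (inverse (zeta e) * (z / 2)) \<notin> mu N" by (rule two_notin_mu)
    then show ?thesis unfolding g_def using False by auto
  qed (use psucc_mu[OF V] in \<open>auto simp: g_def\<close>)
  have gi: "z = w" if "g z = g w"
  proof (cases "z \<in> mu N")
    case True
    then have "w \<in> mu N" using g2[OF z] g2[OF w] that by simp
    then show ?thesis using psucc_inj[OF V True] that True by (simp add: g_def)
  next
    case False
    then have "w \<notin> mu N" using g2[OF z] g2[OF w] that by simp
    then show ?thesis using False that by (auto simp: g_def split: if_splits)
  qed
  show ?thesis
  proof (cases "Z \<noteq> {} \<and> 0 \<notin> convex hull Z")
    case True
    then have e: "succ_map V Z z = swap (first_pt Z) 2 (g z)" for z
      by (simp add: succ_map_def g_def)
    have f: "first_pt Z \<in> mu N" using first_props(3)[OF c] True by auto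
    have "swap (first_pt Z) 2 (swap (first_pt Z) 2 z) = z" for z
      using swap_invol[of "first_pt Z" 2] mu_N_nz[OF f] two_not_unit[OF f] by auto
    then have "g z = g w" using eq e by metis
    then show ?thesis by (rule gi)
  next
    case False
    then have e: "succ_map V Z z = g z" for z by (simp only: succ_map_def g_def Let_def if_False)
    then show ?thesis using gi eq by simp
  qed
qed

text \<open>Frees \<open>arc_split\<close> from \<open>PZ\<close>: if some rotation of
  \<open>P\<close> is \<open>Z\<close>, the locale is instantiated with that rotation. Rotating all
  data changes neither \<open>split_off\<close> nor the exchange.\<close>

lemma arc_move:
  assumes c: "config V Z" and P: "P \<in> V" and a: "a \<in> P" and l: "l = a * \<zeta> ^ k" "l \<in> P"
    and k: "k < N"
    and r: "r = {z \<in> P. \<exists>i\<le>k. z = a * \<zeta> ^ i}"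
    and H1: "\<And>z \<omega>. z \<in> r \<Longrightarrow> \<omega> \<in> mu e \<Longrightarrow> \<omega> * z \<in> r \<Longrightarrow> \<omega> = 1"
    and H2: "\<And>z. z \<in> r \<Longrightarrow> z \<noteq> l \<Longrightarrow> succ_map V Z z \<in> r"
    and H3: "succ_map V Z l \<notin> satur r"
  shows "config (split_off V r) (Z - satur r)"
    and "z \<in> Omega \<Longrightarrow> succ_map (split_off V r) (Z - satur r) z = swap a (succ_map V Z l) (succ_map
      V Z z)"
    and "rank V Z + e \<le> rank (split_off V r) (Z - satur r)"
    and "succ_map V Z l / a \<notin> mu e"
proof -
  have V: "sym_nc V" using c by (auto simp: config_def)
  have lO: "l \<in> Omega" using l sym_nc_sub[OF V P] mu_N_Omega by auto
  obtain \<omega> where w: "\<omega> \<in> mu e" and PZ: "rot \<omega> P = Z \<or> (\<forall>\<omega>'\<in>mu e. rot \<omega>' (rot \<omega> P) \<noteq> Z)"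
  proof (cases "\<exists>\<omega>\<in>mu e. rot \<omega> P = Z")
    case True then show ?thesis using that by blast
  next
    case False then show ?thesis using that[OF mu_one] by simp
  qed
  have w0: "\<omega> \<noteq> 0" using mu_e_nz[OF w] .
  have m: "z \<in> rot \<omega> p \<longleftrightarrow> (\<exists>y\<in>p. z = \<omega> * y)" for z p by (auto simp: rot_def)
  have rO: "y \<in> Omega" if "y \<in> r" for y using that sym_nc_sub[OF V P] mu_N_Omega unfolding r by auto
  have pl: "succ_map V Z (\<omega> * l) = \<omega> * succ_map V Z l" using succ_map_rot[OF c w lO] .
  interpret S: arc_split e n V Z "rot \<omega> P" "rot \<omega> r" "\<omega> * a" "\<omega> * l" k
  proof unfold_locales
    show "config V Z" "rot \<omega> P \<in> V" "k < N" using c sym_nc_rot[OF V w P] k by auto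
    show "\<omega> * a \<in> rot \<omega> P" "\<omega> * l \<in> rot \<omega> P" "\<omega> * l = \<omega> * a * \<zeta> ^ k"
      using a l by (auto simp: rot_def)
    show "rot \<omega> r = {z \<in> rot \<omega> P. \<exists>i\<le>k. z = \<omega> * a * \<zeta> ^ i}"
      unfolding r using w0 by (auto simp: rot_def mult.assoc)
    fix z assume "z \<in> rot \<omega> r"
    then obtain y where y: "y \<in> r" "z = \<omega> * y" by (auto simp: rot_def)
    show "\<omega>' = 1" if "\<omega>' \<in> mu e" "\<omega>' * z \<in> rot \<omega> r" for \<omega>'
    proof -
      have "\<omega> * (\<omega>' * y) \<in> rot \<omega> r" using that y by (simp add: mult_ac)
      then show ?thesis using H1[OF y(1) that(1)] rot_mem[OF w] by auto
    qed
    assume "z \<noteq> \<omega> * l"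
    then have "succ_map V Z y \<in> r" using H2 y by auto
    then show "succ_map V Z z \<in> rot \<omega> r" using succ_map_rot[OF c w rO[OF y(1)]] y
      by (auto simp: rot_def)
  next
    show "succ_map V Z (\<omega> * l) \<notin> satur (rot \<omega> r)" unfolding pl satur_rot_eq[OF w]
      using H3 satur_rot[OF w] by auto
  qed (use PZ in auto)
  show "config (split_off V r) (Z - satur r)" "rank V Z + e \<le> rank (split_off V r) (Z - satur r)"
    using S.config_V' S.rank_split unfolding split_rot[OF w] satur_rot_eq[OF w] by auto
  show "succ_map (split_off V r) (Z - satur r) z = swap a (succ_map V Z l) (succ_map V Z z)"
    if "z \<in> Omega"
    using S.succ_map_split[OF that] unfolding split_rot[OF w] satur_rot_eq[OF w]
      pl swap_scale[OF w] .
  show "succ_map V Z l / a \<notin> mu e" using S.ineq unfolding pl using w0 by simp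
qed

section \<open>Breaking up the long part\<close>

lemma window_rep:
  assumes s: "s \<in> mu N" and z: "z \<in> mu N"
  shows "\<exists>\<omega>\<in>mu e. \<exists>i<n. z = \<omega> * (s * \<zeta> ^ i)"
proof -
  obtain m where m: "m < N" "z = s * \<zeta> ^ m" using pos_ex[OF s z] by auto
  have "\<zeta> ^ m = \<zeta> ^ (n * (m div n)) * \<zeta> ^ (m mod n)" by (simp flip: power_add)
  then have "z = \<zeta> ^ (n * (m div n)) * (s * \<zeta> ^ (m mod n))" using m by (simp add: mult_ac)
  then show ?thesis using zeta_n_mu by (intro bexI[of _ "\<zeta> ^ (n * (m div n))"]
    exI[of _ "m mod n"]) auto
qed

lemma window_unique:
  assumes s: "s \<in> mu N" and w: "\<omega> \<in> mu e" and i: "i < n" "j < n" "s * \<zeta> ^ i = \<omega> * (s * \<zeta> ^ j)"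
  shows "\<omega> = 1" "i = j"
proof -
  have s0: "s \<noteq> 0" using s mu_N_nz by auto
  have "\<zeta> ^ i = \<omega> * \<zeta> ^ j" using i(3) s0 by (simp add: mult_ac)
  then have "\<zeta> ^ i / \<zeta> ^ j \<in> mu e" using w by simp
  then show "i = j" using mu_e_pow_iff i by auto
  then show "\<omega> = 1" using \<open>\<zeta> ^ i = \<omega> * \<zeta> ^ j\<close> by simp
qed

text \<open>In \<open>Z\<close> the last point of the window is followed by
  \<open>zeta e * s\<close>; afterwards it is followed by \<open>0\<close>, and \<open>0\<close> by
  \<open>s\<close>. Since a long configuration turns the circle of radius 2 by
  \<open>inverse (zeta e)\<close>, one equivariant exchange of \<open>2\<close> and
  \<open>zeta e * s\<close> accounts for both changes.\<close>

lemma window_move: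
  assumes c: "config V Z" and h: "0 \<in> convex hull Z" and s: "s \<in> Z"
    and W: "W = {z \<in> Z. \<exists>i<n. z = s * \<zeta> ^ i}" and V': "V' = (V - {Z}) \<union> {rot \<omega> W | \<omega>. \<omega> \<in> mu e}"
  shows "config V' W" and "z \<in> Omega \<Longrightarrow> succ_map V' W z = swap 2 (zeta e * s) (succ_map V Z z)"
    and "rank V Z + e \<le> rank V' W"
proof -
  have V: "sym_nc V" and Zv: "Z \<in> V" using c s by (auto simp: config_def)
  have sN: "s \<in> mu N" using s sym_nc_sub[OF V Zv] by auto
  have s0: "s \<noteq> 0" using sN mu_N_nz by auto
  have sW: "s \<in> W" unfolding W using s n1 by (auto intro!: exI[of _ 0])
  have WZ: "W \<subseteq> Z" "W \<subseteq> {s * \<zeta> ^ i | i. i < n}" unfolding W by auto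
  have ZN: "Z \<subseteq> mu N" using sym_nc_sub[OF V Zv] .
  have Zrot: "rot \<omega> Z = Z" if "\<omega> \<in> mu e" for \<omega> using sym_nc_long_rot[OF V Zv h that] .
  have rWZ: "rot \<omega> W \<subseteq> Z" if "\<omega> \<in> mu e" for \<omega> using rot_mono[OF WZ(1)] Zrot[OF that] by auto
  have repZ: "\<exists>\<omega>\<in>mu e. z \<in> rot \<omega> W" if z: "z \<in> Z" for z
  proof -
    have zN: "z \<in> mu N" using z ZN by auto
    obtain \<omega> i where w: "\<omega> \<in> mu e" "i < n" "z = \<omega> * (s * \<zeta> ^ i)" using window_rep[OF sN zN] by auto
    have "s * \<zeta> ^ i \<in> Z" using Zrot[OF w(1)] rot_mem[OF w(1), of "s * \<zeta> ^ i" Z] z w by auto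
    then have "s * \<zeta> ^ i \<in> W" unfolding W using w by auto
    then show ?thesis using w rot_mem by auto
  qed
  have Wuniq: "\<omega> = 1" if w: "\<omega> \<in> mu e" and zw: "z \<in> W" "\<omega> * z \<in> W" for \<omega> z
  proof -
    obtain i j where i: "i < n" "z = s * \<zeta> ^ i" "j < n" "\<omega> * z = s * \<zeta> ^ j" using WZ(2) zw by blast
    show ?thesis by (rule window_unique(1)[OF sN w i(3,1)]) (use i(2,4) in \<open>simp only:\<close>)
  qed
  have rdisj: "rot \<omega> W \<inter> rot \<omega>' W = {}" if "\<omega> \<in> mu e" "\<omega>' \<in> mu e" "\<omega> \<noteq> \<omega>'" for \<omega> \<omega>'
  proof (rule ccontr)
    assume "\<not> ?thesis"
    then obtain y y' where y: "y \<in> W" "y' \<in> W" "\<omega> * y = \<omega>' * y'" by (auto simp: rot_def)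
    then have "y = \<omega>' / \<omega> * y'" using mu_e_nz[OF that(1)] by (simp add: field_simps)
    then have "\<omega>' / \<omega> = 1" using Wuniq[OF mu_divide[OF that(2,1)] y(2)] y by auto
    then show False using that mu_e_nz by auto
  qed
  have key: "convex hull (rot \<omega> W) \<inter> convex hull (insert 0 W) = {}" if w: "\<omega> \<in> mu e" "\<omega> \<noteq> 1" for \<omega>
  \<comment> \<open>The rotated window ends \<open>n - 1\<close> positions after its start, so less
    than half a turn is cut off and \<open>0\<close> stays on the other side. By
    \<open>window_unique\<close> no point of \<open>W\<close> has a position in the rotated
    window.\<close>
  proof (rule arc_hulls_disjoint[of "\<omega> * s" "n - 1"])
    show "\<omega> * s \<in> mu N" using mu_N_rot[OF w(1) sN] .
    show "n - 1 < N" using n_less_N by simp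
    show "2 * (n - 1) + 1 < N" using N_ge n1 by linarith
    show "rot \<omega> W \<subseteq> {\<omega> * s * \<zeta> ^ i | i. i \<le> n - 1}"
    proof
      fix z assume "z \<in> rot \<omega> W"
      then obtain i where "i < n" "z = \<omega> * (s * \<zeta> ^ i)" using WZ(2) by (auto simp: rot_def)
      then show "z \<in> {\<omega> * s * \<zeta> ^ i | i. i \<le> n - 1}" by (auto simp: mult.assoc intro!: exI[of _ i])
    qed
    show "insert 0 W \<subseteq> {\<omega> * s * \<zeta> ^ i | i. n - 1 < i \<and> i < N} \<union> {0}"
    proof
      fix z assume z: "z \<in> insert 0 W"
      show "z \<in> {\<omega> * s * \<zeta> ^ i | i. n - 1 < i \<and> i < N} \<union> {0}"
      proof (cases "z = 0")
        case False
        then have zW: "z \<in> W" using z by auto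
        then have "z \<in> mu N" using WZ ZN by auto
        then obtain i where i: "i < N" "z = \<omega> * s * \<zeta> ^ i" using pos_ex[OF mu_N_rot[OF w(1) sN]]
          by blast
        have "\<not> i < n"
        proof
          assume "i < n"
          obtain j where j: "j < n" "z = s * \<zeta> ^ j" using zW WZ(2) by auto
          then have "s * \<zeta> ^ j = \<omega> * (s * \<zeta> ^ i)" using i by (simp only: mult.assoc)
          then show False using window_unique(1)[OF sN w(1) j(1) \<open>i < n\<close>] w(2) by blast
        qed
        then have "n - 1 < i" using n1 by linarith
        then show ?thesis using i by blast
      qed simp
    qed
  qed
  have ze: "zeta e \<in> mu e" by (rule zeta_mu)
  have Wshort: "0 \<notin> convex hull W"
    using key[OF ze zeta_e_ne_1] hull_inc[of 0 "insert 0 W" convex] zero_hull_rot[OF ze, of W]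
      by blast
  have cases: "(q \<in> V \<and> q \<noteq> Z) \<or> (\<exists>\<omega>\<in>mu e. q = rot \<omega> W)" if "q \<in> V'" for q using that V' by auto
  have rotV': "rot \<omega> W \<in> V'" if "\<omega> \<in> mu e" for \<omega> using that V' by auto
  have WV': "W \<in> V'" using rotV'[OF mu_one] by simp
  have h1: "convex hull (rot \<omega> W) \<inter> convex hull (rot \<omega>' W) = {}"
    if w: "\<omega> \<in> mu e" "\<omega>' \<in> mu e" "\<omega> \<noteq> \<omega>'" for \<omega> \<omega>'
  proof -
    have "convex hull (rot (\<omega> / \<omega>') W) \<inter> convex hull W = {}"
      using key[of "\<omega> / \<omega>'"] mu_divide[OF w(1,2)] w(3) mu_e_nz[OF w(2)]
        hull_mono[of W "insert 0 W" convex] by auto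
    then show ?thesis using hull_rot_disjoint[OF w(2), of "rot (\<omega> / \<omega>') W" W] mu_e_nz[OF w(2)]
      by (simp add: rot_rot)
  qed
  have h2: "convex hull (rot \<omega> W) \<inter> convex hull p = {}" if "\<omega> \<in> mu e" "p \<in> V" "p \<noteq> Z" for \<omega> p
    using sym_nc_hull[OF V Zv that(2)] that(3) hull_mono[OF rWZ[OF that(1)], of convex] by blast
  have hull: "p = q" if pq: "p \<in> V'" "q \<in> V'" and m: "convex hull p \<inter> convex hull q \<noteq> {}" for p q
  proof (rule ccontr)
    assume ne: "p \<noteq> q"
    show False using cases[OF pq(1)] cases[OF pq(2)]
    proof (elim disjE bexE conjE)
      assume "p \<in> V" "q \<in> V" then show False using sym_nc_hull[OF V] ne m by blast
    next
      fix \<omega> assume "p \<in> V" "p \<noteq> Z" "\<omega> \<in> mu e" "q = rot \<omega> W"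
      then show False using h2[of \<omega> p] m by auto
    next
      fix \<omega> assume "q \<in> V" "q \<noteq> Z" "\<omega> \<in> mu e" "p = rot \<omega> W"
      then show False using h2[of \<omega> q] m by auto
    next
      fix \<omega> \<omega>' assume "\<omega> \<in> mu e" "p = rot \<omega> W" "\<omega>' \<in> mu e" "q = rot \<omega>' W"
      then show False using h1[of \<omega> \<omega>'] ne m by auto
    qed
  qed
  have sub: "p \<subseteq> mu N" if "p \<in> V'" for p using cases[OF that] sym_nc_sub[OF V] rWZ ZN by blast
  have cover: "z \<in> \<Union> V'" if z: "z \<in> mu N" for z
  proof -
    obtain p where p: "p \<in> V" "z \<in> p" using sym_nc_ex[OF V z] by auto
    then show ?thesis using repZ[of z] rotV' V' by (cases "p = Z") auto
  qed
  have nc': "sym_nc V'"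
  proof -
    have "partition_on (mu N) V'"
    proof (rule partition_onI)
      show "\<Union> V' = mu N" using sub cover by auto
      show "disjnt p q" if "p \<in> V'" "q \<in> V'" "p \<noteq> q" for p q
        using hull[OF that(1,2)] that(3) hull_subset[of p convex] hull_subset[of q convex]
          unfolding disjnt_iff by blast
      show "{} \<notin> V'"
      proof
        assume "{} \<in> V'"
        then show False using cases[of "{}"] sym_nc_ne[OF V] sW rot_empty by (metis empty_iff)
      qed
    qed
    moreover have "rot \<omega> p \<in> V'" if w: "\<omega> \<in> mu e" and p: "p \<in> V'" for \<omega> p
      using cases[OF p]
    proof (elim disjE bexE conjE)
      assume q: "p \<in> V" "p \<noteq> Z"
      have "rot \<omega> p \<noteq> Z" using q rot_inject[OF w, of p Z] Zrot[OF w] by auto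
      then show ?thesis using sym_nc_rot[OF V w q(1)] V' by auto
    next
      fix \<omega>' assume "\<omega>' \<in> mu e" "p = rot \<omega>' W"
      then show ?thesis using mu_mult[OF w] rotV' by (simp add: rot_rot)
    qed
    ultimately show ?thesis unfolding sym_nc_def using hull by blast
  qed
  show cfg': "config V' W" unfolding config_def
  proof (intro conjI ballI impI)
    show "W = {} \<or> W \<in> V'" using WV' by simp
    fix p assume p: "p \<in> V'" "p \<noteq> W"
    show "convex hull (insert 0 W) \<inter> convex hull p = {}" using cases[OF p(1)]
    proof (elim disjE bexE conjE)
      assume q: "p \<in> V" "p \<noteq> Z"
      then have "convex hull (insert 0 Z) \<inter> convex hull p = {}" using c unfolding config_def
        by blast
      then show ?thesis using hull_mono[of "insert 0 W" "insert 0 Z" convex] WZ(1) by blast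
    next
      fix \<omega> assume w: "\<omega> \<in> mu e" "p = rot \<omega> W"
      then have "\<omega> \<noteq> 1" using p(2) by auto
      then show ?thesis using key[OF w(1)] w(2) by blast
    qed
  qed (rule nc')
  have fW: "first_pt W = s" using first_eq[OF sW WZ(2) sN] .
  have s2: "s / 2 \<notin> mu e" "2 / s \<notin> mu e" using two_not_unit[OF sN] by auto
  define s' where "s' = zeta e * s"
  have s'N: "s' \<in> mu N" using mu_N_rot[OF ze sN] by (simp add: s'_def)
  have s': "s' / 2 \<notin> mu e" "2 / s' \<notin> mu e" "s' \<noteq> 0" using two_not_unit[OF s'N] mu_N_nz[OF s'N]
    by auto
  have eqv: "z / s' \<in> mu e \<longleftrightarrow> z / s \<in> mu e" for z unfolding s'_def by (rule unit_div_rot2[OF ze])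
  have asW: "W \<noteq> {} \<and> 0 \<notin> convex hull W" using sW Wshort by auto
  have phV': "succ_map V' W z = swap s 2 (if z \<in> mu N then psucc V' z else z)" for z
    using asW by (auto simp: succ_map_def fW)
  have phV: "succ_map V Z z = (if z \<in> mu N then psucc V z else inverse (zeta e) * z)" for z
    using h by (simp add: succ_map_def)
  show "succ_map V' W z = swap 2 (zeta e * s) (succ_map V Z z)" if z: "z \<in> Omega"
  proof (cases "z \<in> mu N")
    case False
    then have z2: "z / 2 \<in> mu e" using Omega_cases[OF z] by auto
    have "swap s 2 z = z / 2 * swap s 2 2" using swap_rot[OF z2, of s 2 2] by simp
    also have "\<dots> = z / 2 * s" using swap_right[of s 2] s0 s2 by simp
    finally have 1: "succ_map V' W z = z / 2 * s" using phV' False by simp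
    have i2: "inverse (zeta e) * (z / 2) \<in> mu e" using mu_mult[OF mu_inverse[OF ze] z2] .
    have "swap 2 s' (inverse (zeta e) * z) = inverse (zeta e) * (z / 2) * swap 2 s' 2"
      using swap_rot[OF i2, of 2 s' 2] by simp
    also have "\<dots> = z / 2 * s" using swap_left[of 2 s'] by (simp add: s'_def)
    finally have "swap 2 s' (inverse (zeta e) * z) = z / 2 * s" .
    then show ?thesis unfolding 1 phV[of z] using False by (simp only: s'_def if_False)
  next
    case zN: True
    obtain p where p: "p \<in> V" "z \<in> p" using sym_nc_ex[OF V zN] by auto
    have scN: "psucc V z \<in> mu N" using psucc_mu[OF V zN] .
    have goal: "swap s 2 (psucc V' z) = swap 2 s' (psucc V z)"
    proof (cases "p = Z")
      case False
      then have pV': "p \<in> V'" using p V' by auto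
      have e: "psucc V' z = psucc V z" using psucc_eq[OF nc' pV' p(2)] psucc_eq[OF V p] by simp
      have "psucc V z / s \<notin> mu e"
      proof
        assume *: "psucc V z / s \<in> mu e"
        have "psucc V z = psucc V z / s * s" using s0 by simp
        then have "psucc V z \<in> rot (psucc V z / s) Z" using rot_mem[OF *] s by metis
        then have "psucc V z \<in> Z" using Zrot[OF *] by simp
        then show False using sym_nc_eq[OF V p(1) Zv psucc_in[OF V p]] False by simp
      qed
      then show ?thesis using e eqv two_not_unit(1)[OF scN] swap_id by simp
    next
      case True
      then obtain \<omega> where w: "\<omega> \<in> mu e" "z \<in> rot \<omega> W" using repZ p by auto
      then obtain y where y: "y \<in> W" "z = \<omega> * y" by (auto simp: rot_def)
      obtain i where i: "i < n" "y = s * \<zeta> ^ i" using y WZ(2) by auto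
      have yZ: "y \<in> Z" and yN: "y \<in> mu N" using y WZ ZN by auto
      have "swap s 2 (psucc V' y) = swap 2 s' (psucc V y)"
      \<comment> \<open>If \<open>y\<close> is the last point of the window, its successor wraps
        around to \<open>s\<close> in \<open>W\<close> but is \<open>s'\<close> in \<open>Z\<close>.
        Otherwise both successors agree, and the exchanges leave them alone.\<close>
      proof (cases "\<forall>j. i < j \<and> j < n \<longrightarrow> s * \<zeta> ^ j \<notin> W")
        case True
        then have "nxt_in W y = s" using window_nxt_in(1)[OF WZ(2) sW sN i(1)] y i by auto
        then have 1: "psucc V' y = s" using psucc_eq[OF nc' WV' y(1)] by simp
        have "nxt_in Z y = y * \<zeta> ^ (n - i)"
        proof (rule nxt_in_eqI)
          have e: "y * \<zeta> ^ (n - i) = s'" using i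
            by (simp add: s'_def zeta_e mult_ac flip: power_add)
          show "y * \<zeta> ^ (n - i) \<in> Z" unfolding e s'_def using Zrot[OF ze] rot_mem[OF ze, of s Z] s
            by simp
          show "0 < n - i" using i by simp
          fix j assume j: "0 < j" "j < n - i"
          show "y * \<zeta> ^ j \<notin> Z"
          proof
            assume "y * \<zeta> ^ j \<in> Z"
            then have "s * \<zeta> ^ (i + j) \<in> W" unfolding W using i j
              by (auto simp: power_add mult.assoc intro!: exI[of _ "i + j"])
            then show False using True j i by auto
          qed
        qed
        also have "\<dots> = s'" using i by (simp add: s'_def zeta_e mult_ac flip: power_add)
        finally have 2: "psucc V y = s'" using psucc_eq[OF V Zv yZ] by simp
        show ?thesis unfolding 1 2 using swap_left[OF s0] swap_right[of 2 s'] s' by simp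
      next
        case False
        obtain j where j: "i < j" "j < n" "nxt_in W y = s * \<zeta> ^ j" "s * \<zeta> ^ j \<in> W" "\<forall>t. i < t \<and>
          t < j \<longrightarrow> s * \<zeta> ^ t \<notin> W"
          using window_nxt_in(2)[OF WZ(2) sW sN i(1) _ False] y i by auto
        have "nxt_in Z y = y * \<zeta> ^ (j - i)"
        proof (rule nxt_in_eqI)
          have e: "y * \<zeta> ^ (j - i) = s * \<zeta> ^ j" using i j by (simp add: mult.assoc flip: power_add)
          show "y * \<zeta> ^ (j - i) \<in> Z" unfolding e using j WZ by auto
          show "0 < j - i" using j by simp
          fix t assume t: "0 < t" "t < j - i"
          show "y * \<zeta> ^ t \<notin> Z"
          proof
            assume "y * \<zeta> ^ t \<in> Z"
            then have "s * \<zeta> ^ (i + t) \<in> W" unfolding W using i j t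
              by (auto simp: power_add mult.assoc intro!: exI[of _ "i + t"])
            then show False using t j(5) by auto
          qed
        qed
        also have "\<dots> = s * \<zeta> ^ j" using i j by (simp add: mult.assoc flip: power_add)
        finally have 2: "psucc V y = s * \<zeta> ^ j" using psucc_eq[OF V Zv yZ] by simp
        have 1: "psucc V' y = s * \<zeta> ^ j" using psucc_eq[OF nc' WV' y(1)] j by simp
        have N: "s * \<zeta> ^ j \<in> mu N" using sN by blast
        have "s * \<zeta> ^ j / s \<notin> mu e"
        proof
          assume *: "s * \<zeta> ^ j / s \<in> mu e"
          have "s * \<zeta> ^ j = s * \<zeta> ^ j / s * (s * \<zeta> ^ 0)" using s0 by simp
          then show False using window_unique(2)[OF sN * j(2) N_pos(3)] j by auto
        qed
        then show ?thesis unfolding 1 2 using two_not_unit(1)[OF N] eqv swap_id by simp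
      qed
      then show ?thesis using psucc_rot[OF nc' w(1) yN] psucc_rot[OF V w(1) yN] swap_rot[OF w(1)]
        y by simp
    qed
    then show ?thesis using phV' phV zN by (simp add: s'_def)
  qed
  show "rank V Z + e \<le> rank V' W"
  proof -
    let ?A = "{p \<in> V. 0 \<notin> convex hull p}" and ?B = "{p \<in> V'. 0 \<notin> convex hull p}"
    let ?refl_mat = "(\<lambda>\<omega>. rot \<omega> W) ` mu e"
    have fin: "finite ?A" "finite ?B" using sym_nc_finite(1)[OF V] sym_nc_finite(1)[OF nc'] by auto
    have "inj_on (\<lambda>\<omega>. rot \<omega> W) (mu e)"
      using rdisj sW unfolding inj_on_def by (metis Int_absorb empty_iff rot_empty)
    then have "card ?refl_mat = card (mu e)" by (rule card_image)
    then have cR: "card ?refl_mat = e" using mu_card[of e] by simp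
    have "?A \<inter> ?refl_mat = {}"
    proof (rule ccontr)
      assume "?A \<inter> ?refl_mat \<noteq> {}"
      then obtain \<omega> where w: "\<omega> \<in> mu e" "rot \<omega> W \<in> V" "0 \<notin> convex hull (rot \<omega> W)" by auto
      have "\<omega> * s \<in> rot \<omega> W" using rot_mem[OF w(1)] sW by simp
      then have "rot \<omega> W = Z" using sym_nc_eq[OF V w(2) Zv] rWZ[OF w(1)] by blast
      then show False using w h by simp
    qed
    then have cU: "card (?A \<union> ?refl_mat) = card ?A + e" using cR fin mu_finite[of e]
      by (subst card_Un_disjoint) auto
    have "?A \<union> ?refl_mat \<subseteq> ?B" using h V' zero_hull_rot Wshort by auto
    then have "card ?A + e \<le> card ?B" unfolding cU[symmetric] by (rule card_mono[OF fin(2)])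
    then show ?thesis using s sW by (auto simp: rank_def)
  qed
qed

section \<open>The greatest and the least configuration\<close>

lemma top_config: "config {mu N} (mu N)" and top_long: "0 \<in> convex hull mu N"
  and top_succ_map: "z \<in> Omega \<Longrightarrow> succ_map {mu N} (mu N) z = (if z \<in> mu N then \<zeta> * z else inverse
    (zeta e) * z)"
proof -
  have inv: "rot \<omega> (mu N) = mu N" if w: "\<omega> \<in> mu e" for \<omega>
  proof (intro equalityI subsetI)
    show "z \<in> mu N" if "z \<in> rot \<omega> (mu N)" for z using that mu_N_rot[OF w] by (auto simp: rot_def)
    show "z \<in> rot \<omega> (mu N)" if "z \<in> mu N" for z
      using mu_N_rot[OF mu_inverse[OF w] that] rot_iff[OF w, of z "mu N"]
        by (simp add: divide_inverse mult.commute)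
  qed
  show lg: "0 \<in> convex hull mu N" using zero_hull[OF zeta_mu zeta_e_ne_1 mu_one] inv[OF zeta_mu]
    by simp
  have ncT: "sym_nc {mu N}" using inv mu_one by (auto simp: sym_nc_def partition_on_def)
  show "config {mu N} (mu N)" using ncT by (auto simp: config_def)
  assume "z \<in> Omega"
  have "psucc {mu N} z = \<zeta> * z" if z: "z \<in> mu N"
  proof -
    have "nxt_in (mu N) z = z * \<zeta> ^ 1" by (rule nxt_in_eqI) (use mu_N_pow[OF z, of 1] in auto)
    then show ?thesis using psucc_eq[OF ncT, of "mu N" z] z by (simp add: mult.commute)
  qed
  then show "succ_map {mu N} (mu N) z = (if z \<in> mu N then \<zeta> * z else inverse (zeta e) * z)"
    using lg by (simp add: succ_map_def)
qed

definition singletons :: "complex set set" where "singletons = (\<lambda>z. {z}) ` mu N"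

lemma singletons_config: "config singletons {}"
  and singletons_succ_map: "z \<in> Omega \<Longrightarrow> succ_map singletons {} z = z"
proof -
  have "rot \<omega> {z} = {\<omega> * z}" for \<omega> z by (simp add: rot_def)
  then have ncF: "sym_nc singletons" using mu_N_rot
    by (auto simp: sym_nc_def partition_on_def singletons_def disjoint_def)
  show "config singletons {}" using ncF zero_notin_mu by (auto simp: config_def singletons_def)
  assume "z \<in> Omega"
  have "psucc singletons z = z" if z: "z \<in> mu N"
  proof -
    have "nxt_in {z} z \<in> {z}" by (rule nxt_in_in) simp
    then show ?thesis using psucc_eq[OF ncF, of "{z}" z] z by (simp add: singletons_def)
  qed
  then show "succ_map singletons {} z = z" by (simp add: succ_map_def convex_hull_empty)
qed

lemma rank_le: assumes "config V Z" shows "rank V Z \<le> e * dm"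
proof -
  have V: "sym_nc V" using assms by (simp add: config_def)
  have "\<exists>h. \<forall>p\<in>V. h p \<in> p" using sym_nc_ne[OF V] by (intro bchoice) auto
  then obtain h where h: "\<forall>p\<in>V. h p \<in> p" by auto
  have "inj_on h V" using h sym_nc_eq[OF V] unfolding inj_on_def by metis
  moreover have "h ` V \<subseteq> mu N" using h sym_nc_sub[OF V] by blast
  ultimately have "card V \<le> card (mu N)" using mu_finite[of N] by (intro card_inj_on_le) auto
  moreover have "card {p \<in> V. 0 \<notin> convex hull p} \<le> card V" using sym_nc_finite(1)[OF V]
    by (intro card_mono) auto
  ultimately show ?thesis using mu_card[of N] by (simp add: rank_def dm_def N_def)
qed

section \<open>Reflections below a configuration\<close>

lemma Omega_finite: "finite Omega"
proof -
  have "Omega \<subseteq> mu N \<union> (*) 2 ` mu e"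
  proof
    fix z assume z: "z \<in> Omega"
    have "z = 2 * (z / 2)" by simp
    then show "z \<in> mu N \<union> (*) 2 ` mu e" using Omega_cases[OF z] by blast
  qed
  then show ?thesis using mu_finite[of N] mu_finite[of e] finite_subset by auto
qed

lemma Omega_unit: "x \<in> Omega \<Longrightarrow> z / x \<in> mu e \<Longrightarrow> \<exists>\<omega>\<in>mu e. z = \<omega> * x"
  using Omega_nz by (intro bexI[of _ "z / x"]) auto

text \<open>A step never passes a point of \<open>p\<close>; so until the iterates return to
  \<open>x\<close> they do not wrap around, and they exhaust \<open>p\<close> in the order of
  exponents.\<close>

lemma nxt_in_iter_arc:
  assumes x: "x \<in> p" "x \<noteq> 0" and m: "\<And>i. 0 < i \<Longrightarrow> i < m \<Longrightarrow> (nxt_in p ^^ i) x \<noteq> x" and "0 < m"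
  shows "\<exists>k<N. (nxt_in p ^^ (m - 1)) x = x * \<zeta> ^ k \<and> {(nxt_in p ^^ i) x |
    i. i < m} = {z \<in> p. \<exists>i\<le>k. z = x * \<zeta> ^ i}"
  using \<open>0 < m\<close> m
proof (induction m)
  case (Suc m)
  show ?case
  proof (cases "m = 0")
    case True
    then show ?thesis using x by (intro exI[of _ 0]) auto
  next
    case False
    then obtain k where k: "k < N" "(nxt_in p ^^ (m - 1)) x = x * \<zeta> ^ k"
      "{(nxt_in p ^^ i) x | i. i < m} = {z \<in> p. \<exists>i\<le>k. z = x * \<zeta> ^ i}"
      using Suc by auto
    define w where "w = x * \<zeta> ^ k"
    have "w \<in> {(nxt_in p ^^ i) x | i. i < m}" unfolding w_def k(2)[symmetric] using False
      by (intro CollectI exI[of _ "m - 1"]) auto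
    then have wp: "w \<in> p" using k(3) by auto
    obtain j where j: "0 < j" "nxt_in p w = w * \<zeta> ^ j" "w * \<zeta> ^ j \<in> p" "\<forall>i. 0 < i \<and>
      i < j \<longrightarrow> w * \<zeta> ^ i \<notin> p"
      using nxt_in_ex[OF wp] by auto
    have step: "(nxt_in p ^^ m) x = nxt_in p w" using False k(2) by (cases m) (auto simp: w_def)
    have wN: "w * \<zeta> ^ (N - k) = x" using k(1) by (simp add: w_def mult.assoc flip: power_add)
    have "nxt_in p w \<noteq> x" using Suc.prems(2)[of m] False step by auto
    then have "j \<noteq> N - k" using j wN by auto
    moreover have "\<not> N - k < j" using j(4)[rule_format, of "N - k"] wN x k(1) by auto
    ultimately have jk: "k + j < N" by linarith
    have e: "w * \<zeta> ^ t = x * \<zeta> ^ (k + t)" for t by (simp add: w_def power_add mult.assoc)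
    have "{(nxt_in p ^^ i) x | i. i < Suc m} = insert ((nxt_in p ^^ m) x) {(nxt_in p ^^ i) x |
      i. i < m}"
      by (auto simp: less_Suc_eq simp del: funpow.simps)
    also have "\<dots> = insert (nxt_in p w) {(nxt_in p ^^ i) x | i. i < m}" using step by simp
    also have "\<dots> = {z \<in> p. \<exists>i\<le>k + j. z = x * \<zeta> ^ i}"
    proof (intro equalityI subsetI)
      fix z assume "z \<in> insert (nxt_in p w) {(nxt_in p ^^ i) x | i. i < m}"
      then show "z \<in> {z \<in> p. \<exists>i\<le>k + j. z = x * \<zeta> ^ i}"
        unfolding k(3) using j e[of j] by (auto intro: exI[of _ "k + j"] trans_le_add1)
    next
      fix z assume "z \<in> {z \<in> p. \<exists>i\<le>k + j. z = x * \<zeta> ^ i}"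
      then obtain i where i: "z \<in> p" "i \<le> k + j" "z = x * \<zeta> ^ i" by auto
      consider "i \<le> k" | "k < i" "i < k + j" | "i = k + j" using i by linarith
      then show "z \<in> insert (nxt_in p w) {(nxt_in p ^^ i) x | i. i < m}"
      proof cases
        case 1 then show ?thesis unfolding k(3) using i by auto
      next
        case 2
        then have "w * \<zeta> ^ (i - k) \<notin> p" using j(4) by auto
        then show ?thesis using e[of "i - k"] 2 i by simp
      next
        case 3 then show ?thesis using j e[of j] i by auto
      qed
    qed
    finally show ?thesis using jk step j e[of j] by (intro exI[of _ "k + j"]) auto
  qed
qed simp

text \<open>The last point of \<open>p\<close> before exponent \<open>t\<close> is reached by
  induction, and one more step leads to \<open>t\<close>. The bound on the exponents along the way
  is what \<open>refl_below\<close> compares with a first return.\<close>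

lemma nxt_in_iter_reach:
  assumes x: "x \<in> p"
  shows "x * \<zeta> ^ t \<in> p \<Longrightarrow> \<exists>i. (nxt_in p ^^ i) x = x * \<zeta> ^ t \<and>
    (\<forall>i'\<le>i. \<exists>t'\<le>t. (nxt_in p ^^ i') x = x * \<zeta> ^ t' \<and> (0 < i' \<longrightarrow> 0 < t'))"
proof (induction t rule: less_induct)
  case (less t)
  show ?case
  proof (cases "t = 0")
    case True
    then show ?thesis by (intro exI[of _ 0]) auto
  next
    case False
    define t0 where "t0 = Max {t'. t' < t \<and> x * \<zeta> ^ t' \<in> p}"
    have fin: "finite {t'. t' < t \<and> x * \<zeta> ^ t' \<in> p}" by simp
    have ne: "{t'. t' < t \<and> x * \<zeta> ^ t' \<in> p} \<noteq> {}" using False x by (auto intro!: exI[of _ 0])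
    have t0: "t0 < t" "x * \<zeta> ^ t0 \<in> p" using Max_in[OF fin ne] unfolding t0_def by auto
    have t0m: "x * \<zeta> ^ t' \<notin> p" if "t0 < t'" "t' < t" for t'
    proof
      assume "x * \<zeta> ^ t' \<in> p"
      then have "t' \<le> t0" unfolding t0_def by (intro Max_ge[OF fin]) (use that in auto)
      then show False using that by simp
    qed
    obtain i where i: "(nxt_in p ^^ i) x = x * \<zeta> ^ t0"
      "\<forall>i'\<le>i. \<exists>t'\<le>t0. (nxt_in p ^^ i') x = x * \<zeta> ^ t' \<and> (0 < i' \<longrightarrow> 0 < t')" using less.IH[OF t0]
        by auto
    have "nxt_in p (x * \<zeta> ^ t0) = x * \<zeta> ^ t0 * \<zeta> ^ (t - t0)"
    proof (rule nxt_in_eqI)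
      show "0 < t - t0" "x * \<zeta> ^ t0 * \<zeta> ^ (t - t0) \<in> p" using t0 less.prems
        by (auto simp: mult.assoc simp flip: power_add)
      show "x * \<zeta> ^ t0 * \<zeta> ^ i \<notin> p" if "0 < i" "i < t - t0" for i
        using t0m[of "t0 + i"] that by (simp add: mult.assoc power_add)
    qed
    also have "\<dots> = x * \<zeta> ^ t" using t0 by (simp add: mult.assoc flip: power_add)
    finally have s: "(nxt_in p ^^ Suc i) x = x * \<zeta> ^ t" using i by simp
    have "\<exists>t'\<le>t. (nxt_in p ^^ i') x = x * \<zeta> ^ t' \<and> (0 < i' \<longrightarrow> 0 < t')" if "i' \<le> Suc i" for i'
    proof (cases "i' = Suc i")
      case True
      then show ?thesis using s False by auto
    next
      case False
      then have "i' \<le> i" using that by simp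
      then obtain t' where "t' \<le> t0" "(nxt_in p ^^ i') x = x * \<zeta> ^ t' \<and> (0 < i' \<longrightarrow> 0 < t')"
        using i(2) by blast
      then show ?thesis using t0 by (intro exI[of _ t']) auto
    qed
    then show ?thesis using s by blast
  qed
qed

context
  fixes V Z assumes c: "config V Z"
begin

abbreviation "\<phi> \<equiv> succ_map V Z"

lemma sym_nc_of_config: "sym_nc V" and part_of_config: "Z = {} \<or> Z \<in> V" using c
  by (auto simp: config_def)

lemma it_Omega: "x \<in> Omega \<Longrightarrow> (\<phi> ^^ i) x \<in> Omega" by (induction i) (auto simp: succ_map_Omega[OF c])

lemma it_rot: "\<omega> \<in> mu e \<Longrightarrow> x \<in> Omega \<Longrightarrow> (\<phi> ^^ i) (\<omega> * x) = \<omega> * (\<phi> ^^ i) x"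
  by (induction i) (auto simp: succ_map_rot[OF c] it_Omega)

lemma it_inj: "x \<in> Omega \<Longrightarrow> y \<in> Omega \<Longrightarrow> (\<phi> ^^ i) x = (\<phi> ^^ i) y \<Longrightarrow> x = y"
proof (induction i)
  case (Suc i)
  then show ?case using succ_map_inj[OF c it_Omega[OF Suc.prems(1)] it_Omega[OF Suc.prems(2)]]
    by simp
qed simp

lemma it_add: "(\<phi> ^^ (i + j)) x = (\<phi> ^^ i) ((\<phi> ^^ j) x)" by (simp add: funpow_add)

lemma it_cancel: "x \<in> Omega \<Longrightarrow> i \<le> j \<Longrightarrow> \<omega> \<in> mu e \<Longrightarrow> (\<phi> ^^ j) x = \<omega> * (\<phi> ^^ i) x \<Longrightarrow>
  (\<phi> ^^ (j - i)) x = \<omega> * x"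
proof -
  assume a: "x \<in> Omega" "i \<le> j" "\<omega> \<in> mu e" "(\<phi> ^^ j) x = \<omega> * (\<phi> ^^ i) x"
  have "(\<phi> ^^ i) ((\<phi> ^^ (j - i)) x) = (\<phi> ^^ i) (\<omega> * x)"
    using a it_add[of i "j - i" x] it_rot[of \<omega> x i] by simp
  then show ?thesis using it_inj it_Omega Omega_rot a by blast
qed

lemma it_return: "x \<in> Omega \<Longrightarrow> \<exists>m>0. (\<phi> ^^ m) x = x"
proof -
  assume x: "x \<in> Omega"
  have "\<not> inj_on (\<lambda>i. (\<phi> ^^ i) x) UNIV"
  proof
    assume "inj_on (\<lambda>i. (\<phi> ^^ i) x) UNIV"
    moreover have "finite (range (\<lambda>i. (\<phi> ^^ i) x))" using it_Omega[OF x] Omega_finite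
      by (auto intro: finite_subset)
    ultimately show False using finite_imageD by blast
  qed
  then obtain i j where "i < j" "(\<phi> ^^ j) x = (\<phi> ^^ i) x" unfolding inj_on_def
    by (metis UNIV_I linorder_neqE_nat)
  then show ?thesis using it_cancel[OF x _ mu_one, of i j] by (intro exI[of _ "j - i"]) auto
qed

text \<open>It suffices to find a set \<open>B\<close> containing \<open>x\<close> that is stable
  under \<open>\<phi>\<close> and meets each orbit at most once, since then \<open>x\<close> and
  \<open>\<omega> * x\<close> are both in \<open>B\<close>. A short part serves, with one point of
  radius 2 added if it is a rotation of an asymmetric \<open>Z\<close>. The hypothesis
  \<open>nl\<close> excludes a long part and the circle of radius 2 beside it.\<close>

lemma weight_one:
  assumes x: "x \<in> Omega" and nl: "0 \<in> convex hull Z \<Longrightarrow> x \<in> mu N \<and> x \<notin> Z"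
    and w: "\<omega> \<in> mu e" and k: "(\<phi> ^^ k) x = \<omega> * x"
  shows "\<omega> = 1"
proof -
  have "\<exists>B. x \<in> B \<and> (\<forall>z\<in>B. \<phi> z \<in> B) \<and> (\<forall>z\<in>B. \<forall>\<omega>\<in>mu e. \<omega> * z \<in> B \<longrightarrow> \<omega> = 1)"
  proof (cases "Z \<noteq> {} \<and> 0 \<notin> convex hull Z")
    case False
    then have e: "\<phi> z = (if z \<in> mu N then psucc V z else if 0 \<in> convex hull Z then inverse (zeta
      e) * z else z)" for z
      by (simp only: succ_map_def Let_def if_False)
    show ?thesis
    proof (cases "x \<in> mu N")
      case True
      then obtain p where p: "p \<in> V" "x \<in> p" using sym_nc_ex[OF sym_nc_of_config] by auto
      have "0 \<notin> convex hull p" using config_long[OF c p(1)] nl p(2) by auto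
      then show ?thesis using p e sym_nc_sub[OF sym_nc_of_config p(1)]
        psucc_in[OF sym_nc_of_config p(1)] sym_nc_short[OF sym_nc_of_config p(1)]
          by (intro exI[of _ p]) auto
    next
      case F: False
      then have "\<phi> x = x" using e nl by auto
      then show ?thesis using Omega_nz[OF x] by (intro exI[of _ "{x}"]) auto
    qed
  next
    case True
    define f where "f = first_pt Z"
    note fp = first_props[OF c, folded f_def]
    have f: "f \<in> Z" "f \<in> mu N" "f \<noteq> 0" using fp True mu_N_nz by auto
    have Zv: "Z \<in> V" using True part_of_config by auto
    have e: "\<phi> z = swap f 2 (if z \<in> mu N then psucc V z else z)" for z using True
      by (auto simp: succ_map_def f_def)
    have em: "\<phi> z = (if psucc V z / f \<in> mu e then psucc V z / f * 2 else psucc V z)" if "z \<in> mu N"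
      for z
      using e[of z] that two_not_unit(1)[OF psucc_mu[OF sym_nc_of_config that]]
        by (simp add: swap_def)
    have e2: "\<phi> (2 * \<omega>) = \<omega> * f" if "\<omega> \<in> mu e" for \<omega>
      using e[of "2 * \<omega>"] two_notin_mu[OF that] swap_rot[OF that, of f 2 2] swap_right[of f 2]
        f two_not_unit[OF f(2)]
      by (simp add: mult.commute)
    have orb: "\<exists>B. x \<in> B \<and> (\<forall>z\<in>B. \<phi> z \<in> B) \<and> (\<forall>z\<in>B. \<forall>\<omega>\<in>mu e. \<omega> * z \<in> B \<longrightarrow> \<omega> = 1)"
      if w: "\<alpha> \<in> mu e" and xB: "x \<in> insert (2 * \<alpha>) (rot \<alpha> Z)" for \<alpha>
    proof (intro exI conjI ballI impI)
      have rV: "rot \<alpha> Z \<in> V" using sym_nc_rot[OF sym_nc_of_config w Zv] .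
      have rs: "0 \<notin> convex hull (rot \<alpha> Z)" using zero_hull_rot[OF w] True by auto
      show "x \<in> insert (2 * \<alpha>) (rot \<alpha> Z)" by fact
      show "\<phi> z \<in> insert (2 * \<alpha>) (rot \<alpha> Z)" if z: "z \<in> insert (2 * \<alpha>) (rot \<alpha> Z)" for z
      proof (cases "z = 2 * \<alpha>")
        case True
        then show ?thesis using e2[OF w] rot_mem[OF w] f by auto
      next
        case False
        then have zr: "z \<in> rot \<alpha> Z" using z by auto
        then have zN: "z \<in> mu N" using sym_nc_sub[OF sym_nc_of_config rV] by auto
        have s: "psucc V z \<in> rot \<alpha> Z" using psucc_in[OF sym_nc_of_config rV zr] .
        show ?thesis
        proof (cases "psucc V z / f \<in> mu e")
          case True
          have af: "\<alpha> * f \<in> rot \<alpha> Z" using rot_mem[OF w] f by auto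
          have "psucc V z / f / \<alpha> * (\<alpha> * f) = psucc V z" using f mu_e_nz[OF w] by simp
          then have "psucc V z / f / \<alpha> = 1" using sym_nc_short[OF sym_nc_of_config rV rs
            mu_divide[OF True w] af] s by simp
          then have "psucc V z / f = \<alpha>" using mu_e_nz[OF w] by simp
          then show ?thesis using em[OF zN] True by simp
        next
          case False
          then show ?thesis using em[OF zN] s by simp
        qed
      qed
      fix z \<omega> assume z: "z \<in> insert (2 * \<alpha>) (rot \<alpha> Z)" and w': "\<omega> \<in> mu e"
        and wz: "\<omega> * z \<in> insert (2 * \<alpha>) (rot \<alpha> Z)"
      have rN: "y \<in> mu N" if "y \<in> rot \<alpha> Z" for y using that sym_nc_sub[OF sym_nc_of_config rV]
        by auto
      show "\<omega> = 1"
      proof (cases "z = 2 * \<alpha>")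
        case True
        have "\<omega> * z \<notin> rot \<alpha> Z" using rN two_notin_mu[OF mu_mult[OF w' w]] True
          by (auto simp: mult_ac)
        then show ?thesis using wz True mu_e_nz[OF w] by auto
      next
        case False
        then have zr: "z \<in> rot \<alpha> Z" using z by auto
        then have "\<omega> * z \<in> mu N" using mu_N_rot[OF w'] rN by auto
        then have "\<omega> * z \<in> rot \<alpha> Z" using wz two_notin_mu[OF w] by auto
        then show ?thesis using sym_nc_short[OF sym_nc_of_config rV rs w' zr] by auto
      qed
    qed
    show ?thesis
    proof (cases "x \<in> mu N")
      case False
      then have "x / 2 \<in> mu e" using Omega_cases[OF x] by auto
      then show ?thesis by (intro orb[of "x / 2"]) auto
    next
      case xN: True
      show ?thesis
      proof (cases "\<exists>\<alpha>\<in>mu e. x \<in> rot \<alpha> Z")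
        case True
        then show ?thesis using orb by blast
      next
        case nx: False
        obtain p where p: "p \<in> V" "x \<in> p" using sym_nc_ex[OF sym_nc_of_config xN] by auto
        have ps: "0 \<notin> convex hull p" using config_long[OF c p(1)] True by auto
        have "\<phi> z \<in> p" if z: "z \<in> p" for z
        proof -
          have zN: "z \<in> mu N" using z sym_nc_sub[OF sym_nc_of_config p(1)] by auto
          have s: "psucc V z \<in> p" using psucc_in[OF sym_nc_of_config p(1) z] .
          have "psucc V z / f \<notin> mu e"
          proof
            assume *: "psucc V z / f \<in> mu e"
            have "psucc V z = psucc V z / f * f" using f by simp
            then have "psucc V z \<in> rot (psucc V z / f) Z" using rot_mem[OF *] f by metis
            then have "p = rot (psucc V z / f) Z"
              using sym_nc_eq[OF sym_nc_of_config p(1) sym_nc_rot[OF sym_nc_of_config * Zv] s]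
                by simp
            then show False using nx p * by blast
          qed
          then show ?thesis using em[OF zN] s by simp
        qed
        then show ?thesis using p sym_nc_short[OF sym_nc_of_config p(1) ps]
          by (intro exI[of _ p]) auto
      qed
    qed
  qed
  then obtain B where B: "x \<in> B" "\<And>z. z \<in> B \<Longrightarrow> \<phi> z \<in> B" "\<And>z \<omega>. z \<in> B \<Longrightarrow> \<omega> \<in> mu e \<Longrightarrow> \<omega> * z \<in> B \<Longrightarrow>
    \<omega> = 1" by blast
  have "(\<phi> ^^ i) x \<in> B" for i by (induction i) (use B in auto)
  then show "\<omega> = 1" using B(3)[OF B(1) w] k by metis
qed

text \<open>The arc consists of the iterates of \<open>x\<close> before the first visit to \<open>y\<close>.\<close>

lemma path_move:
  assumes x: "x \<in> Omega" and y: "y \<in> Omega" and xy: "y / x \<notin> mu e" and m: "0 < m" "(\<phi> ^^ m) x = y"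
    and first_pt: "\<And>i. 0 < i \<Longrightarrow> i < m \<Longrightarrow> (\<phi> ^^ i) x / x \<notin> mu e \<and> (\<phi> ^^ i) x / y \<notin> mu e"
    and muN: "\<And>i. i < m \<Longrightarrow> (\<phi> ^^ i) x \<in> mu N"
  shows "\<exists>V' Z'. config V' Z' \<and> (\<forall>z\<in>Omega. succ_map V' Z' z = swap x y (\<phi> z))"
proof -
  have x0: "x \<noteq> 0" and y0: "y \<noteq> 0" using Omega_nz x y by auto
  have xN: "x \<in> mu N" using muN[of 0] m by simp
  obtain P where P: "P \<in> V" "x \<in> P" using sym_nc_ex[OF sym_nc_of_config xN] by auto
  \<comment> \<open>When the exchange with the radius 2 point acts on a successor, it moves it off
    the unit circle; where the image is in \<open>mu N\<close>, it has not acted.\<close>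
  have step: "\<phi> z = psucc V z" if z: "z \<in> mu N" "\<phi> z \<in> mu N" for z
  proof (cases "Z \<noteq> {} \<and> 0 \<notin> convex hull Z")
    case True
    have s: "psucc V z \<in> mu N" using psucc_mu[OF sym_nc_of_config z(1)] .
    have "psucc V z / first_pt Z \<notin> mu e"
    proof
      assume *: "psucc V z / first_pt Z \<in> mu e"
      then have "\<phi> z = 2 * (psucc V z / first_pt Z)" using succ_map_mu[OF z(1), of V Z] True
        by (simp add: swap_def)
      then show False using two_notin_mu[OF *] z(2) by simp
    qed
    then show ?thesis using succ_map_mu[OF z(1), of V Z] True two_not_unit(1)[OF s] swap_id by simp
  next
    case False
    then show ?thesis by (simp only: succ_map_mu[OF z(1)] if_False)
  qed
  have it: "(\<phi> ^^ i) x = (nxt_in P ^^ i) x \<and> (\<phi> ^^ i) x \<in> P" if "i < m" for i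
    using that
  proof (induction i)
    case (Suc i)
    then have IH: "(\<phi> ^^ i) x = (nxt_in P ^^ i) x" "(\<phi> ^^ i) x \<in> P" by auto
    have "(\<phi> ^^ Suc i) x = psucc V ((\<phi> ^^ i) x)" using step muN[of i] muN[of "Suc i"] Suc.prems
      by simp
    also have "\<dots> = nxt_in P ((\<phi> ^^ i) x)" using psucc_eq[OF sym_nc_of_config P(1) IH(2)] .
    finally show ?case using IH nxt_in_in[OF IH(2)] by simp
  qed (use P in simp)
  have ne: "(nxt_in P ^^ i) x \<noteq> x" if "0 < i" "i < m" for i
    using first_pt[OF that] it[OF that(2)] x0 by (auto simp: mu_one)
  define r where "r = {(\<phi> ^^ i) x | i. i < m}"
  have r': "r = {(nxt_in P ^^ i) x | i. i < m}" unfolding r_def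
    by (rule Collect_cong) (use it in metis)
  obtain k where k: "k < N" "(nxt_in P ^^ (m - 1)) x = x * \<zeta> ^ k" "r = {z \<in> P. \<exists>i\<le>k. z = x * \<zeta> ^ i}"
    using nxt_in_iter_arc[OF P(2) x0 ne m(1)] unfolding r' by blast
  define l where "l = (\<phi> ^^ (m - 1)) x"
  have l: "l = x * \<zeta> ^ k" "l \<in> P" using k it[of "m - 1"] m by (auto simp: l_def)
  have pl: "\<phi> l = y" using m by (cases m) (auto simp: l_def)
  \<comment> \<open>Two points of the arc in one orbit would, after cancelling iterates, give an
    early return to the orbit of \<open>x\<close>.\<close>
  have H1: "\<omega> = 1" if z: "z \<in> r" and w: "\<omega> \<in> mu e" and wz: "\<omega> * z \<in> r" for z \<omega>
  proof -
    obtain i j where i: "i < m" "z = (\<phi> ^^ i) x" and j: "j < m" "\<omega> * z = (\<phi> ^^ j) x"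
      using z wz r_def by auto
    have w0: "\<omega> \<noteq> 0" using mu_e_nz[OF w] .
    consider "i = j" | "i < j" | "j < i" by linarith
    then show ?thesis
    proof cases
      case 1
      then have "\<omega> * z = z" using i j by simp
      then show ?thesis using Omega_nz[OF it_Omega[OF x]] i by simp
    next
      case 2
      have "(\<phi> ^^ (j - i)) x = \<omega> * x" using it_cancel[OF x _ w, of i j] 2 i j by simp
      moreover have "0 < j - i" "j - i < m" using 2 j by auto
      ultimately show ?thesis using first_pt[of "j - i"] x0 w by auto
    next
      case 3
      have "(\<phi> ^^ i) x = inverse \<omega> * (\<omega> * z)" using i(2) w0 by simp
      also have "\<dots> = inverse \<omega> * (\<phi> ^^ j) x" using j(2) by simp
      finally have "(\<phi> ^^ i) x = inverse \<omega> * (\<phi> ^^ j) x" .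
      then have "(\<phi> ^^ (i - j)) x = inverse \<omega> * x"
        using it_cancel[OF x _ mu_inverse[OF w], of j i] 3 by simp
      moreover have "0 < i - j" "i - j < m" using 3 i by auto
      ultimately show ?thesis using first_pt[of "i - j"] x0 mu_inverse[OF w] by auto
    qed
  qed
  have H2: "\<phi> z \<in> r" if z: "z \<in> r" "z \<noteq> l" for z
  proof -
    obtain i where i: "i < m" "z = (\<phi> ^^ i) x" using z r_def by auto
    then have "i \<noteq> m - 1" using z(2) l_def by auto
    then have "Suc i < m" using i by simp
    moreover have "\<phi> z = (\<phi> ^^ Suc i) x" using i by simp
    ultimately show ?thesis unfolding r_def by blast
  qed
  have H3: "\<phi> l \<notin> satur r"
  proof
    assume "\<phi> l \<in> satur r"
    then obtain \<omega> i where w: "\<omega> \<in> mu e" "i < m" "y = \<omega> * (\<phi> ^^ i) x" unfolding pl satur_def r_def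
      by auto
    show False
    proof (cases "i = 0")
      case True
      then show False using w xy x0 by auto
    next
      case False
      have "(\<phi> ^^ i) x / y = inverse \<omega>" using w Omega_nz[OF it_Omega[OF x], of i]
        by (simp add: field_simps)
      then show False using first_pt[of i] False w mu_inverse[OF w(1)] by auto
    qed
  qed
  have "config (split_off V r) (Z - satur r)"
    by (rule arc_move(1)[OF c P(1,2) l k(1,3)]) (rule H1 H2 H3; assumption)+
  moreover have "succ_map (split_off V r) (Z - satur r) z = swap x (\<phi> l) (\<phi> z)" if "z \<in> Omega" for z
    by (rule arc_move(2)[OF c P(1,2) l k(1,3) _ _ _ that]) (rule H1 H2 H3; assumption)+
  ultimately show ?thesis unfolding pl by blast
qed

text \<open>\<open>F\<close> stands for the coordinates of a vector that is fixed by the shorter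
  prefix and lies outside the hyperplane of the reflection. It excludes the exchanges that would
  join two cycles of weight 1, for there the return of \<open>x\<close> would give
  \<open>F x = F y\<close>.\<close>

lemma refl_below:
  assumes x: "x \<in> Omega" and y: "y \<in> Omega" and xy: "y / x \<notin> mu e"
    and F: "\<And>\<omega> z. \<omega> \<in> mu e \<Longrightarrow> z \<in> Omega \<Longrightarrow> F (\<omega> * z) = \<omega> * (F z :: complex)"
    and Ff: "\<And>z. z \<in> Omega \<Longrightarrow> F (swap x y (\<phi> z)) = F z" and Fxy: "F x \<noteq> F y"
  shows "\<exists>V' Z'. config V' Z' \<and> (\<forall>z\<in>Omega. succ_map V' Z' z = swap x y (\<phi> z))"
proof -
  \<comment> \<open>Before the first visit to one of the two orbits the exchange does nothing, so
    \<open>F\<close> is constant; at that visit the exchange relates \<open>F x\<close> to a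
    multiple of \<open>F y\<close> or of itself.\<close>
  have ret: "\<exists>m>0. (\<forall>i. 0 < i \<and> i < m \<longrightarrow> (\<phi> ^^ i) x / x \<notin> mu e \<and> (\<phi> ^^ i) x / y \<notin> mu e) \<and>
     (\<exists>\<omega>\<in>mu e. ((\<phi> ^^ m) x = \<omega> * x \<and> F x = \<omega> * F y) \<or> ((\<phi> ^^ m) x = \<omega> * y \<and> F x = \<omega> * F x))"
    if x: "x \<in> Omega" and y: "y \<in> Omega" and xy: "y / x \<notin> mu e"
      and Ff: "\<And>z. z \<in> Omega \<Longrightarrow> F (swap x y (\<phi> z)) = F z" for x y
  proof -
    have x0: "x \<noteq> 0" and y0: "y \<noteq> 0" using Omega_nz x y by auto
    let ?Q = "\<lambda>i. 0 < i \<and> ((\<phi> ^^ i) x / x \<in> mu e \<or> (\<phi> ^^ i) x / y \<in> mu e)"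
    obtain m0 where "0 < m0" "(\<phi> ^^ m0) x = x" using it_return[OF x] by auto
    then have "?Q m0" using x0 by (simp add: mu_one)
    define m where "m = (LEAST i. ?Q i)"
    have m: "?Q m" unfolding m_def by (rule LeastI[of ?Q]) fact
    have ml: "(\<phi> ^^ i) x / x \<notin> mu e \<and> (\<phi> ^^ i) x / y \<notin> mu e" if "0 < i" "i < m" for i
      using not_less_Least[of i ?Q] that unfolding m_def by auto
    have Fi: "F ((\<phi> ^^ i) x) = F x" if "i < m" for i
      using that
    proof (induction i)
      case (Suc i)
      have "F ((\<phi> ^^ i) x) = F (swap x y ((\<phi> ^^ Suc i) x))" using Ff[OF it_Omega[OF x, of i]]
        by simp
      also have "swap x y ((\<phi> ^^ Suc i) x) = (\<phi> ^^ Suc i) x" using ml[of "Suc i"] Suc.prems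
        by (intro swap_id) auto
      finally show ?case using Suc by simp
    qed simp
    have Fm: "F x = F (swap x y ((\<phi> ^^ m) x))"
      using Fi[of "m - 1"] Ff[OF it_Omega[OF x, of "m - 1"]] m by (cases m) auto
    have "\<exists>\<omega>\<in>mu e. ((\<phi> ^^ m) x = \<omega> * x \<and> F x = \<omega> * F y) \<or> ((\<phi> ^^ m) x = \<omega> * y \<and> F x = \<omega> * F x)"
    proof (cases "(\<phi> ^^ m) x / x \<in> mu e")
      case True
      then obtain \<omega> where w: "\<omega> \<in> mu e" "(\<phi> ^^ m) x = \<omega> * x" using Omega_unit[OF x] by blast
      have "F x = \<omega> * F y" using Fm w swap_rot[OF w(1)] swap_left[OF x0] F[OF w(1) y] by simp
      then show ?thesis using w by auto
    next
      case False
      then obtain \<omega> where w: "\<omega> \<in> mu e" "(\<phi> ^^ m) x = \<omega> * y" using Omega_unit[OF y] m by blast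
      have "F x = \<omega> * F x" using Fm w swap_rot[OF w(1)] swap_right[OF x0 y0 xy] F[OF w(1) x] by simp
      then show ?thesis using w by auto
    qed
    then show ?thesis using m ml by blast
  qed
  have x0: "x \<noteq> 0" and y0: "y \<noteq> 0" using Omega_nz x y by auto
  have yx: "x / y \<notin> mu e" using xy unit_div_sym by blast
  have ss: "swap y x = swap x y" using swap_sym[OF x0 y0 xy] by auto
  \<comment> \<open>If the path from \<open>x\<close> to \<open>y\<close> meets the circle of radius
    2, then \<open>Z\<close> is asymmetric and all weights are 1. So the cycle closes up and meets
    that circle once, and the path from \<open>y\<close> back to \<open>x\<close> can be split off
    instead; \<open>swap\<close> is symmetric in the two points.\<close>
  have cross: "\<exists>V' Z'. config V' Z' \<and> (\<forall>z\<in>Omega. succ_map V' Z' z = swap x y (\<phi> z))"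
    if x: "x \<in> Omega" and y: "y \<in> Omega" and xy: "y / x \<notin> mu e"
      and Ff: "\<And>z. z \<in> Omega \<Longrightarrow> F (swap x y (\<phi> z)) = F z"
      and m: "0 < m" "(\<phi> ^^ m) x = y" and fst: "\<And>i. 0 < i \<Longrightarrow> i < m \<Longrightarrow> (\<phi> ^^ i) x / x \<notin> mu e \<and>
        (\<phi> ^^ i) x / y \<notin> mu e" for x y m
  proof (cases "\<forall>i<m. (\<phi> ^^ i) x \<in> mu N")
    case True
    then show ?thesis using path_move[OF x y xy m fst] by blast
  next
    case False
    then obtain i0 where i0: "i0 < m" "(\<phi> ^^ i0) x \<notin> mu N" by auto
    have x0: "x \<noteq> 0" and y0: "y \<noteq> 0" using Omega_nz x y by auto
    have yx: "x / y \<notin> mu e" using xy unit_div_sym by blast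
    have ss: "swap y x z = swap x y z" for z using swap_sym[OF x0 y0 xy] by auto
    have as: "Z \<noteq> {} \<and> 0 \<notin> convex hull Z"
    proof (rule ccontr)
      assume na: "\<not> ?thesis"
      have "(\<phi> ^^ i) x \<in> mu N \<longleftrightarrow> x \<in> mu N" for i
        by (induction i) (auto simp: succ_map_mu_N[OF c na it_Omega[OF x]])
      then have "x \<notin> mu N" "y \<notin> mu N" using i0 m(2) by blast+
      then have "x / 2 \<in> mu e" "y / 2 \<in> mu e" using Omega_cases x y by blast+
      then have "(y / 2) / (x / 2) \<in> mu e" using mu_divide by blast
      then show False using xy by simp
    qed
    have one: "\<omega> = 1" if "\<omega> \<in> mu e" "(\<phi> ^^ k) x = \<omega> * x" for \<omega> k
      using weight_one[OF x _ that] as by auto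
    obtain m' \<omega> where m': "0 < m'" "\<And>i. 0 < i \<Longrightarrow> i < m' \<Longrightarrow> (\<phi> ^^ i) y / y \<notin> mu e \<and>
      (\<phi> ^^ i) y / x \<notin> mu e"
      and w: "\<omega> \<in> mu e" "(\<phi> ^^ m') y = \<omega> * y \<or> (\<phi> ^^ m') y = \<omega> * x"
      using ret[OF y x yx] Ff ss by auto
    have yx': "(\<phi> ^^ i) y = (\<phi> ^^ (i + m)) x" for i using m(2) by (simp add: it_add)
    have bk: "(\<phi> ^^ m') y = x"
      using w(2)
    proof
      assume "(\<phi> ^^ m') y = \<omega> * x"
      then show ?thesis using one[OF w(1), of "m' + m"] yx' by simp
    next
      assume "(\<phi> ^^ m') y = \<omega> * y"
      then have "(\<phi> ^^ (m' + m)) x = \<omega> * (\<phi> ^^ m) x" using yx'[of m'] m(2) by simp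
      then have wx: "(\<phi> ^^ m') x = \<omega> * x" using it_cancel[OF x _ w(1), of m "m' + m"] by simp
      then have "\<omega> = 1" using one w by blast
      then have mx: "(\<phi> ^^ m') x = x" using wx by simp
      consider "m' < m" | "m' = m" | "m < m'" by linarith
      then show ?thesis
      proof cases
        case 1 then show ?thesis using fst[OF m'(1)] mx x0 by (simp add: mu_one)
      next
        case 2 then show ?thesis using mx m xy x0 by (simp add: mu_one)
      next
        case 3
        then have "(\<phi> ^^ (m' - m)) y = x" using yx'[of "m' - m"] mx by simp
        then show ?thesis using m'(2)[of "m' - m"] 3 m x0 by (simp add: mu_one)
      qed
    qed
    \<comment> \<open>A second point of radius 2 would be a multiple of the first and, as weights
      are 1, equal to it. The cycle would then be too short for the two paths.\<close>
    have "(\<phi> ^^ j) y \<in> mu N" if j: "j < m'" for j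
    proof (rule ccontr)
      assume jn: "(\<phi> ^^ j) y \<notin> mu N"
      define \<beta> \<gamma> where "\<beta> = (\<phi> ^^ i0) x / 2" and "\<gamma> = (\<phi> ^^ (j + m)) x / 2"
      have bg: "\<beta> \<in> mu e" "\<gamma> \<in> mu e"
        using Omega_cases[OF it_Omega[OF x, of i0]] Omega_cases[OF it_Omega[OF y, of j]] i0 jn
          unfolding \<beta>_def \<gamma>_def yx' by auto
      have b0: "\<beta> \<noteq> 0" using mu_e_nz bg by auto
      have "(\<phi> ^^ (j + m)) x = \<gamma> / \<beta> * (\<phi> ^^ i0) x" using b0 by (simp add: \<beta>_def \<gamma>_def)
      then have d: "(\<phi> ^^ (j + m - i0)) x = \<gamma> / \<beta> * x"
        using it_cancel[OF x _ mu_divide[OF bg(2,1)], of i0 "j + m"] i0 by simp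
      then have "\<gamma> / \<beta> = 1" using one[OF mu_divide[OF bg(2,1)]] by blast
      then have dx: "(\<phi> ^^ (j + m - i0)) x = x" using d by simp
      consider "j + m - i0 < m" | "j + m - i0 = m" | "m < j + m - i0" by linarith
      then show False
      proof cases
        case 1 then show ?thesis using fst[of "j + m - i0"] i0 dx x0 by (simp add: mu_one)
      next
        case 2 then show ?thesis using dx m xy x0 by (simp add: mu_one)
      next
        case 3
        then have "(\<phi> ^^ (j - i0)) y = x" using yx'[of "j - i0"] dx by simp
        moreover have "0 < j - i0" "j - i0 < m'" using 3 j by auto
        ultimately show ?thesis using m'(2)[of "j - i0"] x0 by (simp add: mu_one)
      qed
    qed
    then show ?thesis using path_move[OF y x yx m'(1) bk m'(2)] unfolding ss by blast
  qed
  obtain mx \<omega>x where mx: "0 < mx" "\<And>i. 0 < i \<Longrightarrow> i < mx \<Longrightarrow> (\<phi> ^^ i) x / x \<notin> mu e \<and>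
    (\<phi> ^^ i) x / y \<notin> mu e"
    and wx: "\<omega>x \<in> mu e" "((\<phi> ^^ mx) x = \<omega>x * x \<and> F x = \<omega>x * F y) \<or> ((\<phi> ^^ mx) x = \<omega>x * y \<and>
      F x = \<omega>x * F x)"
    using ret[OF x y xy Ff] by auto
  obtain my \<omega>y where my: "0 < my" "\<And>i. 0 < i \<Longrightarrow> i < my \<Longrightarrow> (\<phi> ^^ i) y / y \<notin> mu e \<and>
    (\<phi> ^^ i) y / x \<notin> mu e"
    and wy: "\<omega>y \<in> mu e" "((\<phi> ^^ my) y = \<omega>y * y \<and> F y = \<omega>y * F x) \<or> ((\<phi> ^^ my) y = \<omega>y * x \<and>
      F y = \<omega>y * F y)"
    using ret[OF y x yx] Ff ss by auto
  \<comment> \<open>A point that reaches the other orbit with a weight other than 1 has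
    \<open>F\<close> equal to 0. Together with the other return this would make both values 0, so
    both points return to their own orbits; a weight 1 there would mean
    \<open>F x = F y\<close>.\<close>
  consider (xy) "(\<phi> ^^ mx) x = y" | (yx) "(\<phi> ^^ my) y = x"
    | (self) "(\<phi> ^^ mx) x = \<omega>x * x" "F x = \<omega>x * F y" "(\<phi> ^^ my) y = \<omega>y * y" "F y = \<omega>y * F x" "\<omega>x \<noteq>
      1" "\<omega>y \<noteq> 1"
  proof -
    have z: "\<omega> = 1 \<or> a = 0" if "a = \<omega> * a" for a \<omega> :: complex using that
      by (metis mult_cancel_right2)
    show thesis
    proof (cases "(\<phi> ^^ mx) x = y \<or> (\<phi> ^^ my) y = x")
      case True
      then show ?thesis using that(1,2) by blast
    next
      case False
      have x: "(\<phi> ^^ mx) x = \<omega>x * x \<and> F x = \<omega>x * F y \<or> F x = 0" using wx(2) z[of "F x" \<omega>x] False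
        by auto
      have y: "(\<phi> ^^ my) y = \<omega>y * y \<and> F y = \<omega>y * F x \<or> F y = 0" using wy(2) z[of "F y" \<omega>y] False
        by auto
      have "F x \<noteq> 0" using y Fxy by auto
      moreover have "F y \<noteq> 0" using x Fxy by auto
      ultimately show ?thesis using that(3) x y Fxy by (metis mult_1)
    qed
  qed
  then show ?thesis
  proof cases
    case xy
    then show ?thesis using cross[OF x y _ Ff mx(1) xy mx(2)] assms(3) by blast
  next
    case yx
    have "\<And>z. z \<in> Omega \<Longrightarrow> F (swap y x (\<phi> z)) = F z" using Ff ss by simp
    then show ?thesis using cross[OF y x _ _ my(1) yx my(2)] \<open>x / y \<notin> mu e\<close> unfolding ss by blast
  next
    case self
    have h: "0 \<in> convex hull Z" and xZ: "x \<notin> mu N \<or> x \<in> Z"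
      using weight_one[OF x _ wx(1) self(1)] self(5) by auto
    have yZ: "y \<notin> mu N \<or> y \<in> Z" using weight_one[OF y _ wy(1) self(3)] self(6) by auto
    have Zv: "Z \<in> V" using h part_of_config by auto
    \<comment> \<open>Rescaling by \<open>x / 2\<close> brings the exchange into the form of
      \<open>window_move\<close>, with the window that starts at \<open>\<beta> * y\<close>.\<close>
    have join: "\<exists>V' Z'. config V' Z' \<and> (\<forall>z\<in>Omega. succ_map V' Z' z = swap x y (\<phi> z))"
      if x: "x \<in> Omega" "x \<notin> mu N" and y: "y \<in> Z" for x y
    proof -
      have x2: "x / 2 \<in> mu e" using Omega_cases x by blast
      define \<beta> where "\<beta> = inverse (zeta e) * inverse (x / 2)"
      have b: "\<beta> \<in> mu e" unfolding \<beta>_def by (intro mu_mult mu_inverse zeta_mu x2)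
      have xnz: "x \<noteq> 0" using Omega_nz x by auto
      have s: "\<beta> * y \<in> Z" using sym_nc_long_rot[OF sym_nc_of_config Zv h b] rot_mem[OF b, of y Z]
        y by simp
      have "swap x y = swap 2 (zeta e * (\<beta> * y))"
      proof
        fix z
        have "zeta e * (\<beta> * y) = y / (x / 2)" by (simp add: \<beta>_def field_simps)
        then show "swap x y z = swap 2 (zeta e * (\<beta> * y)) z"
          using swap_scale[OF x2, of 2 "y / (x / 2)" z] xnz by simp
      qed
      then show ?thesis using window_move[OF c h s refl refl] by fastforce
    qed
    \<comment> \<open>If both were in \<open>Z\<close>, the walk along \<open>Z\<close> from
      \<open>x\<close> would meet the orbit of \<open>y\<close> within fewer than \<open>n\<close>
      positions, and the orbit of \<open>x\<close> has no second point there.\<close>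
    have "x \<notin> mu N \<or> y \<notin> mu N"
    proof (rule ccontr)
      assume "\<not> ?thesis"
      then have xZ: "x \<in> Z" "x \<in> mu N" and yZ: "y \<in> Z" "y \<in> mu N" using xZ yZ by auto
      obtain \<omega> t where w: "\<omega> \<in> mu e" "t < n" "y = \<omega> * (x * \<zeta> ^ t)"
        using window_rep[OF xZ(2) yZ(2)] by auto
      have tZ: "x * \<zeta> ^ t \<in> Z" using sym_nc_long_rot[OF sym_nc_of_config Zv h w(1)]
        rot_mem[OF w(1), of "x * \<zeta> ^ t" Z] yZ w by simp
      obtain i where i: "(nxt_in Z ^^ i) x = x * \<zeta> ^ t"
        "\<forall>i'\<le>i. \<exists>t'\<le>t. (nxt_in Z ^^ i') x = x * \<zeta> ^ t' \<and> (0 < i' \<longrightarrow> 0 < t')"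
          using nxt_in_iter_reach[OF xZ(1) tZ] by blast
      have eq: "(\<phi> ^^ j) x = (nxt_in Z ^^ j) x \<and> (nxt_in Z ^^ j) x \<in> Z" for j
      proof (induction j)
        case (Suc j)
        have "\<phi> z = nxt_in Z z" if "z \<in> Z" for z
          using that h psucc_eq[OF sym_nc_of_config Zv] sym_nc_sub[OF sym_nc_of_config Zv]
            by (auto simp: succ_map_def)
        then show ?case using Suc nxt_in_in by simp
      qed (use xZ in simp)
      have "(\<phi> ^^ i) x / y = inverse \<omega>" using i(1) eq[of i] w y0 Omega_nz x mu_e_nz[OF w(1)]
        by (simp add: field_simps)
      then have "(\<phi> ^^ i) x / y \<in> mu e" using mu_inverse[OF w(1)] by simp
      moreover have "i \<noteq> 0"
      proof
        assume "i = 0" then show False using \<open>(\<phi> ^^ i) x / y \<in> mu e\<close> yx by simp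
      qed
      ultimately have "mx \<le> i" using mx(2)[of i] by (metis gr0I not_le)
      then obtain t' where t': "t' \<le> t" "(nxt_in Z ^^ mx) x = x * \<zeta> ^ t'" "0 < t'"
        using i(2) mx(1) by blast
      then have "x * \<zeta> ^ t' = \<omega>x * (x * \<zeta> ^ 0)" using self(1) eq[of mx] by simp
      then show False using window_unique(2)[OF xZ(2) wx(1), of t' 0] t' w(2) by simp
    qed
    moreover have "x \<in> mu N \<or> y \<in> mu N"
    proof (rule ccontr)
      assume "\<not> ?thesis"
      then have "x / 2 \<in> mu e" "y / 2 \<in> mu e" using Omega_cases x y by blast+
      then have "(y / 2) / (x / 2) \<in> mu e" using mu_divide by blast
      then show False using xy by simp
    qed
    ultimately show ?thesis using join[OF x _, of y] join[OF y _, of x] xZ yZ unfolding ss by blast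
  qed
qed

end

section \<open>Chains of configurations\<close>

definition move :: "complex set set \<Rightarrow> complex set \<Rightarrow> complex set set \<Rightarrow> complex set \<Rightarrow> bool" where
  "move V Z V' Z' \<longleftrightarrow> config V' Z' \<and> rank V Z + e \<le> rank V' Z' \<and>
     (\<exists>x\<in>Omega. \<exists>y\<in>Omega. y / x \<notin> mu e \<and> (\<forall>z\<in>Omega. succ_map V' Z' z = swap x y (succ_map V Z z)))"

definition refines :: "complex set set \<Rightarrow> complex set \<Rightarrow> complex set set \<Rightarrow> complex set \<Rightarrow> bool" where
  "refines U Y V Z \<longleftrightarrow> (\<forall>q\<in>U. \<exists>p\<in>V. q \<subseteq> p) \<and> Y \<subseteq> Z"

text \<open>\<open>k\<close> is the width of \<open>r\<close>, counted in positions from its first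
  point \<open>a\<close> to its last one; \<open>refining_step\<close> minimises it.\<close>

definition spans :: "complex set \<Rightarrow> complex \<Rightarrow> nat \<Rightarrow> bool" where
  "spans r a k \<longleftrightarrow> a \<in> r \<and> a * \<zeta> ^ k \<in> r \<and> k < n \<and> r \<subseteq> {a * \<zeta> ^ i | i. i \<le> k}"

lemma spans_ex:
  assumes f: "r \<noteq> {}" "f \<in> mu N" "r \<subseteq> {f * \<zeta> ^ i | i. s \<le> i \<and> i < t}" and t: "t \<le> n + s"
  shows "\<exists>a k. spans r a k \<and> k < t - s"
proof -
  have f0: "f \<noteq> 0" using f mu_N_nz by auto
  define I where "I = {i. s \<le> i \<and> i < t \<and> f * \<zeta> ^ i \<in> r}"
  have fin: "finite I" unfolding I_def by simp
  have ne: "I \<noteq> {}" using f unfolding I_def by blast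
  have I: "s \<le> i" "i < t" "f * \<zeta> ^ i \<in> r" if "i \<in> I" for i using that by (auto simp: I_def)
  have mn: "Min I \<in> I" "Max I \<in> I" using fin ne by auto
  have le: "Min I \<le> Max I" using mn fin by auto
  define a where "a = f * \<zeta> ^ Min I"
  have e: "f * \<zeta> ^ i = a * \<zeta> ^ (i - Min I)" if "Min I \<le> i" for i
    using that by (simp add: a_def mult.assoc flip: power_add)
  have "spans r a (Max I - Min I)" unfolding spans_def
  proof (intro conjI)
    show "a \<in> r" "a * \<zeta> ^ (Max I - Min I) \<in> r" using I(3)[OF mn(1)] I(3)[OF mn(2)] e[OF le]
      by (simp_all only: a_def)
    show "Max I - Min I < n" using I(2)[OF mn(2)] I(1)[OF mn(1)] n1 t by linarith
    show "r \<subseteq> {a * \<zeta> ^ i | i. i \<le> Max I - Min I}"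
    proof
      fix z assume z: "z \<in> r"
      then obtain i where i: "s \<le> i" "i < t" "z = f * \<zeta> ^ i" using f by auto
      then have "i \<in> I" using z by (auto simp: I_def)
      then have "Min I \<le> i" "i \<le> Max I" using fin by auto
      then show "z \<in> {a * \<zeta> ^ i | i. i \<le> Max I - Min I}" using e[of i] i
        by (intro CollectI exI[of _ "i - Min I"]) auto
    qed
  qed
  moreover have "Max I - Min I < t - s" using I(2)[OF mn(2)] I(1)[OF mn(1)] le by linarith
  ultimately show ?thesis by blast
qed

lemma sym_nc_spans: assumes "sym_nc U" "r \<in> U" "0 \<notin> convex hull r" shows "\<exists>a k. spans r a k"
proof -
  obtain f where f: "f \<in> r" "r \<subseteq> {f * \<zeta> ^ i | i. i < n}" using sym_nc_window[OF assms] by auto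
  show ?thesis using spans_ex[of r f 0 n] f sym_nc_sub[OF assms(1,2)] by auto
qed

text \<open>Derives the hypotheses of \<open>arc_move\<close> on \<open>succ_map\<close> from the
  shape of \<open>r\<close>. By \<open>NE\<close> either something of \<open>P\<close> is left over,
  or \<open>P\<close> is a rotation of an asymmetric \<open>Z\<close> and the move may detach
  \<open>0\<close>.\<close>

lemma arc_part_move:
  assumes c: "config V Z" and P: "P \<in> V" and spans: "spans r a k"
    and r: "r = {z \<in> P. \<exists>i\<le>k. z = a * \<zeta> ^ i}"
    and H1: "\<And>z \<omega>. z \<in> r \<Longrightarrow> \<omega> \<in> mu e \<Longrightarrow> \<omega> * z \<in> r \<Longrightarrow> \<omega> = 1"
    and NE: "P - satur r \<noteq> {} \<or> (Z \<noteq> {} \<and> 0 \<notin> convex hull Z \<and> (\<exists>\<omega>\<in>mu e. P = rot \<omega> Z))"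
  shows "move V Z (split_off V r) (Z - satur r)"
proof -
  have V: "sym_nc V" and ZV: "Z = {} \<or> Z \<in> V" using c by (auto simp: config_def)
  define l where "l = a * \<zeta> ^ k"
  have ar: "a \<in> r" and lr: "l \<in> r" and kn: "k < n" using spans by (auto simp: spans_def l_def)
  have rP: "r \<subseteq> P" and aP: "a \<in> P" and lP: "l \<in> P" using ar lr unfolding r by auto
  have PN: "P \<subseteq> mu N" using sym_nc_sub[OF V P] .
  have aN: "a \<in> mu N" and lN: "l \<in> mu N" using aP lP PN by auto
  have a0: "a \<noteq> 0" using aN mu_N_nz by auto
  have kN: "k < N" using kn n_less_N by simp
  have sN: "satur r \<subseteq> mu N" using rP PN mu_N_rot unfolding satur_def by blast
  define f where "f = first_pt Z"
  have fp: "f \<in> Z" "Z \<subseteq> {f * \<zeta> ^ i | i. i < n}" "f \<in> mu N" "f \<noteq> 0" if "Z \<noteq> {} \<and> 0 \<notin> convex hull Z"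
    using first_props[OF c, folded f_def] that mu_N_nz by auto
  have succ_map: "succ_map V Z z = (if Z \<noteq> {} \<and> 0 \<notin> convex hull Z \<and>
    psucc V z / f \<in> mu e then 2 * (psucc V z / f) else psucc V z)"
    if z: "z \<in> mu N" for z
    unfolding succ_map_mu[OF z] f_def[symmetric] using two_not_unit(1)[OF psucc_mu[OF V z]]
      by (auto simp: swap_def)
  have H2: "succ_map V Z z \<in> r" if z: "z \<in> r" "z \<noteq> l" for z
  proof -
    obtain i where i: "i \<le> k" "z = a * \<zeta> ^ i" using z unfolding r by auto
    have ik: "i < k" using i z l_def by (cases "i = k") auto
    have zP: "z \<in> P" using z rP by auto
    obtain j where j: "0 < j" "nxt_in P z = z * \<zeta> ^ j" "z * \<zeta> ^ j \<in> P" "\<forall>i. 0 < i \<and>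
      i < j \<longrightarrow> z * \<zeta> ^ i \<notin> P"
      using nxt_in_ex[OF zP] by auto
    have "z * \<zeta> ^ (k - i) = l" using i by (simp add: l_def mult.assoc flip: power_add)
    then have "\<not> k - i < j" using j(4) lP ik by auto
    then have ijk: "i + j \<le> k" using ik by simp
    have s: "psucc V z = a * \<zeta> ^ (i + j)" using psucc_eq[OF V P zP] j i
      by (simp add: power_add mult.assoc)
    have sr: "psucc V z \<in> r" using s ijk j(3) psucc_in[OF V P zP] unfolding r by auto
    \<comment> \<open>Otherwise the successor of \<open>z\<close> is the first point of the window
      containing \<open>P\<close>; but it comes after \<open>a\<close>, which is in the same
      window.\<close>
    have "psucc V z / f \<notin> mu e" if as: "Z \<noteq> {} \<and> 0 \<notin> convex hull Z"
    proof
      assume *: "psucc V z / f \<in> mu e"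
      define \<omega> where "\<omega> = psucc V z / f"
      have w: "\<omega> \<in> mu e" "psucc V z = \<omega> * f" using * fp[OF as] by (auto simp: \<omega>_def)
      have Zv: "Z \<in> V" using ZV as by auto
      have "psucc V z \<in> rot \<omega> Z" using w rot_mem fp[OF as] by auto
      then have PZ: "P = rot \<omega> Z" using sym_nc_eq[OF V P sym_nc_rot[OF V w(1) Zv]] sr rP by auto
      then obtain t where t: "t < n" "a = \<omega> * (f * \<zeta> ^ t)" using aP fp(2)[OF as]
        by (auto simp: rot_def)
      have "\<omega> * f * \<zeta> ^ (t + (i + j)) = a * \<zeta> ^ (i + j)" unfolding t(2)
        by (simp add: power_add mult_ac)
      also have "\<dots> = \<omega> * f * \<zeta> ^ 0" using s w(2) by simp
      finally have "t + (i + j) = 0"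
        by (intro pos_inj[of "\<omega> * f"]) (use mu_e_nz[OF w(1)] fp[OF as] t ijk kn N_ge in auto)
      then show False using j by simp
    qed
    then have ns: "\<not> (Z \<noteq> {} \<and> 0 \<notin> convex hull Z \<and> psucc V z / f \<in> mu e)" by blast
    have "z \<in> mu N" using zP PN by auto
    then have "succ_map V Z z = psucc V z" by (simp only: succ_map ns if_False)
    then show ?thesis using sr by simp
  qed
  have H3: "succ_map V Z l \<notin> satur r"
  proof (cases "P - satur r = {}")
    case False
    have "psucc V l \<notin> satur r"
    proof
      assume bs: "psucc V l \<in> satur r"
      obtain j where j: "0 < j" "nxt_in P l = l * \<zeta> ^ j" "l * \<zeta> ^ j \<in> P" "\<forall>i. 0 < i \<and>
        i < j \<longrightarrow> l * \<zeta> ^ i \<notin> P"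
        using nxt_in_ex[OF lP] by auto
      have b: "psucc V l = a * \<zeta> ^ (k + j)" using psucc_eq[OF V P lP] j
        by (simp add: l_def power_add mult.assoc)
      obtain \<omega> y where w: "\<omega> \<in> mu e" "y \<in> r" "psucc V l = \<omega> * y" using bs unfolding satur_def
        by auto
      obtain s where s: "s \<le> k" "y = a * \<zeta> ^ s" using w(2) unfolding r by auto
      obtain z where z: "z \<in> P" "z \<notin> satur r" using False by auto
      \<comment> \<open>A point of \<open>P\<close> outside the rotations of \<open>r\<close> comes
        after the arc, and so not before \<open>psucc V l\<close>. This bounds the position of that
        successor, which lies beyond the arc and then cannot be a rotated point of it.\<close>
      have after: "k + j \<le> t" if "a * \<zeta> ^ t \<in> P" "a * \<zeta> ^ t \<notin> satur r" for t
      proof -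
        have kt: "k < t"
        proof (rule ccontr)
          assume "\<not> k < t"
          then have "t \<le> k" by simp
          then have "a * \<zeta> ^ t \<in> r" using that(1) unfolding r by blast
          then show False using that satur_incl by auto
        qed
        have "l * \<zeta> ^ (t - k) = a * \<zeta> ^ t" using kt by (simp add: l_def mult.assoc flip: power_add)
        then have "\<not> t - k < j" using j(4) kt that(1) by (metis zero_less_diff)
        then show ?thesis using kt by simp
      qed
      show False
      proof (cases "0 \<in> convex hull P")
        case True
        have zN: "z \<in> mu N" using z PN by auto
        obtain \<omega>' t where t: "\<omega>' \<in> mu e" "t < n" "z = \<omega>' * (a * \<zeta> ^ t)" using window_rep[OF aN zN]
          by auto
        have "a * \<zeta> ^ t \<in> P" using sym_nc_long_rot[OF V P True t(1)] rot_mem[OF t(1),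
          of "a * \<zeta> ^ t" P] z t(3) by simp
        then have kj: "k + j < n" using after[of t] z t satur_rot[OF t(1)] by auto
        have "a * \<zeta> ^ (k + j) = \<omega> * (a * \<zeta> ^ s)" using b w(3) s(2) by metis
        then have "k + j = s" using window_unique(2)[OF aN w(1) kj] s kn by simp
        then show False using s j by simp
      next
        case short: False
        obtain t where t: "t < N" "z = a * \<zeta> ^ t" using pos_ex[OF aN] z PN by blast
        then have kj: "k + j < N" using after[of t] z by simp
        have "\<omega> = 1" using sym_nc_short[OF V P short w(1), of y] w rP psucc_in[OF V P lP] by auto
        then have "a * \<zeta> ^ (k + j) = a * \<zeta> ^ s" using b w(3) s(2) by (metis mult_1)
        then have "k + j = s" using pos_inj[OF a0 kj, of s] s kN by simp
        then show False using s j by simp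
      qed
    qed
    moreover have "2 * (psucc V l / f) \<notin> satur r" if "psucc V l / f \<in> mu e"
      using two_notin_mu[OF that] sN by auto
    ultimately show ?thesis unfolding succ_map[OF lN] by auto
  next
    case True
    then obtain \<omega> where as: "Z \<noteq> {} \<and> 0 \<notin> convex hull Z" and w: "\<omega> \<in> mu e" "P = rot \<omega> Z" using NE
      by auto
    have short: "0 \<notin> convex hull P" using as w zero_hull_rot by auto
    have Pr: "P = r"
    proof
      show "P \<subseteq> r"
      proof
        fix z assume z: "z \<in> P"
        then obtain \<omega>' y where y: "\<omega>' \<in> mu e" "y \<in> r" "z = \<omega>' * y" using True unfolding satur_def
          by blast
        then have "\<omega>' = 1" using sym_nc_short[OF V P short y(1), of y] rP z by auto
        then show "z \<in> r" using y by simp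
      qed
    qed (rule rP)
    have Pa: "P \<subseteq> {a * \<zeta> ^ i | i. i < n}" using spans kn unfolding spans_def Pr by fastforce
    have "nxt_in P (a * \<zeta> ^ k) = a"
    proof (subst window_nxt_in(1)[OF Pa aP aN kn])
      show "a * \<zeta> ^ k \<in> P" using lP by (simp add: l_def)
      show "\<forall>i. k < i \<and> i < n \<longrightarrow> a * \<zeta> ^ i \<notin> P"
      proof (intro allI impI)
        fix i assume i: "k < i \<and> i < n"
        show "a * \<zeta> ^ i \<notin> P"
        proof
          assume "a * \<zeta> ^ i \<in> P"
          then have "a * \<zeta> ^ i \<in> r" using Pr by simp
          then obtain i' where "i' \<le> k" "a * \<zeta> ^ i = a * \<zeta> ^ i'" unfolding r by blast
          then show False using pos_inj[OF a0, of i i'] i kN n_less_N by simp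
        qed
      qed
    qed
    then have b: "psucc V l = a" using psucc_eq[OF V P lP] by (simp add: l_def)
    have "\<omega> * f \<in> P" using w rot_mem fp[OF as] by auto
    moreover have "P \<subseteq> {\<omega> * f * \<zeta> ^ i | i. i < n}" using fp(2)[OF as] w
      by (auto simp: rot_def mult.assoc)
    ultimately have "first_pt P = \<omega> * f" using first_eq mu_N_rot[OF w(1) fp(3)[OF as]] by blast
    moreover have "first_pt P = a" using first_eq[OF aP Pa aN] .
    ultimately have "psucc V l / f = \<omega>" using b fp[OF as] by simp
    then have "succ_map V Z l = 2 * \<omega>" using succ_map[OF lN] as w by simp
    then show ?thesis using two_notin_mu[OF w(1)] sN by auto
  qed
  have l': "l = a * \<zeta> ^ k" by (simp add: l_def)
  note H = arc_move[OF c P aP l' lP kN r]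
  have "config (split_off V r) (Z - satur r)" by (rule H(1)) (rule H1 H2 H3; assumption)+
  moreover have "rank V Z + e \<le> rank (split_off V r) (Z - satur r)"
    by (rule H(3)) (rule H1 H2 H3; assumption)+
  moreover have "succ_map (split_off V r) (Z - satur r) z = swap a (succ_map V Z l) (succ_map V Z
    z)" if "z \<in> Omega" for z
    by (rule H(2)[OF _ _ _ that]) (rule H1 H2 H3; assumption)+
  moreover have "succ_map V Z l / a \<notin> mu e" by (rule H(4)) (rule H1 H2 H3; assumption)+
  ultimately show ?thesis unfolding move_def
    using mu_N_Omega[OF aN] succ_map_Omega[OF c mu_N_Omega[OF lN]] by blast
qed

text \<open>A part of \<open>U\<close> that meets a rotation of \<open>r\<close> equals that
  rotation, so all other parts of \<open>U\<close> survive the removal of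
  \<open>satur r\<close>.\<close>

lemma refines_split:
  assumes d: "config U Y" and r: "r \<in> U" and ref: "refines U Y V Z"
    and Y: "\<And>\<omega>. \<omega> \<in> mu e \<Longrightarrow> Y \<noteq> rot \<omega> r"
  shows "refines U Y (split_off V r) (Z - satur r)"
proof -
  have U: "sym_nc U" and YU: "Y = {} \<or> Y \<in> U" using d by (auto simp: config_def)
  have meet: "\<exists>\<omega>\<in>mu e. q = rot \<omega> r" if q: "q \<in> U" "z \<in> q" "z \<in> satur r" for q z
  proof -
    obtain \<omega> where w: "\<omega> \<in> mu e" "z \<in> rot \<omega> r" using q satur_alt by auto
    then show ?thesis using sym_nc_eq[OF U q(1) sym_nc_rot[OF U w(1) r] q(2)] by blast
  qed
  have "\<exists>p\<in>split_off V r. q \<subseteq> p" if q: "q \<in> U" for q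
  proof (cases "q \<inter> satur r = {}")
    case True
    obtain p where p: "p \<in> V" "q \<subseteq> p" using ref q unfolding refines_def by auto
    then have "q \<subseteq> p - satur r" "p - satur r \<noteq> {}" using True sym_nc_ne[OF U q] by auto
    then show ?thesis using p by (auto simp: split_off_def)
  next
    case False
    then show ?thesis using meet[OF q] by (auto simp: split_off_def)
  qed
  moreover have "Y \<inter> satur r = {}"
  proof (rule ccontr)
    assume "Y \<inter> satur r \<noteq> {}"
    then obtain z where z: "z \<in> Y" "z \<in> satur r" by auto
    then have "Y \<in> U" using YU by auto
    then show False using meet[OF _ z] Y by blast
  qed
  ultimately show ?thesis using ref unfolding refines_def by auto
qed

text \<open>The rotations of \<open>r\<close> cover \<open>Z\<close> and \<open>r\<close> spans
  fewer than \<open>n\<close> positions, so \<open>r\<close> is exactly the window of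
  \<open>Z\<close> that starts at \<open>a\<close>, as \<open>window_move\<close> requires.\<close>

lemma window_step:
  assumes c: "config V Z" and h: "0 \<in> convex hull Z" and d: "config U Y" and ref: "refines U Y V Z"
    and r: "r \<in> U" and spans: "spans r a k" and Zr: "Z \<subseteq> satur r" "r \<subseteq> Z" and Y: "Y \<subseteq> r"
  shows "\<exists>V' Z'. move V Z V' Z' \<and> refines U Y V' Z'"
proof -
  have U: "sym_nc U" using d by (simp add: config_def)
  have ar: "a \<in> r" and aN: "a \<in> mu N" using spans sym_nc_sub[OF U r] by (auto simp: spans_def)
  have aZ: "a \<in> Z" using ar Zr by auto
  have kn: "k < n" using spans by (simp add: spans_def)
  have W: "r = {z \<in> Z. \<exists>i<n. z = a * \<zeta> ^ i}"
  proof (intro equalityI subsetI)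
    fix z assume z: "z \<in> r"
    then obtain i where "i \<le> k" "z = a * \<zeta> ^ i" using spans by (auto simp: spans_def)
    then show "z \<in> {z \<in> Z. \<exists>i<n. z = a * \<zeta> ^ i}" using z Zr kn by (auto intro!: exI[of _ i])
  next
    fix z assume "z \<in> {z \<in> Z. \<exists>i<n. z = a * \<zeta> ^ i}"
    then obtain i where i: "z \<in> Z" "i < n" "z = a * \<zeta> ^ i" by auto
    then obtain \<omega> y where w: "\<omega> \<in> mu e" "y \<in> r" "z = \<omega> * y" using Zr unfolding satur_def by auto
    obtain j where j: "j \<le> k" "y = a * \<zeta> ^ j" using w spans by (auto simp: spans_def)
    have "a * \<zeta> ^ i = \<omega> * (a * \<zeta> ^ j)" using i w j by metis
    then have "\<omega> = 1" using window_unique(1)[OF aN w(1) i(2), of j] j kn by simp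
    then show "z \<in> r" using w by simp
  qed
  define V' where "V' = (V - {Z}) \<union> {rot \<omega> r | \<omega>. \<omega> \<in> mu e}"
  note wm = window_move[OF c h aZ W V'_def]
  have s: "zeta e * a \<in> Omega" using Omega_rot[OF zeta_mu mu_N_Omega[OF aN]] .
  have "zeta e * a / 2 \<notin> mu e" using two_not_unit(1)[OF mu_N_rot[OF zeta_mu aN]] .
  then have "move V Z V' r" unfolding move_def
    by (intro conjI bexI[of _ 2] bexI[of _ "zeta e * a"] ballI) (use wm s two_Omega[OF mu_one]
      in auto)
  moreover have "refines U Y V' r" unfolding refines_def
  proof (intro conjI ballI)
    fix q assume q: "q \<in> U"
    obtain p where p: "p \<in> V" "q \<subseteq> p" using ref q unfolding refines_def by auto
    show "\<exists>p\<in>V'. q \<subseteq> p"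
    proof (cases "p = Z")
      case True
      obtain z where z: "z \<in> q" using sym_nc_ne[OF U q] by auto
      then have "z \<in> satur r" using p True Zr by auto
      then obtain \<omega> where w: "\<omega> \<in> mu e" "z \<in> rot \<omega> r" using satur_alt by auto
      then have "q = rot \<omega> r" using sym_nc_eq[OF U q sym_nc_rot[OF U w(1) r] z] by blast
      then show ?thesis using w by (auto simp: V'_def)
    qed (use p in \<open>auto simp: V'_def\<close>)
  qed (rule Y)
  ultimately show ?thesis by blast
qed

text \<open>Among the parts of \<open>U\<close> that are not parts of \<open>V\<close>, one of minimal width is an arc of the part
  of \<open>V\<close> that contains it.\<close>

lemma refining_step:
  assumes c: "config V Z" and d: "config U Y" and ref: "refines U Y V Z" and ne: "\<not> (U = V \<and> Y = Z)"
  shows "\<exists>V' Z'. move V Z V' Z' \<and> refines U Y V' Z'"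
proof -
  have V: "sym_nc V" and ZV: "Z = {} \<or> Z \<in> V" using c by (auto simp: config_def)
  have U: "sym_nc U" and YU: "Y = {} \<or> Y \<in> U" using d by (auto simp: config_def)
  have YZ: "Y \<subseteq> Z" using ref by (simp add: refines_def)
  have into: "q \<subseteq> p" if q: "q \<in> U" "p \<in> V" "z \<in> q" "z \<in> p" for q p z
  proof -
    obtain p' where p': "p' \<in> V" "q \<subseteq> p'" using ref q unfolding refines_def by auto
    then show ?thesis using sym_nc_eq[OF V p'(1) q(2), of z] q by auto
  qed
  \<comment> \<open>The candidates for an arc. Rotations of \<open>Y\<close> are left out because
    \<open>0\<close> has to remain attached to \<open>Y\<close>; a long part of \<open>U\<close>
    could only be \<open>Y\<close>.\<close>
  define C where "C = {r \<in> U. r \<notin> V \<and> 0 \<notin> convex hull r \<and> (\<forall>\<omega>\<in>mu e. r \<noteq> rot \<omega> Y)}"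
  show ?thesis
  proof (cases "U = V")
    case True
    then have YneZ: "Y \<noteq> Z" using ne by auto
    have as: "Z \<noteq> {} \<and> 0 \<notin> convex hull Z"
    proof (rule ccontr)
      assume "\<not> ?thesis"
      then have "0 \<in> convex hull Z" using YZ YneZ by auto
      moreover have "Z \<in> U" using ZV True \<open>0 \<in> convex hull Z\<close> by auto
      ultimately show False using config_long[OF d] YneZ by auto
    qed
    have Zv: "Z \<in> V" using as ZV by auto
    have Y0: "Y = {}"
    proof (rule ccontr)
      assume "Y \<noteq> {}"
      then obtain z where "z \<in> Y" by auto
      then show False using sym_nc_eq[OF U, of Y Z z] YU YZ YneZ Zv True by auto
    qed
    obtain a k where spans: "spans Z a k" using sym_nc_spans[OF V Zv] as by auto
    have r: "Z = {z \<in> Z. \<exists>i\<le>k. z = a * \<zeta> ^ i}" using spans unfolding spans_def by blast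
    \<comment> \<open>Here only the attachment of \<open>0\<close> differs, so the arc is the whole
      of \<open>Z\<close>.\<close>
    have "move V Z (split_off V Z) (Z - satur Z)"
    proof (rule arc_part_move[OF c Zv spans r])
      show "\<omega> = 1" if "z \<in> Z" "\<omega> \<in> mu e" "\<omega> * z \<in> Z" for z \<omega>
        using sym_nc_short[OF V Zv _ that(2,1,3)] as by auto
      show "Z - satur Z \<noteq> {} \<or> (Z \<noteq> {} \<and> 0 \<notin> convex hull Z \<and> (\<exists>\<omega>\<in>mu e. Z = rot \<omega> Z))"
        using as mu_one by (auto intro!: bexI[of _ 1])
    qed
    moreover have "refines U Y (split_off V Z) (Z - satur Z)"
      by (rule refines_split[OF d _ ref]) (use Zv True as Y0 in \<open>auto simp: eq_commute[of "{}"]\<close>)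
    ultimately show ?thesis by blast
  next
    case UV: False
    show ?thesis
    proof (cases "C = {}")
      case True
      have "\<not> U \<subseteq> V"
      proof
        assume UsubV: "U \<subseteq> V"
        have "V \<subseteq> U"
        proof
          fix p assume p: "p \<in> V"
          then obtain z where z: "z \<in> p" using sym_nc_ne[OF V] by auto
          then obtain q where q: "q \<in> U" "z \<in> q" using sym_nc_ex[OF U] sym_nc_sub[OF V p] by blast
          then have "q = p" using sym_nc_eq[OF V _ p q(2) z] UsubV by auto
          then show "p \<in> U" using q by simp
        qed
        then show False using UsubV UV by auto
      qed
      then obtain r where r: "r \<in> U" "r \<notin> V" by auto
      \<comment> \<open>Without candidates every new part is a rotation of \<open>Y\<close>. So
        \<open>Z\<close> is long and composed of rotations of \<open>Y\<close>, and it is broken up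
        with \<open>Y\<close> as the window.\<close>
      have "\<exists>\<omega>\<in>mu e. r = rot \<omega> Y"
      proof (cases "0 \<in> convex hull r")
        case True
        then have "r = rot 1 Y" using config_long[OF d r(1)] by simp
        then show ?thesis using mu_one by blast
      qed (use r \<open>C = {}\<close> in \<open>auto simp: C_def\<close>)
      then obtain \<omega> where w: "\<omega> \<in> mu e" "r = rot \<omega> Y" by auto
      have Yne: "Y \<noteq> {}" using sym_nc_ne[OF U r(1)] w by auto
      have Yu: "Y \<in> U" using YU Yne by auto
      have Zv: "Z \<in> V" using ZV Yne YZ by auto
      have YV: "Y \<notin> V" using r w sym_nc_rot[OF V w(1)] by auto
      then have "Y \<noteq> Z" using Zv by auto
      have satY: "\<exists>\<omega>\<in>mu e. z \<in> rot \<omega> Y \<and> (rot \<omega> Y \<subseteq> Z)" if z: "z \<in> Z" for z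
      proof -
        obtain q where q: "q \<in> U" "z \<in> q" using sym_nc_ex[OF U] sym_nc_sub[OF V Zv] z by blast
        have qZ: "q \<subseteq> Z" using into[OF q(1) Zv q(2) z] .
        have "q \<noteq> Z"
        proof
          assume "q = Z"
          then show False using sym_nc_eq[OF U q(1) Yu] YZ Yne \<open>Y \<noteq> Z\<close> by blast
        qed
        then have qV: "q \<notin> V" using sym_nc_eq[OF V _ Zv q(2) z] by auto
        show ?thesis
        proof (cases "0 \<in> convex hull q")
          case True
          then have "q = rot 1 Y" using config_long[OF d q(1)] by simp
          then show ?thesis using mu_one q qZ by blast
        next
          case False
          then show ?thesis using qV q \<open>C = {}\<close> qZ unfolding C_def by blast
        qed
      qed
      obtain z where z: "z \<in> Z" "z \<notin> Y" using YZ \<open>Y \<noteq> Z\<close> by auto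
      then obtain \<omega>' where w': "\<omega>' \<in> mu e" "z \<in> rot \<omega>' Y" "rot \<omega>' Y \<subseteq> Z" using satY by blast
      have "\<omega>' \<noteq> 1" using w' z by auto
      have "rot \<omega>' Z = Z"
      proof -
        have "z \<in> rot \<omega>' Z" using w' rot_mono[OF YZ] by auto
        then show ?thesis using sym_nc_eq[OF V sym_nc_rot[OF V w'(1) Zv] Zv] z by auto
      qed
      then have h: "0 \<in> convex hull Z" using zero_hull[OF w'(1) \<open>\<omega>' \<noteq> 1\<close> z(1)] by simp
      have Ys: "0 \<notin> convex hull Y"
      proof
        assume "0 \<in> convex hull Y"
        then have "rot \<omega>' Y = Y" using sym_nc_long_rot[OF U Yu _ w'(1)] by simp
        then show False using w' z by simp
      qed
      obtain a k where spans: "spans Y a k" using sym_nc_spans[OF U Yu Ys] by auto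
      have "Z \<subseteq> satur Y" using satY satur_alt by blast
      then show ?thesis using window_step[OF c h d ref Yu spans _ YZ] by auto
    next
      case False
      let ?Q = "\<lambda>k. \<exists>r\<in>C. \<exists>a. spans r a k"
      have "\<exists>k. ?Q k" using False sym_nc_spans[OF U] unfolding C_def by blast
      define k where "k = (LEAST k. ?Q k)"
      have "?Q k" unfolding k_def by (rule LeastI_ex) fact
      then obtain r a where rC: "r \<in> C" and spans: "spans r a k" by auto
      have kmin: "k \<le> k'" if "r' \<in> C" "spans r' a' k'" for r' a' k'
        unfolding k_def by (rule Least_le) (use that in blast)
      have rU: "r \<in> U" and rV: "r \<notin> V" and rs: "0 \<notin> convex hull r"
        and rY: "\<And>\<omega>. \<omega> \<in> mu e \<Longrightarrow> r \<noteq> rot \<omega> Y"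
        using rC by (auto simp: C_def)
      have ar: "a \<in> r" and lr: "a * \<zeta> ^ k \<in> r" and kn: "k < n"
        and rank: "r \<subseteq> {a * \<zeta> ^ i | i. i \<le> k}"
        using spans by (auto simp: spans_def)
      have aN: "a \<in> mu N" and a0: "a \<noteq> 0" using ar sym_nc_sub[OF U rU] mu_N_nz by auto
      obtain P where P: "P \<in> V" "r \<subseteq> P" using ref rU unfolding refines_def by auto
      have rP: "r \<noteq> P" using rV P by auto
      have arc: "r = {z \<in> P. \<exists>i\<le>k. z = a * \<zeta> ^ i}"
      proof (intro equalityI subsetI)
        fix z assume "z \<in> {z \<in> P. \<exists>i\<le>k. z = a * \<zeta> ^ i}"
        then obtain i where z: "z \<in> P" "i \<le> k" "z = a * \<zeta> ^ i" by auto
        show "z \<in> r"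
        proof (rule ccontr)
          assume zr: "z \<notin> r"
          have ik: "0 < i" "i < k" using z zr ar lr by (auto simp: order_le_less intro: ccontr)
          obtain q where q: "q \<in> U" "z \<in> q" using sym_nc_ex[OF U] sym_nc_sub[OF V P(1)] z(1)
            by blast
          have qP: "q \<subseteq> P" using into[OF q(1) P(1) q(2) z(1)] .
          have qr: "q \<noteq> r" using q zr by auto
          have qneP: "q \<noteq> P" using sym_nc_eq[OF U q(1) rU, of a] P ar qr by auto
          then have qV: "q \<notin> V" using sym_nc_eq[OF V _ P(1) q(2) z(1)] by auto
          have hqr: "convex hull q \<inter> convex hull r = {}" using sym_nc_hull[OF U q(1) rU qr] .
          \<comment> \<open>As \<open>q\<close> does not cross \<open>r\<close>, it is confined
            strictly between the ends of \<open>r\<close>; this makes it a candidate of smaller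
            width.\<close>
          have pos: "\<exists>t. 0 < t \<and> t < k \<and> y = a * \<zeta> ^ t" if y: "y \<in> q" for y
          proof -
            have "y \<in> mu N" using y sym_nc_sub[OF U q(1)] by auto
            then obtain t where t: "t < N" "y = a * \<zeta> ^ t" using pos_ex[OF aN] by blast
            have "y \<notin> r" using y q qr sym_nc_eq[OF U q(1) rU y] by auto
            then have t0: "t \<noteq> 0" "t \<noteq> k" using t ar lr by (auto intro: ccontr)
            have "\<not> k < t"
            proof
              assume kt: "k < t"
              have "convex hull {a, a * \<zeta> ^ k} \<inter> convex hull {a * \<zeta> ^ i, a * \<zeta> ^ t} \<noteq> {}"
                by (rule chords_cross[OF aN ik kt t(1)])
              moreover have "convex hull {a, a * \<zeta> ^ k} \<subseteq> convex hull r" using ar lr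
                by (intro hull_mono) auto
              moreover have "convex hull {a * \<zeta> ^ i, a * \<zeta> ^ t} \<subseteq> convex hull q" using q y z t
                by (intro hull_mono) auto
              ultimately show False using hqr by blast
            qed
            then show ?thesis using t t0 by (intro exI[of _ t]) auto
          qed
          have qs: "0 \<notin> convex hull q"
          proof
            assume "0 \<in> convex hull q"
            then have "zeta e * z \<in> q" using sym_nc_long_rot[OF U q(1) _ zeta_mu]
              rot_mem[OF zeta_mu, of z q] q by simp
            then obtain t where t: "0 < t" "t < k" "zeta e * z = a * \<zeta> ^ t" using pos by auto
            have "a * \<zeta> ^ (i + n) = a * \<zeta> ^ t" using t z by (simp add: zeta_e power_add mult_ac)
            then have "i + n = t" using pos_inj[OF a0, of "i + n" t] ik kn t N_ge by simp
            then show False using t kn by simp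
          qed
          \<comment> \<open>A rotation of \<open>Y\<close> stays clear of \<open>r\<close> even with
            \<open>0\<close> added, whereas the segment from \<open>0\<close> to a point between the
            ends of \<open>r\<close> meets the chord of \<open>r\<close>.\<close>
          have qY: "q \<noteq> rot \<omega> Y" if w: "\<omega> \<in> mu e" for \<omega>
          proof
            assume qe: "q = rot \<omega> Y"
            have wi: "inverse \<omega> \<in> mu e" using mu_inverse[OF w] .
            have rr: "rot (inverse \<omega>) r \<in> U" using sym_nc_rot[OF U wi rU] .
            have "rot (inverse \<omega>) r \<noteq> Y" using rY[OF w] rot_inverse(1)[OF w, of r] by auto
            then have "convex hull (insert 0 Y) \<inter> convex hull (rot (inverse \<omega>) r) = {}" using d rr
              unfolding config_def by blast
            then have dis: "convex hull (insert 0 q) \<inter> convex hull r = {}"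
              using hull_rot_disjoint[OF w, of "insert 0 Y" "rot (inverse \<omega>) r"]
                rot_inverse(1)[OF w] by (simp add: rot_insert0 qe)
            have "convex hull {0, a * \<zeta> ^ i} \<inter> convex hull {a, a * \<zeta> ^ k} \<noteq> {}"
              by (rule chord_meets_ray[OF aN ik kn])
            moreover have "convex hull {a, a * \<zeta> ^ k} \<subseteq> convex hull r" using ar lr
              by (intro hull_mono) auto
            moreover have "convex hull {0, a * \<zeta> ^ i} \<subseteq> convex hull (insert 0 q)" using q z
              by (intro hull_mono) auto
            ultimately show False using dis by blast
          qed
          have qC: "q \<in> C" using q qV qs qY by (auto simp: C_def)
          have "q \<subseteq> {a * \<zeta> ^ i | i. 1 \<le> i \<and> i < k}" using pos by fastforce
          then obtain b k' where "spans q b k'" "k' < k - 1" using spans_ex[of q a 1 k] q aN kn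
            by auto
          then show False using kmin[OF qC] by fastforce
        qed
      qed (use rank P in auto)
      have H1: "\<omega> = 1" if "z \<in> r" "\<omega> \<in> mu e" "\<omega> * z \<in> r" for z \<omega>
        using sym_nc_short[OF U rU rs that(2,1,3)] .
      show ?thesis
      proof (cases "P - satur r = {}")
        case False
        have "move V Z (split_off V r) (Z - satur r)"
          by (rule arc_part_move[OF c P(1) spans arc]) (use H1 False in auto)
        moreover have "refines U Y (split_off V r) (Z - satur r)"
        proof (rule refines_split[OF d rU ref])
          show "Y \<noteq> rot \<omega> r" if w: "\<omega> \<in> mu e" for \<omega>
          proof
            assume "Y = rot \<omega> r"
            then have "r = rot (inverse \<omega>) Y" using rot_inverse(2)[OF w] by simp
            then show False using rY mu_inverse[OF w] by blast
          qed
        qed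
        ultimately show ?thesis by blast
      next
        case True
        \<comment> \<open>A short \<open>P\<close> meets each orbit at most once, so being covered
          by the rotations of \<open>r\<close> it would be equal to \<open>r\<close>.\<close>
        have lg: "0 \<in> convex hull P"
        proof (rule ccontr)
          assume sh: "0 \<notin> convex hull P"
          obtain z where z: "z \<in> P" "z \<notin> r" using rP P(2) by auto
          then obtain \<omega> y where w: "\<omega> \<in> mu e" "y \<in> r" "z = \<omega> * y" using True unfolding satur_def
            by blast
          then have "\<omega> = 1" using sym_nc_short[OF V P(1) sh w(1), of y] z P(2) by auto
          then show False using w z by simp
        qed
        then have PZ: "P = Z" using config_long[OF c P(1)] by simp
        have "Y = {}"
        proof (rule ccontr)
          assume "Y \<noteq> {}"
          then obtain y where y: "y \<in> Y" by auto
          then have Yu: "Y \<in> U" using YU by auto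
          have "y \<in> satur r" using y YZ PZ True by auto
          then obtain \<omega> where w: "\<omega> \<in> mu e" "y \<in> rot \<omega> r" using satur_alt by auto
          then have "Y = rot \<omega> r" using sym_nc_eq[OF U Yu sym_nc_rot[OF U w(1) rU] y] by blast
          then have "r = rot (inverse \<omega>) Y" using rot_inverse(2)[OF w(1)] by simp
          then show False using rY mu_inverse[OF w(1)] by blast
        qed
        then show ?thesis using window_step[OF c _ d ref rU spans] lg True P PZ by auto
      qed
    qed
  qed
qed

text \<open>Each move raises \<open>rank\<close> by at least \<open>e\<close>, and
  \<open>rank\<close> is at most \<open>e * dm\<close>. This gives termination and, summed up, the
  bound on the number of reflections.\<close>

lemma chain:
  assumes c: "config V Z" and d: "config U Y" and ref: "refines U Y V Z"
  shows "\<exists>ts. set ts \<subseteq> refls e n \<and> (\<forall>t\<in>set ts. t * t = 1\<^sub>m dm) \<and>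
    rank V Z + e * length ts \<le> rank U Y \<and>
    (\<forall>g. acts g (succ_map V Z) \<longrightarrow> acts (g * mat_prod n ts) (succ_map U Y))"
  using c ref
proof (induction "e * dm - rank V Z" arbitrary: V Z rule: less_induct)
  case less
  show ?case
  proof (cases "U = V \<and> Y = Z")
    case True
    have "g * mat_prod n [] = g" if "acts g (succ_map V Z)" for g
      using that G_carrier[of g] by (simp add: acts_def mat_prod_simps)
    then show ?thesis using True by (intro exI[of _ "[]"]) auto
  next
    case False
    obtain V' Z' where s: "move V Z V' Z'" and ref': "refines U Y V' Z'"
      using refining_step[OF less.prems(1) d less.prems(2) False] by auto
    have c': "config V' Z'" and rank: "rank V Z + e \<le> rank V' Z'" using s by (auto simp: move_def)
    have "e * dm - rank V' Z' < e * dm - rank V Z" using rank rank_le[OF c'] N_pos(2) by linarith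
    then obtain ts where ts: "set ts \<subseteq> refls e n" "\<forall>t\<in>set ts. t * t = 1\<^sub>m dm" "rank V' Z' + e *
      length ts \<le> rank U Y"
      "\<And>g. acts g (succ_map V' Z') \<Longrightarrow> acts (g * mat_prod n ts) (succ_map U Y)"
        using less.hyps[OF _ c' ref'] by blast
    obtain x y where xy: "x \<in> Omega" "y \<in> Omega" "y / x \<notin> mu e" "\<And>z. z \<in> Omega \<Longrightarrow>
      succ_map V' Z' z = swap x y (succ_map V Z z)"
      using s by (auto simp: move_def)
    obtain t where t: "t \<in> refls e n" "t * t = 1\<^sub>m dm" "\<And>g \<phi>. acts g \<phi> \<Longrightarrow>
      acts (g * t) (swap x y \<circ> \<phi>)"
      using swap_refl[OF xy(1-3)] by auto
    have "acts (g * mat_prod n (t # ts)) (succ_map U Y)" if g: "acts g (succ_map V Z)" for g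
    proof -
      have "acts (g * t) (succ_map V' Z')" using t(3)[OF g] xy(4) x1_Omega by (auto simp: acts_def)
      then have "acts (g * t * mat_prod n ts) (succ_map U Y)" by (rule ts(4))
      moreover have "g * t * mat_prod n ts = g * (t * mat_prod n ts)"
        using g by (intro assoc_mult_mat[OF G_carrier refl_carrier[OF t(1)]
          mat_prod_carrier[OF ts(1)]]) (simp add: acts_def)
      ultimately show ?thesis by (simp add: mat_prod_simps)
    qed
    then show ?thesis using t ts rank by (intro exI[of _ "t # ts"]) auto
  qed
qed

section \<open>The interval below the Coxeter element\<close>

lemma refl_sq: "t \<in> refls e n \<Longrightarrow> t * t = 1\<^sub>m dm"
  using refl_mat_sq by (auto simp: refls_eq)

lemma top_acts: "acts (c_elt e n) (succ_map {mu N} (mu N))"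
  using c_acts top_succ_map x1_Omega by (auto simp: acts_def)

lemma top_refines: "config U Y \<Longrightarrow> refines U Y {mu N} (mu N)"
  unfolding refines_def using sym_nc_sub config_sub by (auto simp: config_def)

lemma singletons_refines: "config V Z \<Longrightarrow> refines singletons {} V Z"
  unfolding refines_def singletons_def config_def using sym_nc_ex by fastforce

lemma acts_singletons: assumes "acts g (succ_map singletons {})" shows "g = 1\<^sub>m dm"
proof (rule G_x0_inj)
  show gG: "g \<in> G_ee e n" "1\<^sub>m dm \<in> G_ee e n" using assms G_one by (auto simp: acts_def)
  fix i assume i: "i < dm"
  have "(g *\<^sub>v x0 e n) $ i = coord (x0 e n) (succ_map singletons {} (x1 $ i))"
    by (rule coord_acts[OF assms x0_eq(2) i])
  also have "\<dots> = x0 e n $ i" using singletons_succ_map[OF x1_Omega[OF i]] coord_eq[OF i mu_one,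
    of "x0 e n"] by simp
  finally show "(g *\<^sub>v x0 e n) $ i = (1\<^sub>m dm *\<^sub>v x0 e n) $ i" using x0_eq(2) by simp
qed

lemma mat_prod_rev:
  assumes "set ts \<subseteq> refls e n" shows "mat_prod n ts * mat_prod n (rev ts) = 1\<^sub>m dm"
  using assms
proof (induction ts)
  case (Cons t ts)
  have t: "t \<in> refls e n" "set ts \<subseteq> refls e n" using Cons.prems by auto
  note tc = refl_carrier[OF t(1)] and pc = mat_prod_carrier[OF t(2)]
  have rc: "mat_prod n (rev ts) \<in> carrier_mat dm dm" using mat_prod_carrier[of "rev ts"] t(2)
    by simp
  have "mat_prod n (rev (t # ts)) = mat_prod n (rev ts) * t"
    using mat_prod_append[of "rev ts" "[t]"] t tc by (simp add: mat_prod_simps)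
  then have "mat_prod n (t # ts) * mat_prod n (rev (t # ts)) = (t * mat_prod n ts) * (mat_prod n
    (rev ts) * t)"
    by (simp add: mat_prod_simps)
  also have "\<dots> = t * (mat_prod n ts * (mat_prod n (rev ts) * t))"
    by (rule assoc_mult_mat[OF tc pc mult_carrier_mat[OF rc tc]])
  also have "mat_prod n ts * (mat_prod n (rev ts) * t) = (mat_prod n ts * mat_prod n (rev ts)) * t"
    by (rule assoc_mult_mat[OF pc rc tc, symmetric])
  also have "\<dots> = t" using Cons.IH[OF t(2)] tc by simp
  also have "t * t = 1\<^sub>m dm" by (rule refl_sq[OF t(1)])
  finally show ?case .
qed (simp add: mat_prod_simps)

lemma config_factorisation:
  assumes d: "config U Y"
  shows "\<exists>ss ts. set ss \<subseteq> refls e n \<and> set ts \<subseteq> refls e n \<and> length ss + length ts \<le> dm \<and>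
    mat_prod n (ss @ ts) = c_elt e n \<and> acts (mat_prod n ss) (succ_map U Y)"
proof -
  obtain ts where ts: "set ts \<subseteq> refls e n" "rank {mu N} (mu N) + e * length ts \<le> rank U Y"
    "\<And>g. acts g (succ_map {mu N} (mu N)) \<Longrightarrow> acts (g * mat_prod n ts) (succ_map U Y)"
    using chain[OF top_config d top_refines[OF d]] by blast
  obtain ss where ss: "set ss \<subseteq> refls e n" "rank U Y + e * length ss \<le> rank singletons {}"
    "\<And>g. acts g (succ_map U Y) \<Longrightarrow> acts (g * mat_prod n ss) (succ_map singletons {})"
    using chain[OF d singletons_config singletons_refines[OF d]] by blast
  \<comment> \<open>\<open>h\<close> is reached from \<open>c_elt e n\<close> by multiplying with
    \<open>ts\<close>, and multiplying with \<open>ss\<close> leads on to 1. Reflections are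
    involutions, so the reversed lists are factorisations of \<open>h\<close> and of the rest of
    \<open>c_elt e n\<close>.\<close>
  define h where "h = c_elt e n * mat_prod n ts"
  have h: "acts h (succ_map U Y)" unfolding h_def by (rule ts(3)[OF top_acts])
  have cc: "c_elt e n \<in> carrier_mat dm dm" using top_acts G_carrier by (auto simp: acts_def)
  have hc: "h \<in> carrier_mat dm dm" using h G_carrier by (auto simp: acts_def)
  have rss: "set (rev ss) \<subseteq> refls e n" and rts: "set (rev ts) \<subseteq> refls e n" using ss ts by auto
  note pts = mat_prod_carrier[OF ts(1)] and pss = mat_prod_carrier[OF ss(1)]
  note prts = mat_prod_carrier[OF rts] and prss = mat_prod_carrier[OF rss]
  have "h * mat_prod n ss = 1\<^sub>m dm" using acts_singletons ss(3)[OF h] by simp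
  then have "(h * mat_prod n ss) * mat_prod n (rev ss) = mat_prod n (rev ss)" using prss by simp
  then have hr: "h = mat_prod n (rev ss)"
    unfolding assoc_mult_mat[OF hc pss prss] mat_prod_rev[OF ss(1)] using hc by simp
  have "h * mat_prod n (rev ts) = c_elt e n"
    unfolding h_def assoc_mult_mat[OF cc pts prts] mat_prod_rev[OF ts(1)] using cc by simp
  then have "mat_prod n (rev ss @ rev ts) = c_elt e n"
    using mat_prod_append[OF rss rts] hr by simp
  \<comment> \<open>The two rank bounds are added, and the rank of the partition into points is at
    most \<open>e * dm\<close>.\<close>
  moreover have "e * (length ss + length ts) \<le> e * dm"
    using ts(2) ss(2) rank_le[OF singletons_config] by (simp add: algebra_simps)
  then have "length ss + length ts \<le> dm" using mult_le_cancel1[of e] N_pos(2)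
    by (metis not_gr0 mult_le_cancel1)
  ultimately show ?thesis using rss rts h hr by (intro exI[of _ "rev ss"] exI[of _ "rev ts"]) auto
qed

text \<open>\<open>config_factorisation\<close> provides a factorisation with at most
  \<open>dm\<close> factors, and by \<open>c_factorisation\<close> none is shorter than
  \<open>dm\<close>.\<close>

lemma Red_c:
  "ts \<in> Red_T e n (c_elt e n) \<longleftrightarrow> set ts \<subseteq> refls e n \<and> mat_prod n ts = c_elt e n \<and> length ts = dm"
proof
  obtain ss vs where sv: "set ss \<subseteq> refls e n" "set vs \<subseteq> refls e n" "length ss + length vs \<le> dm"
    "mat_prod n (ss @ vs) = c_elt e n" using config_factorisation[OF top_config] by blast
  define us where "us = ss @ vs"
  have us: "set us \<subseteq> refls e n" "mat_prod n us = c_elt e n" "length us \<le> dm" using sv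
    by (auto simp: us_def)
  assume "ts \<in> Red_T e n (c_elt e n)"
  then have ts: "set ts \<subseteq> refls e n" "mat_prod n ts = c_elt e n" "length ts \<le> dm"
    using us unfolding Red_T_def by (auto dest: spec[of _ us])
  then show "set ts \<subseteq> refls e n \<and> mat_prod n ts = c_elt e n \<and> length ts = dm"
    using c_factorisation[OF ts] by simp
next
  assume ts: "set ts \<subseteq> refls e n \<and> mat_prod n ts = c_elt e n \<and> length ts = dm"
  have "dm \<le> length us" if "set us \<subseteq> refls e n" "mat_prod n us = c_elt e n" for us
    using c_factorisation[OF that] by linarith
  then show "ts \<in> Red_T e n (c_elt e n)" using ts unfolding Red_T_def by auto
qed

lemma P_G_iff: "g \<in> P_G e n \<longleftrightarrow> (\<exists>V Z. config V Z \<and> acts g (succ_map V Z))"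
proof
  assume "g \<in> P_G e n"
  then obtain V Z where c: "config V Z" and g: "g = g_elt e n (partition_of V Z)"
    by (auto simp: P_G_def NCP_ee_eq)
  \<comment> \<open>An element that acts as the successor map has to exist before the definite
    description in \<open>g_elt\<close> can be evaluated.\<close>
  obtain h where "acts h (succ_map V Z)" using config_factorisation[OF c] by blast
  then show "\<exists>V Z. config V Z \<and> acts g (succ_map V Z)" using c g g_elt_build by metis
next
  assume "\<exists>V Z. config V Z \<and> acts g (succ_map V Z)"
  then show "g \<in> P_G e n" unfolding P_G_def NCP_ee_eq using g_elt_build
    by (metis (mono_tags, lifting) CollectI imageI)
qed

text \<open>Descends from the full product: passing to the next shorter prefix is one application of
  \<open>refl_below\<close>.\<close>

lemma prefix_acts:
  assumes ts: "set ts \<subseteq> refls e n" "mat_prod n ts = c_elt e n" "length ts = dm" and l: "l \<le> dm"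
  shows "\<exists>V Z. config V Z \<and> acts (mat_prod n (take l ts)) (succ_map V Z)"
  using l
proof (induction l rule: inc_induct)
  case base
  then show ?case using top_config top_acts ts by auto
next
  case (step l)
  have l: "l < dm" using step by simp
  obtain V Z where c: "config V Z" and a: "acts (mat_prod n (take (Suc l) ts)) (succ_map V Z)"
    using step by auto
  define t where "t = ts ! l"
  have t: "t \<in> refls e n" using ts l by (auto simp: t_def)
  have tk: "set (take l ts) \<subseteq> refls e n" using ts set_take_subset[of l ts] by blast
  note tc = refl_carrier[OF t] and pc = mat_prod_carrier[OF tk]
  have "mat_prod n (take (Suc l) ts) = mat_prod n (take l ts) * t"
    using mat_prod_append[OF tk, of "[t]"] t tc ts l
      by (simp add: take_Suc_conv_app_nth t_def mat_prod_simps)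
  then have eq: "mat_prod n (take (Suc l) ts) * t = mat_prod n (take l ts)"
    using assoc_mult_mat[OF pc tc tc] refl_sq[OF t] pc by simp
  obtain x y where xy: "x \<in> Omega" "y \<in> Omega" "y / x \<notin> mu e"
    and act: "\<And>g \<phi>. acts g \<phi> \<Longrightarrow> acts (g * t) (swap x y \<circ> \<phi>)"
    and fx: "\<And>v. v \<in> carrier_vec dm \<Longrightarrow> t *\<^sub>v v = v \<longleftrightarrow> coord v x = coord v y"
    using refl_swap[OF t] by blast
  have al: "acts (mat_prod n (take l ts)) (swap x y \<circ> succ_map V Z)" using act[OF a] eq by simp
  \<comment> \<open>This is where independence of the linear forms enters; the coordinates of
    \<open>v\<close> are the function \<open>F\<close> of \<open>refl_below\<close>.\<close>
  obtain v where v: "v \<in> carrier_vec dm" "\<And>k. k < l \<Longrightarrow> ts ! k *\<^sub>v v = v" "t *\<^sub>v v \<noteq> v"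
    using c_factorisation[OF ts(1,2)] ts(3) l by (auto simp: t_def)
  have fixv: "mat_prod n (take l ts) *\<^sub>v v = v"
    by (rule mat_prod_fix[OF tk v(1)]) (use v(2) in \<open>auto simp: in_set_conv_nth\<close>)
  have "coord v (swap x y (succ_map V Z z)) = coord v z" if z: "z \<in> Omega" for z
  proof -
    obtain i \<alpha> where i: "i < dm" "\<alpha> \<in> mu e" "z = \<alpha> * x1 $ i" using Omega_ex[OF z] by auto
    note xO = x1_Omega[OF i(1)]
    have "coord v (swap x y (succ_map V Z (x1 $ i))) = v $ i"
      using coord_acts[OF al v(1) i(1)] fixv by simp
    moreover have "swap x y (succ_map V Z z) = \<alpha> * swap x y (succ_map V Z (x1 $ i))"
      unfolding i(3) succ_map_rot[OF c i(2) xO] swap_rot[OF i(2)] ..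
    ultimately show ?thesis
      using coord_rot[OF i(2) swap_Omega[OF xy(1,2) succ_map_Omega[OF c xO]]] coord_eq[OF i(1,2)]
        i(3) by simp
  qed
  then obtain V' Z' where c': "config V' Z'" and p': "\<forall>z\<in>Omega. succ_map V' Z' z = swap x y
    (succ_map V Z z)"
    using refl_below[OF c xy, of "coord v"] coord_rot fx[OF v(1)] v(3) by blast
  have "acts (mat_prod n (take l ts)) (succ_map V' Z')" using al x1_Omega p'
    by (auto simp: acts_def)
  then show ?case using c' by blast
qed

lemma P_G_iff_le: "g \<in> P_G e n \<longleftrightarrow> le_T e n g (c_elt e n)"
proof
  assume "g \<in> P_G e n"
  then obtain V Z where c: "config V Z" and g: "acts g (succ_map V Z)" by (auto simp: P_G_iff)
  obtain ss ts where ss: "set ss \<subseteq> refls e n" "set ts \<subseteq> refls e n" "length ss + length ts \<le> dm"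
    "mat_prod n (ss @ ts) = c_elt e n" "acts (mat_prod n ss) (succ_map V Z)"
      using config_factorisation[OF c] by auto
  \<comment> \<open>Both elements act as the same successor map, so both are the value of
    \<open>g_elt\<close>.\<close>
  have "g = mat_prod n ss" using g_elt_build[OF c g] g_elt_build[OF c ss(5)] by simp
  moreover have "length (ss @ ts) = dm" using c_factorisation[of "ss @ ts"] ss by auto
  then have "ss @ ts \<in> Red_T e n (c_elt e n)" unfolding Red_c using ss by auto
  ultimately show "le_T e n g (c_elt e n)" unfolding le_T_def
    by (intro bexI[of _ "ss @ ts"] exI[of _ "length ss"]) auto
next
  assume "le_T e n g (c_elt e n)"
  then obtain ts l where "ts \<in> Red_T e n (c_elt e n)" "l \<le> length ts" "g = mat_prod n (take l ts)"
    by (auto simp: le_T_def)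
  then show "g \<in> P_G e n" unfolding P_G_iff Red_c using prefix_acts by auto
qed

end

theorem proposition4p4:
  fixes e n :: nat
  assumes "e \<ge> 2" and "n \<ge> 1"
  shows "\<forall>g \<in> G_ee e n. g \<in> P_G e n \<longleftrightarrow> le_T e n g (c_elt e n)"
proof -
  interpret refl_group e n by unfold_locales (use assms in auto)
  show ?thesis using P_G_iff_le by blast
qed

end
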